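(* Let $F=\mathbb{C}$ or $F=\mathbb{R}$, and let $L$ be an indecomposable solvable (left) Leibniz algebra over $F$ whose nilradical is the $3$-dimensional Heisenberg algebra $H(1)$, with $L\ne\operatorname{nilrad}(L)$. Then $\dim L\in\{4,5\}$, and $L$ is isomorphic to one of the algebras listed below. In every case the basis of the nilradical is $\{H,P,B\}$ with $[P,B]=-[B,P]=H$ and all other products among $H,P,B$ zero; and for each additional basis element $S$ (or $S_1,S_2$) one has $[x,S]=-[S,x]$ for all $x\in\operatorname{span}\{H,P,B\}$. Dimension 4 (basis $\{S,H,P,B\}$): (1) $[S,S]=0$, $[S,H]=2H$, $[S,P]=(1+A)P$, $[S,B]=(1-A)B$, where $A\ge 0$. (2) $[S,S]=0$, $[S,H]=2H$, $[S,P]=P+B$, $[S,B]=B$. (3) (listed as a separate class only for $F=\mathbb{R}$) $[S,S]=0$, $[S,H]=2H$, $[S,P]=P+CB$, $[S,B]=-CP+B$, where $C>0$. (4) $[S,S]=rH$, $[S,H]=0$, $[S,P]=P$, $[S,B]=-B$, where $r\in\{0,1\}$ if $F=\mathbb{C}$ and $r\in\{0,1,-1\}$ if $F=\mathbb{R}$. (5) (listed as a separate class only for $F=\mathbb{R}$) $[S,S]=rH$, $[S,H]=0$, $[S,P]=B$, $[S,B]=-P$, where $r\in\{0,1,-1\}$. Dimension 5 (basis $\{S_1,S_2,H,P,B\}$, with $[S_\alpha,S_\beta]=0$ for all $\alpha,\beta\in\{1,2\}$): (6) $[S_1,H]=2H$, $[S_1,P]=P$, $[S_1,B]=B$; $[S_2,H]=0$,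 $[S_2,P]=P$, $[S_2,B]=-B$. (7) (listed as a separate class only for $F=\mathbb{R}$) $[S_1,H]=2H$, $[S_1,P]=P$, $[S_1,B]=B$; $[S_2,H]=0$, $[S_2,P]=B$, $[S_2,B]=-P$. In particular, if $\dim L=5$ then $L$ is a Lie algebra. Moreover: (1) and (2) represent two distinct classes of algebras over $\mathbb{C}$, and (1), (2), (3) represent three distinct classes over $\mathbb{R}$, while over $\mathbb{C}$ the algebras (1) and (3) condense to just one case. For $r=0$, (4) represents the only class over $\mathbb{C}$ among (4) and (5), and (4) and (5) represent two distinct classes over $\mathbb{R}$; over $\mathbb{C}$ these two condense to just one case. In dimension 5, (6) represents the only class over $\mathbb{C}$, and (6) and (7) represent two distinct classes over $\mathbb{R}$; over $\mathbb{C}$ these two condense to just one case.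
   Context: A (left) Leibniz algebra over $F$ is a (finite-dimensional) vector space $L$ over $F$ with a bilinear product $[\cdot,\cdot]$ satisfying $[x,[y,z]]=[[x,y],z]+[y,[x,z]]$ for all $x,y,z\in L$. It is a Lie algebra if in addition $[x,y]=-[y,x]$ for all $x,y$. $L$ is solvable if its derived series $L^{(1)}=[L,L]$, $L^{(k+1)}=[L^{(k)},L^{(k)}]$ reaches $0$; it is nilpotent if its lower central series $L^2=[L,L]$, $L^{k+1}=[L,L^k]$ reaches $0$. The nilradical $\operatorname{nilrad}(L)$ is the unique maximal nilpotent (two-sided) ideal of $L$. $L$ is indecomposable if it is not the direct sum of two nonzero ideals. The Heisenberg algebra $H(1)$ is the $3$-dimensional Lie algebra with basis $\{H,P,B\}$ and products $[P,B]=-[B,P]=H$, all other products of basis elements being zero.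
   Formalization: Over ℂ, "A ≥ 0" in (1) is read as complex A normalised up to sign (Re A > 0, or Re A = 0 and Im A ≥ 0), since with real A the list over ℂ is incomplete (e.g. A = 1+i); likewise "C > 0" in (3) over ℂ means nonzero C so normalised. *)

theory Defs
  imports "HOL-Analysis.Analysis"
begin

section \<open>Left Leibniz algebras\<close>

locale leibniz_algebra = vector_space scale
  for scale :: "'f::field \<Rightarrow> 'v::ab_group_add \<Rightarrow> 'v" +
  fixes br :: "'v \<Rightarrow> 'v \<Rightarrow> 'v"
  assumes finite_dimensional: "\<exists>X. finite X \<and> span X = UNIV"
    and linear_left: "Vector_Spaces.linear scale scale (\<lambda>x. br x y)"
    and linear_right: "Vector_Spaces.linear scale scale (\<lambda>y. br x y)"
    and leibniz: "br x (br y z) = br (br x y) z + br y (br x z)"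
begin

definition lie :: bool where
  "lie \<longleftrightarrow> (\<forall>x y. br x y = - br y x)"

definition brspan :: "'v set \<Rightarrow> 'v set \<Rightarrow> 'v set" where
  "brspan X Y = span {br x y | x y. x \<in> X \<and> y \<in> Y}"

definition ideal :: "'v set \<Rightarrow> bool" where
  "ideal I \<longleftrightarrow> subspace I \<and> (\<forall>x. \<forall>y\<in>I. br x y \<in> I \<and> br y x \<in> I)"

primrec derived_series :: "nat \<Rightarrow> 'v set" where
  "derived_series 0 = UNIV"
| "derived_series (Suc k) = brspan (derived_series k) (derived_series k)"

definition solvable :: bool where
  "solvable \<longleftrightarrow> (\<exists>k. derived_series k = {0})"

text \<open>The set \<open>lower_central_series M k\<close> is usually written \<open>M\<^sup>k\<^sup>+\<^sup>1\<close>.\<close>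

primrec lower_central_series :: "'v set \<Rightarrow> nat \<Rightarrow> 'v set" where
  "lower_central_series M 0 = M"
| "lower_central_series M (Suc k) = brspan M (lower_central_series M k)"

definition nilpotent_ideal :: "'v set \<Rightarrow> bool" where
  "nilpotent_ideal I \<longleftrightarrow> ideal I \<and> (\<exists>k. lower_central_series I k = {0})"

definition maximal_nilpotent_ideal :: "'v set \<Rightarrow> bool" where
  "maximal_nilpotent_ideal N \<longleftrightarrow>
     nilpotent_ideal N \<and> (\<forall>M. nilpotent_ideal M \<and> N \<subseteq> M \<longrightarrow> M = N)"

definition is_nilradical :: "'v set \<Rightarrow> bool" where
  "is_nilradical N \<longleftrightarrow>
     maximal_nilpotent_ideal N \<and> (\<forall>M. maximal_nilpotent_ideal M \<longrightarrow> M = N)"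

definition indecomposable :: bool where
  "indecomposable \<longleftrightarrow>
     \<not> (\<exists>I J. ideal I \<and> ideal J \<and> I \<noteq> {0} \<and> J \<noteq> {0} \<and>
          I \<inter> J = {0} \<and> {x + y | x y. x \<in> I \<and> y \<in> J} = UNIV)"

end

definition isomorphic_onto ::
  "('f::field \<Rightarrow> 'v::ab_group_add \<Rightarrow> 'v) \<Rightarrow> ('v \<Rightarrow> 'v \<Rightarrow> 'v) \<Rightarrow>
   ('f \<Rightarrow> 'w::ab_group_add \<Rightarrow> 'w) \<Rightarrow> ('w \<Rightarrow> 'w \<Rightarrow> 'w) \<Rightarrow> 'w set \<Rightarrow> bool" where
  "isomorphic_onto s1 b1 s2 b2 N \<longleftrightarrow>
     (\<exists>f. Vector_Spaces.linear s1 s2 f \<and> bij_betw f UNIV N \<and>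
          (\<forall>x y. f (b1 x y) = b2 (f x) (f y)))"

abbreviation isomorphic ::
  "('f::field \<Rightarrow> 'v::ab_group_add \<Rightarrow> 'v) \<Rightarrow> ('v \<Rightarrow> 'v \<Rightarrow> 'v) \<Rightarrow>
   ('f \<Rightarrow> 'w::ab_group_add \<Rightarrow> 'w) \<Rightarrow> ('w \<Rightarrow> 'w \<Rightarrow> 'w) \<Rightarrow> bool" where
  "isomorphic s1 b1 s2 b2 \<equiv> isomorphic_onto s1 b1 s2 b2 UNIV"


section \<open>Coordinate algebras given by multiplication tables\<close>

definition bilinear_ext :: "('i \<Rightarrow> 'i \<Rightarrow> 'f::field ^ 'i) \<Rightarrow> 'f ^ 'i \<Rightarrow> 'f ^ 'i \<Rightarrow> 'f ^ 'i::finite" where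
  "bilinear_ext T x y = (\<Sum>i\<in>UNIV. \<Sum>j\<in>UNIV. (x $ i * y $ j) *s T i j)"

datatype heis_index = iH | iP | iB

instance heis_index :: finite
proof
  have "(UNIV :: heis_index set) = {iH, iP, iB}"
    using heis_index.exhaust by auto
  then show "finite (UNIV :: heis_index set)"
    by (metis finite.emptyI finite_insert)
qed

abbreviation eH :: "'f::field ^ heis_index" where "eH \<equiv> axis iH 1"
abbreviation eP :: "'f::field ^ heis_index" where "eP \<equiv> axis iP 1"
abbreviation eB :: "'f::field ^ heis_index" where "eB \<equiv> axis iB 1"

fun heis_table :: "heis_index \<Rightarrow> heis_index \<Rightarrow> 'f::field ^ heis_index" where
  "heis_table iP iB = eH"
| "heis_table iB iP = - eH"
| "heis_table _ _ = 0"

definition heis_br :: "'f::field ^ heis_index \<Rightarrow> 'f ^ heis_index \<Rightarrow> 'f ^ heis_index" where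
  "heis_br = bilinear_ext heis_table"

datatype one_outer = iS
datatype two_outer = iS1 | iS2

instance one_outer :: finite
proof
  have "(UNIV :: one_outer set) = {iS}"
    using one_outer.exhaust by auto
  then show "finite (UNIV :: one_outer set)"
    by (metis finite.emptyI finite_insert)
qed

instance two_outer :: finite
proof
  have "(UNIV :: two_outer set) = {iS1, iS2}"
    using two_outer.exhaust by auto
  then show "finite (UNIV :: two_outer set)"
    by (metis finite.emptyI finite_insert)
qed

text \<open>
  The space \<open>'f ^ ('s + heis_index)\<close> has basis \<open>S\<^sub>\<alpha>\<close> (index \<open>Inl \<alpha>\<close>) together with \<open>H, P, B\<close>
  (indices \<open>Inr iH, Inr iP, Inr iB\<close>).  In \<open>ext_table d r\<close> the vector \<open>d \<alpha> j\<close> is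
  \<open>[S\<^sub>\<alpha>, e\<^sub>j] = - [e\<^sub>j, S\<^sub>\<alpha>]\<close> and \<open>[S\<^sub>\<alpha>, S\<^sub>\<beta>] = r \<alpha> \<beta> H\<close>.
\<close>

definition heis_incl :: "'f::field ^ heis_index \<Rightarrow> 'f ^ ('s::finite + heis_index)" where
  "heis_incl v = (\<chi> i. case i of Inl _ \<Rightarrow> 0 | Inr j \<Rightarrow> v $ j)"

fun ext_table ::
  "('s \<Rightarrow> heis_index \<Rightarrow> 'f::field ^ heis_index) \<Rightarrow> ('s \<Rightarrow> 's \<Rightarrow> 'f) \<Rightarrow>
   's + heis_index \<Rightarrow> 's + heis_index \<Rightarrow> 'f ^ ('s::finite + heis_index)" where
  "ext_table d r (Inl a) (Inl b) = heis_incl (r a b *s eH)"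
| "ext_table d r (Inl a) (Inr j) = heis_incl (d a j)"
| "ext_table d r (Inr j) (Inl a) = - heis_incl (d a j)"
| "ext_table d r (Inr j) (Inr k) = heis_incl (heis_table j k)"

definition ext_br ::
  "('s::finite \<Rightarrow> heis_index \<Rightarrow> 'f::field ^ heis_index) \<Rightarrow> ('s \<Rightarrow> 's \<Rightarrow> 'f) \<Rightarrow>
   'f ^ ('s + heis_index) \<Rightarrow> 'f ^ ('s + heis_index) \<Rightarrow> 'f ^ ('s + heis_index)" where
  "ext_br d r = bilinear_ext (ext_table d r)"

definition span_HPB :: "('f::field ^ ('s::finite + heis_index)) set" where
  "span_HPB = vec.span {axis (Inr iH) 1, axis (Inr iP) 1, axis (Inr iB) 1}"


section \<open>The listed algebras\<close>

type_synonym 'f space4 = "'f ^ (one_outer + heis_index)"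
type_synonym 'f space5 = "'f ^ (two_outer + heis_index)"

fun act1 :: "'f::field \<Rightarrow> one_outer \<Rightarrow> heis_index \<Rightarrow> 'f ^ heis_index" where
  "act1 A iS iH = 2 *s eH"
| "act1 A iS iP = (1 + A) *s eP"
| "act1 A iS iB = (1 - A) *s eB"

fun act2 :: "one_outer \<Rightarrow> heis_index \<Rightarrow> 'f::field ^ heis_index" where
  "act2 iS iH = 2 *s eH"
| "act2 iS iP = eP + eB"
| "act2 iS iB = eB"

fun act3 :: "'f::field \<Rightarrow> one_outer \<Rightarrow> heis_index \<Rightarrow> 'f ^ heis_index" where
  "act3 C iS iH = 2 *s eH"
| "act3 C iS iP = eP + C *s eB"
| "act3 C iS iB = - (C *s eP) + eB"

fun act4 :: "one_outer \<Rightarrow> heis_index \<Rightarrow> 'f::field ^ heis_index" where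
  "act4 iS iH = 0"
| "act4 iS iP = eP"
| "act4 iS iB = - eB"

fun act5 :: "one_outer \<Rightarrow> heis_index \<Rightarrow> 'f::field ^ heis_index" where
  "act5 iS iH = 0"
| "act5 iS iP = eB"
| "act5 iS iB = - eP"

fun act6 :: "two_outer \<Rightarrow> heis_index \<Rightarrow> 'f::field ^ heis_index" where
  "act6 iS1 iH = 2 *s eH"
| "act6 iS1 iP = eP"
| "act6 iS1 iB = eB"
| "act6 iS2 iH = 0"
| "act6 iS2 iP = eP"
| "act6 iS2 iB = - eB"

fun act7 :: "two_outer \<Rightarrow> heis_index \<Rightarrow> 'f::field ^ heis_index" where
  "act7 iS1 iH = 2 *s eH"
| "act7 iS1 iP = eP"
| "act7 iS1 iB = eB"
| "act7 iS2 iH = 0"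
| "act7 iS2 iP = eB"
| "act7 iS2 iB = - eP"

definition br1 :: "'f::field \<Rightarrow> 'f space4 \<Rightarrow> 'f space4 \<Rightarrow> 'f space4" where
  "br1 A = ext_br (act1 A) (\<lambda>_ _. 0)"

definition br2 :: "'f::field space4 \<Rightarrow> 'f space4 \<Rightarrow> 'f space4" where
  "br2 = ext_br act2 (\<lambda>_ _. 0)"

definition br3 :: "'f::field \<Rightarrow> 'f space4 \<Rightarrow> 'f space4 \<Rightarrow> 'f space4" where
  "br3 C = ext_br (act3 C) (\<lambda>_ _. 0)"

definition br4 :: "'f::field \<Rightarrow> 'f space4 \<Rightarrow> 'f space4 \<Rightarrow> 'f space4" where
  "br4 r = ext_br act4 (\<lambda>_ _. r)"

definition br5 :: "'f::field \<Rightarrow> 'f space4 \<Rightarrow> 'f space4 \<Rightarrow> 'f space4" where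
  "br5 r = ext_br act5 (\<lambda>_ _. r)"

definition br6 :: "'f::field space5 \<Rightarrow> 'f space5 \<Rightarrow> 'f space5" where
  "br6 = ext_br act6 (\<lambda>_ _. 0)"

definition br7 :: "'f::field space5 \<Rightarrow> 'f space5 \<Rightarrow> 'f space5" where
  "br7 = ext_br act7 (\<lambda>_ _. 0)"

text \<open>
  Over the complex numbers the parameter of the first family is complex: the algebras with
  parameters \<open>A\<close> and \<open>- A\<close> are isomorphic, \<open>A\<^sup>2\<close> is an isomorphism invariant and takes every
  complex value.  There the normalisation \<open>A \<ge> 0\<close> is read as the choice of one of \<open>A, - A\<close>, namely
  the one in the range of the principal square root; on real \<open>A\<close> this is the usual \<open>A \<ge> 0\<close>.
\<close>

definition complex_nonneg :: "complex \<Rightarrow> bool" where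
  "complex_nonneg A \<longleftrightarrow> 0 < Re A \<or> (Re A = 0 \<and> 0 \<le> Im A)"

definition complex_pos :: "complex \<Rightarrow> bool" where
  "complex_pos C \<longleftrightarrow> complex_nonneg C \<and> C \<noteq> 0"

definition indecomposable_solvable_with_nilradical_H1 ::
  "('f::field \<Rightarrow> 'v::ab_group_add \<Rightarrow> 'v) \<Rightarrow> ('v \<Rightarrow> 'v \<Rightarrow> 'v) \<Rightarrow> 'v set \<Rightarrow> bool" where
  "indecomposable_solvable_with_nilradical_H1 s br N \<longleftrightarrow>
     leibniz_algebra s br \<and>
     leibniz_algebra.indecomposable s br \<and>
     leibniz_algebra.solvable s br \<and>
     leibniz_algebra.is_nilradical s br N \<and>
     isomorphic_onto (*s) heis_br s br N \<and>
     N \<noteq> UNIV"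

end

theory Submission
  imports Defs
begin

text \<open>
  Let \<open>N = H(1)\<close> be the nilradical and let \<open>x \<in> L\<close> act on \<open>N / F H\<close> by the \<open>2 \<times> 2\<close> matrix \<open>M\<^sub>x\<close> of
  \<open>[x, -]\<close>; then \<open>[x, H] = tr(M\<^sub>x) H\<close>. Since \<open>L\<close> is solvable and every nilpotent ideal lies in \<open>N\<close>, the
  kernel of \<open>x \<mapsto> M\<^sub>x\<close> is \<open>N\<close>. An ideal of \<open>L\<close> cannot be generated modulo \<open>N\<close> by one element with
  nilpotent matrix, and this forces the matrices to commute and their nonzero members not to be
  nilpotent. Hence \<open>L / N\<close> has dimension at most two and contains an element acting as the identity
  when the dimension is two. The left centre of \<open>L\<close>, which contains all squares, is an abelian ideal
  and hence lies in \<open>F H\<close>; this yields \<open>[x, n] = - [n, x]\<close> for \<open>n \<in> N\<close>. What remains is to normalise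
  one matrix up to similarity and scaling.

  An isomorphism between two listed algebras respects \<open>N\<close>, the set of all \<open>x\<close> with \<open>[x, -]\<^sup>3 = 0\<close>,
  and \<open>F H = [N, N]\<close>, hence the trace and the determinant of \<open>M\<^sub>x\<close>.
\<close>

section \<open>Leibniz algebras with a given basis\<close>

text \<open>The two fields differ only in which square roots exist, so the reduction is carried out
  over any field of characteristic 0. Matrices cannot be triangularised there, and the matrix
  arguments become identities between four entries. Normalisation goes through the companion matrix
  of a cyclic vector, which exists over every field; trace and determinant remain as two scalars,
  and the root that leads to a listed table is left as a hypothesis. If the trace is nonzero,
  rescaling the outer element makes it 2, and a root of the discriminant, or of its negative,
  becomes \<open>A\<close> or \<open>C\<close>. If the trace is zero, rescaling makes the
  determinant -1 or 1. The coefficient \<open>r\<close> in [S,S] = rH is annihilated by every trace,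
  so it can survive only in the second case. A change of basis of the nilradical multiplies H by its
  determinant, and this factor is what normalises \<open>r\<close>.\<close>

context leibniz_algebra
begin

lemma br_add_left: "br (x + y) z = br x z + br y z"
  and br_scale_left: "br (scale c x) z = scale c (br x z)"
  using linear_left[of z] by (auto simp: Vector_Spaces.linear_iff)

lemma br_add_right: "br z (x + y) = br z x + br z y"
  and br_scale_right: "br z (scale c x) = scale c (br z x)"
  using linear_right[of z] by (auto simp: Vector_Spaces.linear_iff)

lemma br_zero_left [simp]: "br 0 z = 0"
  using br_scale_left[of 0 0 z] by simp

lemma br_zero_right [simp]: "br z 0 = 0"
  using br_scale_right[of z 0 0] by simp

lemma br_minus_left: "br (- x) z = - br x z"
  using br_scale_left[of "-1" x z] by simp

lemma br_minus_right: "br z (- x) = - br z x"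
  using br_scale_right[of z "-1" x] by simp

lemma br_diff_left: "br (x - y) z = br x z - br y z"
  using br_add_left[of x "- y" z] by (simp add: br_minus_left)

lemma br_diff_right: "br z (x - y) = br z x - br z y"
  using br_add_right[of z x "- y"] by (simp add: br_minus_right)

lemma br_sum_left: "br (\<Sum>i\<in>I. f i) z = (\<Sum>i\<in>I. br (f i) z)"
  by (induction I rule: infinite_finite_induct) (auto simp: br_add_left)

lemma br_sum_right: "br z (\<Sum>i\<in>I. f i) = (\<Sum>i\<in>I. br z (f i))"
  by (induction I rule: infinite_finite_induct) (auto simp: br_add_right)

lemmas br_bilinear = br_add_left br_add_right br_scale_left br_scale_right br_minus_left
  br_minus_right br_diff_left br_diff_right

lemma leibniz_left: "br (br x y) z = br x (br y z) - br y (br x z)"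
  using leibniz[of x y z] by simp

text \<open>Coordinates refer to an indexed family, so that \<open>bij (comb e)\<close> expresses
  that \<open>e\<close> is a basis without repetitions.\<close>

definition comb :: "('i::finite \<Rightarrow> 'v) \<Rightarrow> 'f ^ 'i \<Rightarrow> 'v" where
  "comb e x = (\<Sum>i\<in>UNIV. scale (x $ i) (e i))"

lemma linear_comb: "Vector_Spaces.linear (*s) scale (comb e)"
proof -
  have "comb e (x + y) = comb e x + comb e y" for x y
    by (simp add: comb_def scale_left_distrib sum.distrib)
  moreover have "comb e (c *s x) = scale c (comb e x)" for c x
    by (simp add: comb_def scale_sum_right)
  ultimately show ?thesis
    by (simp add: Vector_Spaces.linear_iff vec.vector_space_axioms vector_space_axioms)
qed

lemma comb_axis [simp]:
  fixes e :: "'i::finite \<Rightarrow> 'v"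
  shows "comb e (axis i 1) = e i"
proof -
  have "scale ((axis i 1 :: 'f ^ 'i) $ j) (e j) = (if j = i then e i else 0)" for j
    by (simp add: axis_def)
  then show ?thesis
    by (simp add: comb_def)
qed

text \<open>Both brackets are bilinear, so agreement on pairs of basis vectors suffices; the
  isomorphism is the coordinate map inverse to \<open>comb e\<close>.\<close>

lemma isomorphic_bilinear_ext:
  assumes bij: "bij (comb e)"
    and table: "\<And>i j. comb e (T i j) = br (e i) (e j)"
  shows "isomorphic scale br (*s) (bilinear_ext T)"
proof -
  interpret comb: Vector_Spaces.linear "(*s)" scale "comb e"
    by (rule linear_comb)
  let ?f = "inv (comb e)"
  have "?f (x + y) = ?f x + ?f y" for x y
    using bij by (metis bij_inv_eq_iff comb.add)
  moreover have "?f (scale c x) = c *s ?f x" for c x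
    using bij by (metis bij_inv_eq_iff comb.scale)
  ultimately have "Vector_Spaces.linear scale (*s) ?f"
    by (simp add: Vector_Spaces.linear_iff vec.vector_space_axioms vector_space_axioms)
  moreover have "?f (br x y) = bilinear_ext T (?f x) (?f y)" for x y
  proof -
    have "comb e (bilinear_ext T u v) = br (comb e u) (comb e v)" for u v
    proof -
      have "comb e (bilinear_ext T u v)
          = (\<Sum>i\<in>UNIV. \<Sum>j\<in>UNIV. scale (u $ i * v $ j) (br (e i) (e j)))"
        by (simp add: bilinear_ext_def comb.sum comb.scale table)
      also have "\<dots> = br (comb e u) (comb e v)"
        by (simp add: comb_def br_sum_left br_sum_right br_scale_left br_scale_right
            scale_sum_right)
           (subst sum.swap, simp add: mult.commute)
      finally show ?thesis .
    qed
    then show ?thesis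
      using bij by (metis bij_inv_eq_iff)
  qed
  ultimately show ?thesis
    unfolding isomorphic_onto_def using bij bij_imp_bij_inv by blast
qed

lemma dim_UNIV_eq_CARD:
  fixes e :: "'i::finite \<Rightarrow> 'v"
  assumes "bij (comb e)"
  shows "dim UNIV = CARD('i)"
proof -
  interpret comb: Vector_Spaces.linear "(*s)" scale "comb e"
    by (rule linear_comb)
  have inj: "inj (comb e)" and surj: "surj (comb e)"
    using assms by (auto simp: bij_def)
  have range: "range e = comb e ` range (\<lambda>i. axis i 1)"
    by (auto simp: image_iff)
  have cart: "range (\<lambda>i. axis i (1::'f)) = (cart_basis :: ('f ^ 'i) set)"
    by (auto simp: cart_basis_def)
  have "independent (range e)"
    unfolding range cart
    using comb.independent_inj_image[OF vec.independent_Basis] inj by blast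
  moreover have "span (range e) = UNIV"
    unfolding range cart comb.span_image using surj by simp
  moreover have "card (range e) = CARD('i)"
  proof (rule card_image)
    show "inj e"
      using inj by (metis (mono_tags, lifting) axis_eq_axis comb_axis injD injI zero_neq_one)
  qed
  ultimately show ?thesis
    by (metis dim_eq_card span_UNIV)
qed

end

section \<open>The action on the nilradical\<close>

context leibniz_algebra
begin

lemma brspan_subset:
  assumes "subspace S" and "\<And>x y. x \<in> X \<Longrightarrow> y \<in> Y \<Longrightarrow> br x y \<in> S"
  shows "brspan X Y \<subseteq> S"
  unfolding brspan_def using assms by (intro span_minimal) auto

lemma br_in_brspan: "x \<in> X \<Longrightarrow> y \<in> Y \<Longrightarrow> br x y \<in> brspan X Y"
  unfolding brspan_def by (rule span_base) auto

lemma zero_in_brspan: "0 \<in> brspan X Y"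
  unfolding brspan_def by (rule span_zero)

lemma subspace_brspan: "subspace (brspan X Y)"
  unfolding brspan_def by (rule subspace_span)

lemma ideal_brspan:
  assumes "ideal I"
  shows "ideal (brspan I I)"
proof -
  let ?S = "brspan I I"
  \<comment> \<open>Elements that all products keep inside \<open>?S\<close>. They form a subspace,
    so only the generators \<open>br a b\<close> need testing, and for these the Leibniz identity
    works on either side.\<close>
  let ?T = "{z \<in> ?S. \<forall>x. br x z \<in> ?S \<and> br z x \<in> ?S}"
  have sub: "subspace ?S"
    by (rule subspace_brspan)
  have "subspace ?T"
    using sub by (auto simp: subspace_def br_bilinear)
  moreover have "br a b \<in> ?T" if ab: "a \<in> I" "b \<in> I" for a b
  proof -
    have in_I: "br x y \<in> I" "br y x \<in> I" if "y \<in> I" for x y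
      using that assms by (auto simp: ideal_def)
    have "br x (br a b) \<in> ?S" for x
      unfolding leibniz[of x a b] using ab in_I sub by (intro subspace_add br_in_brspan) auto
    moreover have "br (br a b) x \<in> ?S" for x
      unfolding leibniz_left[of a b x] using ab in_I sub by (intro subspace_diff br_in_brspan) auto
    ultimately show ?thesis
      using ab br_in_brspan by auto
  qed
  ultimately have "?S \<subseteq> ?T"
    by (rule brspan_subset)
  then show ?thesis
    using sub by (auto simp: ideal_def)
qed

lemma ideal_derived_series: "ideal (derived_series k)"
proof (induction k)
  case 0
  show ?case
    by (simp add: ideal_def)
next
  case (Suc k)
  then show ?case
    by (simp add: ideal_brspan)
qed

text \<open>A nilpotent ideal of largest dimension among those containing \<open>I\<close> is
  maximal, and \<open>is_nilradical\<close> admits only one maximal nilpotent ideal. This avoids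
  sums of nilpotent ideals.\<close>

lemma nilpotent_ideal_subset_nilradical:
  assumes "is_nilradical N" and I: "nilpotent_ideal I"
  shows "I \<subseteq> N"
proof -
  obtain X where "finite X" "span X = UNIV"
    using finite_dimensional by blast
  then obtain B where B: "finite B" "independent B" "span B = UNIV"
    by (metis finite_subset maximal_independent_subset span_minimal span_span subspace_span
        subset_UNIV top.extremum_uniqueI)
  interpret fin: finite_dimensional_vector_space scale B
    using B by unfold_locales auto
  let ?P = "\<lambda>M. nilpotent_ideal M \<and> I \<subseteq> M"
  have "\<exists>M. ?P M \<and> (\<forall>M'. ?P M' \<longrightarrow> dim M' \<le> dim M)"
    by (rule ex_has_greatest_nat[where k = I and b = "card B + 1"])
       (use I fin.dim_subset_UNIV in \<open>auto simp: less_Suc_eq_le fin.dimension_def\<close>)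
  then obtain M where M: "?P M" "\<And>M'. ?P M' \<Longrightarrow> dim M' \<le> dim M"
    by blast
  have "maximal_nilpotent_ideal M"
    unfolding maximal_nilpotent_ideal_def
  proof (intro conjI allI impI)
    fix M' assume M': "nilpotent_ideal M' \<and> M \<subseteq> M'"
    then have "dim M' \<le> dim M"
      using M by auto
    moreover have "subspace M" "subspace M'"
      using M M' by (auto simp: nilpotent_ideal_def ideal_def)
    ultimately show "M' = M"
      using M' fin.subspace_dim_equal[of M M'] by auto
  qed (use M in auto)
  then show ?thesis
    using assms M by (auto simp: is_nilradical_def)
qed

end

section \<open>Coordinates and matrices on the Heisenberg nilradical\<close>

locale heisenberg_nilradical = leibniz_algebra scale br
  for scale :: "'f::field_char_0 \<Rightarrow> 'v::ab_group_add \<Rightarrow> 'v" and br +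
  fixes N :: "'v set" and H P B :: 'v
  assumes nilpotent_ideal_subset: "nilpotent_ideal I \<Longrightarrow> I \<subseteq> N"
    and ideal_N: "ideal N"
    and solvable: solvable
    and N_eq: "N = {scale h H + scale p P + scale b B | h p b. True}"
    and HPB_independent:
      "scale h H + scale p P + scale b B = 0 \<Longrightarrow> h = 0 \<and> p = 0 \<and> b = 0"
    and br_table [simp]: "br P B = H" "br B P = - H" "br H H = 0" "br H P = 0" "br P H = 0"
      "br H B = 0" "br B H = 0" "br P P = 0" "br B B = 0"
begin

definition hpb :: "'f \<Rightarrow> 'f \<Rightarrow> 'f \<Rightarrow> 'v" where
  "hpb h p b = scale h H + scale p P + scale b B"

lemma hpb_in_N [simp]: "hpb h p b \<in> N"
  by (auto simp: N_eq hpb_def)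

lemma N_cases:
  assumes "n \<in> N"
  obtains h p b where "n = hpb h p b"
  using assms by (auto simp: N_eq hpb_def)

lemma subspace_N: "subspace N"
  using ideal_N by (simp add: ideal_def)

lemma br_in_N [simp]: "n \<in> N \<Longrightarrow> br x n \<in> N" "n \<in> N \<Longrightarrow> br n x \<in> N"
  using ideal_N by (auto simp: ideal_def)

lemma hpb_add: "hpb h p b + hpb h' p' b' = hpb (h + h') (p + p') (b + b')"
  by (simp add: hpb_def scale_left_distrib)

lemma hpb_diff: "hpb h p b - hpb h' p' b' = hpb (h - h') (p - p') (b - b')"
  by (simp add: hpb_def scale_left_diff_distrib)

lemma hpb_scale: "scale c (hpb h p b) = hpb (c * h) (c * p) (c * b)"
  by (simp add: hpb_def scale_right_distrib)

lemma hpb_minus: "- hpb h p b = hpb (- h) (- p) (- b)"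
  by (simp add: hpb_def)

lemmas hpb_arith = hpb_add hpb_diff hpb_scale hpb_minus

lemma hpb_zero: "0 = hpb 0 0 0"
  and hpb_H: "H = hpb 1 0 0"
  and hpb_P: "P = hpb 0 1 0"
  and hpb_B: "B = hpb 0 0 1"
  by (simp_all add: hpb_def)

lemma HPB_in_N [simp]: "H \<in> N" "P \<in> N" "B \<in> N"
  by (metis hpb_in_N hpb_H, metis hpb_in_N hpb_P, metis hpb_in_N hpb_B)

lemma hpb_eq_iff [simp]: "hpb h p b = hpb h' p' b' \<longleftrightarrow> h = h' \<and> p = p' \<and> b = b'"
proof
  assume "hpb h p b = hpb h' p' b'"
  then have "hpb (h - h') (p - p') (b - b') = 0"
    by (simp flip: hpb_diff)
  then show "h = h' \<and> p = p' \<and> b = b'"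
    using HPB_independent[of "h - h'" "p - p'" "b - b'"] by (simp add: hpb_def)
qed simp

lemma hpb_eq_0_iff [simp]: "hpb h p b = 0 \<longleftrightarrow> h = 0 \<and> p = 0 \<and> b = 0"
  using hpb_eq_iff[of h p b 0 0 0] hpb_zero by metis

lemma br_hpb_hpb: "br (hpb h p b) (hpb h' p' b') = hpb (p * b' - b * p') 0 0"
  by (simp add: hpb_def br_bilinear scale_left_diff_distrib mult.commute)

lemma br_hpb_B: "br (hpb h p b) B = hpb p 0 0"
  and br_P_hpb: "br P (hpb h p b) = hpb b 0 0"
  by (simp_all add: hpb_def br_bilinear)

text \<open>The matrix of \<open>[x, -]\<close> on \<open>N / F H\<close> in the basis \<open>P, B\<close> has columns \<open>(adPP x, adPB x)\<close>
  and \<open>(adBP x, adBB x)\<close>.\<close>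

definition "adPH x = (THE h. \<exists>p b. br x P = hpb h p b)"
definition "adPP x = (THE p. \<exists>h b. br x P = hpb h p b)"
definition "adPB x = (THE b. \<exists>h p. br x P = hpb h p b)"
definition "adBH x = (THE h. \<exists>p b. br x B = hpb h p b)"
definition "adBP x = (THE p. \<exists>h b. br x B = hpb h p b)"
definition "adBB x = (THE b. \<exists>h p. br x B = hpb h p b)"

lemma br_P: "br x P = hpb (adPH x) (adPP x) (adPB x)"
proof -
  obtain h p b where "br x P = hpb h p b"
    by (meson HPB_in_N br_in_N N_cases)
  then show ?thesis
    by (simp add: adPH_def adPP_def adPB_def)
qed

lemma br_B: "br x B = hpb (adBH x) (adBP x) (adBB x)"
proof -
  obtain h p b where "br x B = hpb h p b"
    by (meson HPB_in_N br_in_N N_cases)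
  then show ?thesis
    by (simp add: adBH_def adBP_def adBB_def)
qed

text \<open>\<open>br x\<close> is a derivation and \<open>H\<close> is \<open>br P B\<close>, so
  the trace of the matrix appears.\<close>

lemma br_H: "br x H = hpb (adPP x + adBB x) 0 0"
proof -
  have "br x H = br (br x P) B + br P (br x B)"
    using leibniz[of x P B] by simp
  then show ?thesis
    by (simp only: br_P br_B[of x] br_hpb_B br_P_hpb hpb_add) simp
qed

lemma br_hpb:
  "br x (hpb h p b) =
    hpb (h * (adPP x + adBB x) + p * adPH x + b * adBH x)
      (p * adPP x + b * adBP x) (p * adPB x + b * adBB x)"
  unfolding hpb_def[of h p b] by (simp add: br_bilinear br_P br_B br_H hpb_arith)

lemma ad_add:
  "adPP (x + y) = adPP x + adPP y" "adPB (x + y) = adPB x + adPB y"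
  "adBP (x + y) = adBP x + adBP y" "adBB (x + y) = adBB x + adBB y"
  "adPH (x + y) = adPH x + adPH y" "adBH (x + y) = adBH x + adBH y"
  using br_add_left[of x y P] br_add_left[of x y B] by (simp_all add: br_P br_B hpb_arith)

lemma ad_scale:
  "adPP (scale k x) = k * adPP x" "adPB (scale k x) = k * adPB x"
  "adBP (scale k x) = k * adBP x" "adBB (scale k x) = k * adBB x"
  "adPH (scale k x) = k * adPH x" "adBH (scale k x) = k * adBH x"
  using br_scale_left[of k x P] br_scale_left[of k x B] by (simp_all add: br_P br_B hpb_arith)

lemma ad_hpb [simp]:
  "adPP (hpb h p b) = 0" "adPB (hpb h p b) = 0" "adBP (hpb h p b) = 0" "adBB (hpb h p b) = 0"
  "adPH (hpb h p b) = - b" "adBH (hpb h p b) = p"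
  using br_hpb_hpb[of h p b 0 1 0] br_hpb_hpb[of h p b 0 0 1]
  by (simp_all add: br_P br_B flip: hpb_P hpb_B)

lemma ad_0 [simp]: "adPP 0 = 0" "adPB 0 = 0" "adBP 0 = 0" "adBB 0 = 0"
  using ad_hpb[of 0 0 0] by (simp_all flip: hpb_zero)

lemma ad_diff:
  "adPP (x - y) = adPP x - adPP y" "adPB (x - y) = adPB x - adPB y"
  "adBP (x - y) = adBP x - adBP y" "adBB (x - y) = adBB x - adBB y"
  using br_diff_left[of x y P] br_diff_left[of x y B] by (simp_all add: br_P br_B hpb_arith)

text \<open>By \<open>leibniz_left\<close>, left multiplication turns brackets into commutators of
  operators; these are the entries of the commutator of the two matrices.\<close>

lemma ad_br:
  "adPP (br x y) = adBP x * adPB y - adBP y * adPB x"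
  "adPB (br x y) = adPB x * adPP y + adBB x * adPB y - (adPB y * adPP x + adBB y * adPB x)"
  "adBP (br x y) = adPP x * adBP y + adBP x * adBB y - (adPP y * adBP x + adBP y * adBB x)"
  "adBB (br x y) = adPB x * adBP y - adPB y * adBP x"
  using leibniz_left[of x y P] leibniz_left[of x y B]
  by (simp_all add: br_P br_B br_hpb hpb_arith algebra_simps)

end

text \<open>Two vectors parallel to the same nonzero vector are parallel. The intended vectors are
  \<open>(adPP x - adBB x, adPB x, adBP x)\<close>, which are parallel exactly when the matrices
  commute.\<close>

lemma cross_product_eq_0:
  fixes u1 :: "'f::field"
  assumes "u1 * w2 = u2 * w1" "u1 * w3 = u3 * w1" "u2 * w3 = u3 * w2"
    and "v1 * w2 = v2 * w1" "v1 * w3 = v3 * w1" "v2 * w3 = v3 * w2"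
    and "\<not> (w1 = 0 \<and> w2 = 0 \<and> w3 = 0)"
  shows "u1 * v2 = u2 * v1 \<and> u1 * v3 = u3 * v1 \<and> u2 * v3 = u3 * v2"
proof -
  have "\<exists>k. u1 = k * w1 \<and> u2 = k * w2 \<and> u3 = k * w3"
    if "u1 * w2 = u2 * w1" "u1 * w3 = u3 * w1" "u2 * w3 = u3 * w2" for u1 u2 u3
  proof -
    consider "w1 \<noteq> 0" | "w2 \<noteq> 0" | "w3 \<noteq> 0"
      using assms(7) by blast
    then show ?thesis
    proof cases
      case 1
      then show ?thesis
        using that by (intro exI[of _ "u1 / w1"]) (simp add: field_simps)
    next
      case 2
      then show ?thesis
        using that by (intro exI[of _ "u2 / w2"]) (simp add: field_simps)
    next
      case 3
      then show ?thesis
        using that by (intro exI[of _ "u3 / w3"]) (simp add: field_simps)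
    qed
  qed
  from this[OF assms(1-3)] this[OF assms(4-6)] show ?thesis
    by (auto simp: algebra_simps)
qed

section \<open>Ideals inside the nilradical and commutativity of L / N\<close>

context heisenberg_nilradical
begin

definition ad_trace :: "'v \<Rightarrow> 'f" where
  "ad_trace x = adPP x + adBB x"

definition ad_det :: "'v \<Rightarrow> 'f" where
  "ad_det x = adPP x * adBB x - adBP x * adPB x"

definition ad_zero :: "'v \<Rightarrow> bool" where
  "ad_zero x \<longleftrightarrow> adPP x = 0 \<and> adPB x = 0 \<and> adBP x = 0 \<and> adBB x = 0"

lemma ad_trace_add: "ad_trace (x + y) = ad_trace x + ad_trace y"
  and ad_trace_scale: "ad_trace (scale k x) = k * ad_trace x"
  by (simp_all add: ad_trace_def ad_add ad_scale algebra_simps)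

lemma ad_trace_br [simp]: "ad_trace (br x y) = 0"
  by (simp add: ad_trace_def ad_br algebra_simps)

lemma ad_zero_br_commute: "ad_zero (br x y) \<longleftrightarrow> ad_zero (br y x)"
  by (auto simp: ad_zero_def ad_br algebra_simps)

lemma subspace_FH: "subspace {hpb h 0 0 | h. True}"
  unfolding subspace_def
proof (intro conjI ballI allI)
  show "0 \<in> {hpb h 0 0 | h. True}"
    using hpb_zero by blast
qed (auto simp: hpb_arith)

text \<open>Term 0 may be any set, but every later term is a span and contains 0; one further step
  turns the inclusion into an equality.\<close>

lemma lower_central_series_subset_0:
  assumes "lower_central_series I k \<subseteq> {0}"
  shows "\<exists>k. lower_central_series I k = {0}"
proof -
  have "lower_central_series I (Suc k) \<subseteq> {0}"
    using assms by (simp, intro brspan_subset subspace_single_0) auto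
  moreover have "0 \<in> lower_central_series I (Suc k)"
    by (simp add: zero_in_brspan)
  ultimately show ?thesis
    by blast
qed

text \<open>\<open>prod\<close> says that the product of any two matrices from \<open>I\<close>
  vanishes. So the lower central series enters \<open>N\<close>, two further actions of
  \<open>I\<close> carry it into the line of \<open>H\<close>, and trace zero kills that
  line.\<close>

lemma ideal_subset_N:
  assumes I: "ideal I"
    and br_N: "\<And>x y. x \<in> I \<Longrightarrow> y \<in> I \<Longrightarrow> br x y \<in> N"
    and tr: "\<And>x. x \<in> I \<Longrightarrow> ad_trace x = 0"
    and prod: "\<And>x y. x \<in> I \<Longrightarrow> y \<in> I \<Longrightarrow>
      adPP x * adPP y + adBP x * adPB y = 0 \<and> adPP x * adBP y + adBP x * adBB y = 0 \<and>
      adPB x * adPP y + adBB x * adPB y = 0 \<and> adPB x * adBP y + adBB x * adBB y = 0"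
  shows "I \<subseteq> N"
proof (rule nilpotent_ideal_subset)
  define FH where "FH = {hpb h 0 0 | h. True}"
  \<comment> \<open>The stage between \<open>N\<close> and \<open>FH\<close>: one more left
    multiplication by \<open>I\<close> ends in \<open>FH\<close>.\<close>
  define S where "S = {n \<in> N. \<forall>y\<in>I. br y n \<in> FH}"
  have FH: "subspace FH"
    using subspace_FH by (simp add: FH_def)
  then have S: "subspace S"
    using subspace_N by (auto simp: S_def subspace_def br_bilinear)
  have "lower_central_series I 1 \<subseteq> N"
    using br_N by (simp, intro brspan_subset subspace_N) auto
  moreover have "br x n \<in> S" if x: "x \<in> I" and n: "n \<in> N" for x n
  proof -
    obtain h p b where n: "n = hpb h p b"
      using n by (rule N_cases)
    have "br y (br x n) \<in> FH" if "y \<in> I" for y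
    proof -
      have "(p * adPP x + b * adBP x) * adPP y + (p * adPB x + b * adBB x) * adBP y =
          p * (adPP y * adPP x + adBP y * adPB x) + b * (adPP y * adBP x + adBP y * adBB x)"
        "(p * adPP x + b * adBP x) * adPB y + (p * adPB x + b * adBB x) * adBB y =
          p * (adPB y * adPP x + adBB y * adPB x) + b * (adPB y * adBP x + adBB y * adBB x)"
        by (simp_all add: algebra_simps)
      then show ?thesis
        unfolding n br_hpb FH_def using prod[OF that x] by auto
    qed
    then show ?thesis
      by (simp add: S_def n)
  qed
  ultimately have "lower_central_series I 2 \<subseteq> S"
    by (simp add: numeral_2_eq_2, intro brspan_subset S) auto
  then have "lower_central_series I 3 \<subseteq> FH"
    by (simp add: numeral_3_eq_3 numeral_2_eq_2, intro brspan_subset FH) (auto simp: S_def)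
  moreover have "br x (hpb h 0 0) = 0" if "x \<in> I" for x h
    using tr[OF that] by (simp add: br_hpb ad_trace_def)
  ultimately have "lower_central_series I 4 \<subseteq> {0}"
    unfolding FH_def by (simp add: eval_nat_numeral, intro brspan_subset subspace_single_0) auto
  then show "nilpotent_ideal I"
    unfolding nilpotent_ideal_def using I lower_central_series_subset_0 by blast
qed

text \<open>The kernel \<open>K\<close> of the action on \<open>N / F H\<close> lies in \<open>N\<close>: going down the derived series
  \<open>D\<close>, each \<open>K \<inter> D\<^sub>j\<close> has products in \<open>K \<inter> D\<^sub>j\<^sub>+\<^sub>1 \<subseteq> N\<close>, hence is a nilpotent ideal.\<close>

lemma ad_zero_imp_N:
  assumes "ad_zero x"
  shows "x \<in> N"
proof -
  define K where "K = {x. ad_zero x}"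
  have K: "ideal K"
    unfolding ideal_def K_def
    by (auto simp: subspace_def ad_zero_def ad_add ad_scale ad_br)
  obtain k where k: "derived_series k = {0}"
    using solvable by (auto simp: solvable_def)
  have "K \<inter> derived_series j \<subseteq> N" if "j \<le> k" for j
    using that
  proof (induction rule: inc_induct)
    case base
    show ?case
      using k subspace_N by (auto simp: subspace_def)
  next
    case (step j)
    have "ideal (K \<inter> derived_series j)"
      using K ideal_derived_series[of j] by (auto simp: ideal_def subspace_inter)
    moreover have "br x y \<in> N" if "x \<in> K \<inter> derived_series j" "y \<in> K \<inter> derived_series j" for x y
      using step.IH that K by (auto simp: ideal_def intro: br_in_brspan)
    ultimately show ?case
      by (rule ideal_subset_N) (auto simp: K_def ad_zero_def ad_trace_def)
  qed
  from this[of 0] show ?thesis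
    using assms by (auto simp: K_def)
qed

lemma in_N_iff: "x \<in> N \<longleftrightarrow> ad_zero x"
proof
  assume "x \<in> N"
  then obtain h p b where "x = hpb h p b"
    by (rule N_cases)
  then show "ad_zero x"
    by (simp add: ad_zero_def)
qed (rule ad_zero_imp_N)

text \<open>\<open>eigen\<close> makes the elements acting by multiples of the matrix of
  \<open>x\<close> an ideal. That matrix has square zero, so all products of two matrices from the
  ideal vanish, as \<open>ideal_subset_N\<close> demands.\<close>

lemma nilpotent_eigenvector_in_N:
  assumes tr: "ad_trace x = 0" and det: "ad_det x = 0"
    and eigen: "\<And>y. \<exists>k. ad_zero (br y x - scale k x)"
  shows "x \<in> N"
proof -
  define I where "I = {z. \<exists>k. ad_zero (z - scale k x)}"
  have adBB: "adBB x = - adPP x"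
    using tr by (simp add: ad_trace_def add_eq_0_iff)
  \<comment> \<open>By Cayley-Hamilton a traceless 2 x 2 matrix squares to minus its determinant
    times the identity.\<close>
  have sq: "adPP x * adPP x + adBP x * adPB x = 0"
    using det by (simp add: ad_det_def adBB add_eq_0_iff)
  have I_iff: "z \<in> I \<longleftrightarrow> (\<exists>k. adPP z = k * adPP x \<and> adPB z = k * adPB x \<and>
      adBP z = k * adBP x \<and> adBB z = k * adBB x)" for z
    by (simp add: I_def ad_zero_def ad_diff ad_scale)
  have "subspace I"
    unfolding subspace_def
  proof (intro conjI ballI allI)
    show "0 \<in> I"
      unfolding I_iff by (rule exI[of _ 0]) simp
    show "y + z \<in> I" if yz: "y \<in> I" "z \<in> I" for y z
    proof -
      obtain k l where "adPP y = k * adPP x \<and> adPB y = k * adPB x \<and>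
          adBP y = k * adBP x \<and> adBB y = k * adBB x"
        "adPP z = l * adPP x \<and> adPB z = l * adPB x \<and>
          adBP z = l * adBP x \<and> adBB z = l * adBB x"
        using yz unfolding I_iff by blast
      then show ?thesis
        unfolding I_iff by (intro exI[of _ "k + l"]) (simp add: ad_add algebra_simps)
    qed
    show "scale c y \<in> I" if y: "y \<in> I" for c y
    proof -
      obtain k where "adPP y = k * adPP x \<and> adPB y = k * adPB x \<and>
          adBP y = k * adBP x \<and> adBB y = k * adBB x"
        using y unfolding I_iff by blast
      then show ?thesis
        unfolding I_iff by (intro exI[of _ "c * k"]) (simp add: ad_scale)
    qed
  qed
  moreover have "br y z \<in> I \<and> br z y \<in> I" if z: "z \<in> I" for y z
  proof -
    obtain k where k: "adPP z = k * adPP x" "adPB z = k * adPB x"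
        "adBP z = k * adBP x" "adBB z = k * adBB x"
      using z unfolding I_iff by blast
    obtain l where l: "adPP (br y x) = l * adPP x" "adPB (br y x) = l * adPB x"
        "adBP (br y x) = l * adBP x" "adBB (br y x) = l * adBB x"
      using eigen[of y] by (auto simp: ad_zero_def ad_diff ad_scale)
    have "br y z \<in> I"
      unfolding I_iff
      by (rule exI[of _ "k * l"], simp only: mult.assoc flip: l)
         (simp add: ad_br k algebra_simps)
    moreover have "br z y \<in> I"
      unfolding I_iff
      by (rule exI[of _ "- (k * l)"], simp only: mult.assoc mult_minus_left flip: l)
         (simp add: ad_br k algebra_simps)
    ultimately show ?thesis
      by simp
  qed
  ultimately have "ideal I"
    by (auto simp: ideal_def)
  moreover have "br y z \<in> N" if "y \<in> I" "z \<in> I" for y z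
    using that unfolding in_N_iff I_iff ad_zero_def by (auto simp: ad_br algebra_simps)
  moreover have "ad_trace y = 0" if "y \<in> I" for y
    using that tr unfolding I_iff by (auto simp: ad_trace_def simp flip: distrib_left)
  moreover have
    "adPP y * adPP z + adBP y * adPB z = 0 \<and> adPP y * adBP z + adBP y * adBB z = 0 \<and>
     adPB y * adPP z + adBB y * adPB z = 0 \<and> adPB y * adBP z + adBB y * adBB z = 0"
    if yz: "y \<in> I" "z \<in> I" for y z
  proof -
    obtain k l where *: "adPP y = k * adPP x \<and> adPB y = k * adPB x \<and>
        adBP y = k * adBP x \<and> adBB y = k * adBB x"
      "adPP z = l * adPP x \<and> adPB z = l * adPB x \<and>
        adBP z = l * adBP x \<and> adBB z = l * adBB x"
      using yz unfolding I_iff by blast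
    have "adPP y * adPP z + adBP y * adPB z = (k * l) * (adPP x * adPP x + adBP x * adPB x)"
      "adPB y * adBP z + adBB y * adBB z = (k * l) * (adPP x * adPP x + adBP x * adPB x)"
      using * by (simp_all add: adBB algebra_simps)
    then show ?thesis
      using * sq by (simp add: adBB)
  qed
  ultimately have "I \<subseteq> N"
    by (rule ideal_subset_N)
  moreover have "x \<in> I"
    unfolding I_iff by (rule exI[of _ 1]) simp
  ultimately show ?thesis
    by blast
qed

text \<open>The matrix of \<open>x\<close> is nonzero and traceless, hence not scalar, and
  everything that commutes with a nonscalar 2 x 2 matrix is a polynomial in it; such matrices
  commute with each other.\<close>

lemma commuting_br_in_N:
  assumes x: "x \<notin> N" "ad_trace x = 0"
    and "br x y \<in> N" "br x z \<in> N"
  shows "br y z \<in> N"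
proof -
  have adBB: "adBB x = - adPP x"
    using x by (simp add: ad_trace_def add_eq_0_iff)
  \<comment> \<open>The vanishing commutator with \<open>x\<close>, written as a vanishing cross
    product with \<open>(2 * adPP x, adPB x, adBP x)\<close>.\<close>
  have par: "(adPP y - adBB y) * adPB x = adPB y * (2 * adPP x) \<and>
      (adPP y - adBB y) * adBP x = adBP y * (2 * adPP x) \<and> adPB y * adBP x = adBP y * adPB x"
    if "br x y \<in> N" for y
  proof -
    have "adBP x * adPB y - adBP y * adPB x = 0"
      "adPB x * adPP y + - adPP x * adPB y - (adPB y * adPP x + adBB y * adPB x) = 0"
      "adPP x * adBP y + adBP x * adBB y - (adPP y * adBP x + adBP y * - adPP x) = 0"
      using that unfolding in_N_iff ad_zero_def ad_br adBB by blast+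
    then show ?thesis
      by (intro conjI; algebra)
  qed
  have nz: "\<not> (2 * adPP x = 0 \<and> adPB x = 0 \<and> adBP x = 0)"
    using x by (auto simp: in_N_iff ad_zero_def adBB)
  have "(adPP y - adBB y) * adPB z = adPB y * (adPP z - adBB z) \<and>
      (adPP y - adBB y) * adBP z = adBP y * (adPP z - adBB z) \<and> adPB y * adBP z = adBP y * adPB z"
    using cross_product_eq_0[OF _ _ _ _ _ _ nz] par[OF assms(3)] par[OF assms(4)] by blast
  then show ?thesis
    unfolding in_N_iff ad_zero_def ad_br by (auto simp: algebra_simps)
qed

text \<open>If \<open>x\<close> lies in \<open>D\<^sub>j\<^sub>+\<^sub>1\<close> but not in \<open>N\<close>, then all commutators of its matrix with matrices
  of \<open>L\<close> are multiples of that matrix, since traceless commuting \<open>2 \<times> 2\<close> matrices are proportional.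
  By the previous lemmas it is nonsingular, hence central, and its centraliser is commutative.\<close>

lemma derived_series_descent:
  assumes "derived_series (Suc (Suc j)) \<subseteq> N"
  shows "derived_series (Suc j) \<subseteq> N"
proof (rule subsetI, rule ccontr)
  fix x assume x: "x \<in> derived_series (Suc j)" "x \<notin> N"
  have tr: "ad_trace y = 0" if "y \<in> derived_series (Suc j)" for y
  proof -
    have "derived_series (Suc j) \<subseteq> {y. ad_trace y = 0}"
      by (simp, intro brspan_subset)
        (auto simp: subspace_def ad_trace_add ad_trace_scale ad_trace_def[of 0])
    then show ?thesis
      using that by auto
  qed
  then have adBB: "adBB y = - adPP y" if "y \<in> derived_series (Suc j)" for y
    using that by (simp add: ad_trace_def add_eq_0_iff)
  have nz: "\<not> (adPP x = 0 \<and> adPB x = 0 \<and> adBP x = 0)"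
    using x by (auto simp: in_N_iff ad_zero_def adBB)
  have eigen: "\<exists>k. ad_zero (br y x - scale k x)" for y
  proof -
    let ?y = "br y x"
    have y: "?y \<in> derived_series (Suc j)"
      using x ideal_derived_series[of "Suc j"] by (auto simp: ideal_def)
    then have "br x ?y \<in> N"
      using assms br_in_brspan[OF x(1) y] by auto
    then have "adBP x * adPB ?y - adBP ?y * adPB x = 0"
      "adPB x * adPP ?y + - adPP x * adPB ?y - (adPB ?y * adPP x + - adPP ?y * adPB x) = 0"
      "adPP x * adBP ?y + adBP x * - adPP ?y - (adPP ?y * adBP x + adBP ?y * - adPP x) = 0"
      unfolding in_N_iff ad_zero_def ad_br[of x] adBB[OF x(1)] adBB[OF y] by blast+
    then have "2 * (adPP ?y * adPB x - adPB ?y * adPP x) = 0"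
      "2 * (adPP ?y * adBP x - adBP ?y * adPP x) = 0" "adPB ?y * adBP x - adBP ?y * adPB x = 0"
      by algebra+
    then have par: "adPP ?y * adPB x = adPB ?y * adPP x" "adPP ?y * adBP x = adBP ?y * adPP x"
      "adPB ?y * adBP x = adBP ?y * adPB x"
      by simp_all
    consider "adPP x \<noteq> 0" | "adPB x \<noteq> 0" | "adBP x \<noteq> 0"
      using nz by blast
    then show ?thesis
    proof cases
      case 1
      then show ?thesis
        using par by (intro exI[of _ "adPP ?y / adPP x"])
          (simp add: ad_zero_def ad_diff ad_scale adBB[OF x(1)] adBB[OF y] field_simps)
    next
      case 2
      then show ?thesis
        using par by (intro exI[of _ "adPB ?y / adPB x"])
          (simp add: ad_zero_def ad_diff ad_scale adBB[OF x(1)] adBB[OF y] field_simps)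
    next
      case 3
      then show ?thesis
        using par by (intro exI[of _ "adBP ?y / adBP x"])
          (simp add: ad_zero_def ad_diff ad_scale adBB[OF x(1)] adBB[OF y] field_simps)
    qed
  qed
  then have det: "ad_det x \<noteq> 0"
    using nilpotent_eigenvector_in_N x tr by blast
  have central: "br x y \<in> N" for y
  proof -
    obtain k where k: "adPP (br y x) = k * adPP x" "adPB (br y x) = k * adPB x"
        "adBP (br y x) = k * adBP x" "adBB (br y x) = k * adBB x"
      using eigen[of y] by (auto simp: ad_zero_def ad_diff ad_scale)
    \<comment> \<open>The right side is minus the trace of [M_y, M_x] M_x, where [M_y, M_x] = k M_x.
      It is zero by cyclicity of the trace, while a traceless M_x has tr(M_x M_x) = -2 det
      M_x.\<close>
    have "2 * k * ad_det x =
        - ((k * adPP x) * adPP x + (k * adPB x) * adBP x + (k * adBP x) * adPB x + (k * adBB x) * adBB x)"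
      by (simp add: ad_det_def adBB[OF x(1)] algebra_simps)
    also have "\<dots> = 0"
      unfolding k[symmetric] by (simp add: ad_br algebra_simps)
    finally have "k = 0"
      using det by simp
    then show ?thesis
      using k unfolding in_N_iff ad_zero_br_commute[of x y] by (simp add: ad_zero_def)
  qed
  have "derived_series (Suc j) \<subseteq> N"
    using commuting_br_in_N[OF x(2) tr[OF x(1)] central central]
    by (simp, intro brspan_subset subspace_N) auto
  then show False
    using x by blast
qed

lemma br_in_N_always: "br x y \<in> N"
proof -
  obtain k where k: "derived_series k = {0}"
    using solvable by (auto simp: solvable_def)
  \<comment> \<open>The descent only moves between positive indices and \<open>k\<close> may be 0,
    so it starts one index later.\<close>
  have "derived_series (Suc k) \<subseteq> N"
    unfolding derived_series.simps k using subspace_0[OF subspace_N]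
    by (intro brspan_subset subspace_N) simp
  moreover have "derived_series (Suc j) \<subseteq> N \<Longrightarrow> derived_series 1 \<subseteq> N" for j
    by (induction j) (use derived_series_descent in auto)
  ultimately have "derived_series 1 \<subseteq> N"
    by blast
  then show ?thesis
    by (auto intro!: br_in_brspan dest!: subsetD)
qed

text \<open>All matrices now commute, so the eigenvector condition holds with eigenvalue 0.\<close>

lemma not_nilpotent:
  assumes "x \<notin> N"
  shows "\<not> (ad_trace x = 0 \<and> ad_det x = 0)"
proof
  assume "ad_trace x = 0 \<and> ad_det x = 0"
  moreover have "ad_zero (br y x - scale 0 x)" for y
    using br_in_N_always[of y x] by (simp add: in_N_iff)
  ultimately show False
    using nilpotent_eigenvector_in_N assms by blast
qed

text \<open>Squares annihilate everything on the left; polarising them puts the symmetric part of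
  the bracket into the left centre \<open>Z\<close>.\<close>

lemma br_swap: "\<exists>h. br x y = - br y x + hpb h 0 0"
proof -
  define Z where "Z = {z. \<forall>y. br z y = 0}"
  have "ideal Z"
    by (auto simp: Z_def ideal_def subspace_def br_bilinear leibniz_left)
  moreover have "lower_central_series Z 1 \<subseteq> {0}"
    by (simp, intro brspan_subset subspace_single_0) (auto simp: Z_def)
  ultimately have "Z \<subseteq> N"
    using nilpotent_ideal_subset lower_central_series_subset_0 by (metis nilpotent_ideal_def)
  have sq: "br x x \<in> Z" for x
    by (simp add: Z_def leibniz_left)
  have "br x y + br y x = br (x + y) (x + y) - br x x - br y y"
    by (simp add: br_bilinear)
  also have "\<dots> \<in> Z"
    using sq \<open>ideal Z\<close> by (metis ideal_def subspace_diff)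
  finally have Z: "br x y + br y x \<in> Z" .
  then obtain h p b where hpb: "br x y + br y x = hpb h p b"
    using \<open>Z \<subseteq> N\<close> N_cases by blast
  \<comment> \<open>Multiplying by \<open>P\<close> and by \<open>B\<close> reads off the
    coefficients \<open>b\<close> and \<open>p\<close>, which therefore vanish.\<close>
  have "br (hpb h p b) (hpb 0 1 0) = 0" "br (hpb h p b) (hpb 0 0 1) = 0"
    using Z unfolding hpb Z_def by auto
  then show ?thesis
    using hpb by (auto simp: br_hpb_hpb algebra_simps intro!: exI[of _ h])
qed

end

section \<open>Normal forms\<close>

lemma UNIV_heis_index: "(UNIV :: heis_index set) = {iH, iP, iB}"
  using heis_index.exhaust by auto

section \<open>Antisymmetry against the nilradical and changes of basis\<close>

context heisenberg_nilradical
begin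

text \<open>Expanding \<open>br (br P B) x\<close> leads to \<open>br B x\<close> and
  \<open>br P x\<close>; the multiples of \<open>H\<close> that \<open>br_swap\<close> adds to them
  die under the remaining left multiplication by \<open>P\<close> or \<open>B\<close>.\<close>

lemma br_H_right: "br H x = - br x H"
proof -
  obtain h k where "br B x = - br x B + hpb h 0 0" "br P x = - br x P + hpb k 0 0"
    using br_swap by meson
  moreover have "br H x = br P (br B x) - br B (br P x)"
    using leibniz_left[of P B x] by simp
  ultimately have "br H x = br P (- br x B + hpb h 0 0) - br B (- br x P + hpb k 0 0)"
    by simp
  also have "\<dots> = - br x H"
    unfolding br_P[of x] br_B[of x] br_H[of x] hpb_arith hpb_def[of _ "_ + _"]
    by (simp add: hpb_def br_bilinear algebra_simps)
  finally show ?thesis .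
qed

lemma br_hpb_H_right: "br (hpb h 0 0) x = hpb (- h * ad_trace x) 0 0"
proof -
  have "hpb h 0 0 = scale h H"
    by (simp add: hpb_def)
  then show ?thesis
    by (simp add: br_bilinear br_H_right br_H hpb_arith flip: ad_trace_def)
qed

text \<open>A square annihilates every \<open>y\<close> on the left, whereas
  \<open>hpb r 0 0\<close> sends \<open>y\<close> to \<open>- r * ad_trace y\<close> times
  \<open>H\<close>. A nonzero square thus forces all traces to vanish.\<close>

lemma br_self:
  obtains r where "br x x = hpb r 0 0" "\<And>y. r * ad_trace y = 0"
proof -
  obtain h where "br x x = - br x x + hpb h 0 0"
    using br_swap by blast
  then have "scale 2 (br x x) = hpb h 0 0"
    by (metis add_diff_cancel_left' diff_minus_eq_add one_add_one scale_left_distrib scale_one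
        uminus_add_conv_diff add.commute)
  then have "scale (1 / 2) (scale 2 (br x x)) = scale (1 / 2) (hpb h 0 0)"
    by simp
  then have r: "br x x = hpb (h / 2) 0 0"
    by (simp add: hpb_scale)
  have "br (br x x) y = 0" for y
    by (simp add: leibniz_left)
  then have "(h / 2) * ad_trace y = 0" for y
    unfolding r br_hpb_H_right by simp
  with r that show ?thesis
    by blast
qed

text \<open>For fixed \<open>x\<close> the defect \<open>[n, x] + [x, n] = \<phi>(n) H\<close> satisfies \<open>\<phi>([x, n]) = 0\<close> and
  \<open>\<phi>([x, n]) = ad_trace x * \<phi>(n)\<close>; the latter settles the case of nonzero trace, the former that
  of nonzero determinant.\<close>

lemma br_N_right:
  assumes n: "n \<in> N"
  shows "br n x = - br x n"
proof (cases "x \<in> N")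
  case True
  with n obtain h p b h' p' b' where "x = hpb h p b" "n = hpb h' p' b'"
    by (meson N_cases)
  then show ?thesis
    by (simp add: br_hpb_hpb hpb_minus)
next
  case False
  define \<phi> where "\<phi> n = (THE h. br n x + br x n = hpb h 0 0)" for n
  have \<phi>: "br n x + br x n = hpb (\<phi> n) 0 0" for n
  proof -
    obtain h where "br n x = - br x n + hpb h 0 0"
      using br_swap by blast
    then have "br n x + br x n = hpb h 0 0"
      by simp
    then show ?thesis
      by (simp add: \<phi>_def)
  qed
  have eq: "br n x = hpb (\<phi> n) 0 0 - br x n" for n
    using \<phi>[of n] by (simp add: algebra_simps)
  obtain r where r: "br x x = hpb r 0 0"
    by (rule br_self)
  have \<phi>_H: "\<phi> (hpb h 0 0) = 0" for h
    using \<phi>[of "hpb h 0 0"] by (simp add: br_hpb_H_right br_hpb hpb_add ad_trace_def)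
  have \<phi>_add: "\<phi> (m + n) = \<phi> m + \<phi> n" and \<phi>_scale: "\<phi> (scale c n) = c * \<phi> n" for m n c
  proof -
    have "hpb (\<phi> (m + n)) 0 0 = hpb (\<phi> m) 0 0 + hpb (\<phi> n) 0 0"
      by (simp add: br_bilinear flip: \<phi>)
    then show "\<phi> (m + n) = \<phi> m + \<phi> n"
      by (simp add: hpb_add)
    have "hpb (\<phi> (scale c n)) 0 0 = scale c (hpb (\<phi> n) 0 0)"
      by (simp add: br_bilinear scale_right_distrib flip: \<phi>)
    then show "\<phi> (scale c n) = c * \<phi> n"
      by (simp add: hpb_scale)
  qed
  have \<phi>_br: "\<phi> (br x n) = 0" if "n \<in> N" for n
  proof -
    obtain h p b where n: "n = hpb h p b"
      using \<open>n \<in> N\<close> by (rule N_cases)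
    \<comment> \<open>The left side is zero, since \<open>br x x\<close> is a multiple of
      \<open>H\<close>; the right side is the defect at \<open>br n x\<close>.\<close>
    have "br n (br x x) = br (br n x) x + br x (br n x)"
      by (rule leibniz)
    moreover have "br n (br x x) = 0"
      by (simp add: r n br_hpb_hpb)
    ultimately have "\<phi> (br n x) = 0"
      by (simp add: \<phi>)
    moreover have "\<phi> (hpb (\<phi> n) 0 0) = \<phi> (br n x) + \<phi> (br x n)"
      by (simp add: eq flip: \<phi>_add)
    ultimately show ?thesis
      by (simp add: \<phi>_H)
  qed
  have \<phi>_trace: "ad_trace x * \<phi> n = 0" if "n \<in> N" for n
  proof -
    obtain h p b where n: "n = hpb h p b"
      using \<open>n \<in> N\<close> by (rule N_cases)
    have "br n (br x x) = 0"
      by (simp add: r n br_hpb_hpb)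
    then have "br x (br n x) = br (br x n) x"
      using leibniz[of x n x] by simp
    then have "br x (hpb (\<phi> n) 0 0) = hpb (\<phi> (br x n)) 0 0"
      by (simp add: eq br_diff_right)
    then show ?thesis
      using \<phi>_br[OF that] by (simp add: br_hpb mult.commute flip: ad_trace_def)
  qed
  have "\<phi> n = 0"
  proof (cases "ad_trace x = 0")
    case True
    then have det: "ad_det x \<noteq> 0"
      using False not_nilpotent by blast
    obtain h p b where "n = hpb h p b"
      using n by (rule N_cases)
    \<comment> \<open>Cramer's rule for the preimage of \<open>(p, b)\<close> under the matrix of
      \<open>x\<close>; up to a multiple of \<open>H\<close> it exhibits \<open>n\<close> as a value
      of \<open>br x\<close>.\<close>
    define q c where "q = (adBB x * p - adBP x * b) / ad_det x"
      and "c = (adPP x * b - adPB x * p) / ad_det x"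
    have "q * adPP x + c * adBP x = p * ad_det x / ad_det x"
      "q * adPB x + c * adBB x = b * ad_det x / ad_det x"
      unfolding q_def c_def
      by (simp_all add: ad_det_def algebra_simps flip: add_divide_distrib diff_divide_distrib)
    then have "q * adPP x + c * adBP x = p" "q * adPB x + c * adBB x = b"
      using det by simp_all
    then have "br x (hpb 0 q c) = hpb (q * adPH x + c * adBH x) p b"
      by (simp add: br_hpb)
    then have "n = br x (hpb 0 q c) + hpb (h - (q * adPH x + c * adBH x)) 0 0"
      by (simp add: hpb_add \<open>n = hpb h p b\<close>)
    then show ?thesis
      using \<phi>_br[of "hpb 0 q c"] by (simp add: \<phi>_add \<phi>_H)
  next
    case False
    then show ?thesis
      using \<phi>_trace[OF n] by simp
  qed
  then show ?thesis
    using eq[of n] by (simp flip: hpb_zero)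
qed

text \<open>Adding an element of \<open>N\<close> keeps the matrix and shifts \<open>adPH\<close>
  and \<open>adBH\<close> by its \<open>B\<close> and \<open>P\<close> coefficients up to sign, so
  both can be cleared.\<close>

lemma exists_adapted_representative:
  obtains x' where "x' - x \<in> N" "adPH x' = 0" "adBH x' = 0"
  by (rule that[of "x + hpb 0 (- adBH x) (adPH x)"]) (simp_all add: ad_add)

lemma ad_cong:
  assumes "x - y \<in> N"
  shows "adPP x = adPP y" "adPB x = adPB y" "adBP x = adBP y" "adBB x = adBB y"
  using assms by (simp_all add: in_N_iff ad_zero_def ad_diff)

definition outer_vec :: "('s::finite \<Rightarrow> 'v) \<Rightarrow> 's + heis_index \<Rightarrow> 'v" where
  "outer_vec s i = (case i of Inl a \<Rightarrow> s a | Inr j \<Rightarrow> (case j of iH \<Rightarrow> H | iP \<Rightarrow> P | iB \<Rightarrow> B))"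

definition hvec :: "'f ^ heis_index \<Rightarrow> 'v" where
  "hvec v = hpb (v $ iH) (v $ iP) (v $ iB)"

lemma comb_outer_vec:
  "comb (outer_vec s) x =
    (\<Sum>a\<in>UNIV. scale (x $ Inl a) (s a)) + hpb (x $ Inr iH) (x $ Inr iP) (x $ Inr iB)"
  by (simp add: comb_def outer_vec_def UNIV_Plus_UNIV[symmetric] sum.Plus UNIV_heis_index hpb_def
      add.assoc)

lemma comb_heis_incl: "comb (outer_vec s) (heis_incl v) = hvec v"
  by (simp add: comb_outer_vec heis_incl_def hvec_def)

definition basis_mod_N :: "('s::finite \<Rightarrow> 'v) \<Rightarrow> bool" where
  "basis_mod_N s \<longleftrightarrow>
    (\<forall>y. \<exists>c. y - (\<Sum>a\<in>UNIV. scale (c a) (s a)) \<in> N) \<and>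
    (\<forall>c. (\<Sum>a\<in>UNIV. scale (c a) (s a)) \<in> N \<longrightarrow> (\<forall>a. c a = 0))"

lemma bij_comb_outer_vec:
  assumes "basis_mod_N s"
  shows "bij (comb (outer_vec s))"
proof (rule bijI)
  interpret comb: Vector_Spaces.linear "(*s)" scale "comb (outer_vec s)"
    by (rule linear_comb)
  show "inj (comb (outer_vec s))"
    unfolding comb.inj_iff_eq_0
  proof (intro allI impI)
    fix x assume x: "comb (outer_vec s) x = 0"
    then have "(\<Sum>a\<in>UNIV. scale (x $ Inl a) (s a)) = - hpb (x $ Inr iH) (x $ Inr iP) (x $ Inr iB)"
      by (simp add: comb_outer_vec add_eq_0_iff2)
    then have "(\<Sum>a\<in>UNIV. scale (x $ Inl a) (s a)) \<in> N"
      by (simp add: hpb_minus)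
    then have "\<forall>a. x $ Inl a = 0"
      using assms unfolding basis_mod_N_def by (elim conjE allE[of _ "\<lambda>a. x $ Inl a"] mp)
    moreover from this have "x $ Inr iH = 0 \<and> x $ Inr iP = 0 \<and> x $ Inr iB = 0"
      using x by (simp add: comb_outer_vec)
    ultimately have "x $ i = 0" for i
    proof (cases i)
      case (Inr j)
      with \<open>x $ Inr iH = 0 \<and> x $ Inr iP = 0 \<and> x $ Inr iB = 0\<close> show ?thesis
        by (cases j) simp_all
    qed simp
    then show "x = 0"
      by (simp add: vec_eq_iff)
  qed
  show "surj (comb (outer_vec s))"
  proof (unfold surj_def, rule allI)
    fix y
    obtain c where "y - (\<Sum>a\<in>UNIV. scale (c a) (s a)) \<in> N"
      using assms unfolding basis_mod_N_def by blast
    then obtain h p b where "y - (\<Sum>a\<in>UNIV. scale (c a) (s a)) = hpb h p b"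
      by (rule N_cases)
    then have "y = comb (outer_vec s)
        (\<chi> i. case i of Inl a \<Rightarrow> c a | Inr j \<Rightarrow> (case j of iH \<Rightarrow> h | iP \<Rightarrow> p | iB \<Rightarrow> b))"
      by (simp add: comb_outer_vec algebra_simps)
    then show "\<exists>x. y = comb (outer_vec s) x"
      by metis
  qed
qed

text \<open>On \<open>N\<close> only left multiplications by the outer elements have to be given;
  \<open>br_N_right\<close> supplies the opposite products.\<close>

lemma isomorphic_ext_br:
  assumes s: "basis_mod_N s"
    and H: "\<And>a. br (s a) H = hvec (d a iH)"
    and P: "\<And>a. br (s a) P = hvec (d a iP)"
    and B: "\<And>a. br (s a) B = hvec (d a iB)"
    and r: "\<And>a b. br (s a) (s b) = hpb (r a b) 0 0"
  shows "isomorphic scale br (*s) (ext_br d r)"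
  unfolding ext_br_def
proof (rule isomorphic_bilinear_ext[OF bij_comb_outer_vec[OF s]])
  interpret comb: Vector_Spaces.linear "(*s)" scale "comb (outer_vec s)"
    by (rule linear_comb)
  fix i j
  have hvec: "hvec 0 = 0" "hvec eH = H" "hvec (- eH) = - H" "hvec (c *s eH) = hpb c 0 0" for c
    by (auto simp: hvec_def axis_def hpb_def)
  then show "comb (outer_vec s) (ext_table d r i j) = br (outer_vec s i) (outer_vec s j)"
  proof (cases i)
    case i: (Inl a)
    show ?thesis
    proof (cases j)
      case (Inr k)
      with i show ?thesis
        by (cases k) (simp_all add: comb_heis_incl outer_vec_def H P B)
    qed (simp add: i comb_heis_incl outer_vec_def r hvec)
  next
    case i: (Inr k)
    show ?thesis
    proof (cases j)
      case (Inl a)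
      with i show ?thesis
        by (cases k) (simp_all add: comb_heis_incl comb.neg outer_vec_def H P B
            br_N_right[of _ "s a"])
    next
      case (Inr l)
      with i show ?thesis
        by (cases k; cases l) (simp_all add: comb_heis_incl outer_vec_def hvec)
    qed
  qed
qed

text \<open>The new central vector must be the bracket of the new \<open>P\<close> and
  \<open>B\<close>, hence the determinant times \<open>H\<close>. As an instance of the locale, the
  new basis comes with its own matrices and normal forms.\<close>

lemma heisenberg_nilradical_change_basis:
  assumes \<Delta>: "\<alpha> * \<epsilon> - \<beta> * \<gamma> \<noteq> 0"
  shows "heisenberg_nilradical scale br N (hpb (\<alpha> * \<epsilon> - \<beta> * \<gamma>) 0 0) (hpb 0 \<alpha> \<beta>) (hpb 0 \<gamma> \<epsilon>)"
proof
  let ?\<Delta> = "\<alpha> * \<epsilon> - \<beta> * \<gamma>"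
  show "nilpotent_ideal I \<Longrightarrow> I \<subseteq> N" for I
    by (rule nilpotent_ideal_subset)
  show "ideal N" solvable
    by (rule ideal_N, rule solvable)
  have comb: "scale h (hpb ?\<Delta> 0 0) + scale p (hpb 0 \<alpha> \<beta>) + scale b (hpb 0 \<gamma> \<epsilon>) =
      hpb (h * ?\<Delta>) (p * \<alpha> + b * \<gamma>) (p * \<beta> + b * \<epsilon>)" for h p b
    by (simp add: hpb_arith)
  have "\<exists>h' p' b'. hpb h p b = hpb (h' * ?\<Delta>) (p' * \<alpha> + b' * \<gamma>) (p' * \<beta> + b' * \<epsilon>)" for h p b
  proof -
    \<comment> \<open>Cramer's rule for the coordinates of \<open>(p, b)\<close> in the new
      basis.\<close>
    have "((p * \<epsilon> - b * \<gamma>) / ?\<Delta>) * \<alpha> + ((b * \<alpha> - p * \<beta>) / ?\<Delta>) * \<gamma> = p * ?\<Delta> / ?\<Delta>"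
      "((p * \<epsilon> - b * \<gamma>) / ?\<Delta>) * \<beta> + ((b * \<alpha> - p * \<beta>) / ?\<Delta>) * \<epsilon> = b * ?\<Delta> / ?\<Delta>"
      by (simp_all add: algebra_simps flip: add_divide_distrib diff_divide_distrib)
    then show ?thesis
      using \<Delta>
      by (intro exI[of _ "h / ?\<Delta>"] exI[of _ "(p * \<epsilon> - b * \<gamma>) / ?\<Delta>"]
          exI[of _ "(b * \<alpha> - p * \<beta>) / ?\<Delta>"]) simp
  qed
  then have "n \<in> N \<longleftrightarrow> (\<exists>h p b. n = hpb (h * ?\<Delta>) (p * \<alpha> + b * \<gamma>) (p * \<beta> + b * \<epsilon>))" for n
    by (metis N_cases hpb_in_N)
  then show "N = {scale h (hpb ?\<Delta> 0 0) + scale p (hpb 0 \<alpha> \<beta>) + scale b (hpb 0 \<gamma> \<epsilon>) | h p b. True}"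
    unfolding comb by blast
  show "h = 0 \<and> p = 0 \<and> b = 0"
    if "scale h (hpb ?\<Delta> 0 0) + scale p (hpb 0 \<alpha> \<beta>) + scale b (hpb 0 \<gamma> \<epsilon>) = 0" for h p b
  proof -
    have eqs: "h * ?\<Delta> = 0" "p * \<alpha> + b * \<gamma> = 0" "p * \<beta> + b * \<epsilon> = 0"
      using that unfolding comb hpb_eq_0_iff by blast+
    have "p * ?\<Delta> = (p * \<alpha> + b * \<gamma>) * \<epsilon> - (p * \<beta> + b * \<epsilon>) * \<gamma>"
      "b * ?\<Delta> = (p * \<beta> + b * \<epsilon>) * \<alpha> - (p * \<alpha> + b * \<gamma>) * \<beta>"
      by (simp_all add: algebra_simps)
    then show ?thesis
      using eqs \<Delta> by simp
  qed
qed (simp_all add: br_hpb_hpb hpb_minus)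

text \<open>For a nonscalar matrix some vector and its image are independent; in the basis they
  form, Cayley-Hamilton determines the second column.\<close>

lemma exists_companion_basis:
  assumes S: "adPH S = 0" "adBH S = 0"
    and nonscalar: "\<not> (adPP S = adBB S \<and> adPB S = 0 \<and> adBP S = 0)"
  obtains \<alpha> \<beta> \<gamma> \<epsilon> where "\<alpha> * \<epsilon> - \<beta> * \<gamma> \<noteq> 0"
    "br S (hpb 0 \<alpha> \<beta>) = hpb 0 \<gamma> \<epsilon>"
    "br S (hpb 0 \<gamma> \<epsilon>) = scale (ad_trace S) (hpb 0 \<gamma> \<epsilon>) - scale (ad_det S) (hpb 0 \<alpha> \<beta>)"
proof -
  have "\<exists>\<alpha> \<beta>. \<alpha> * (\<alpha> * adPB S + \<beta> * adBB S) - \<beta> * (\<alpha> * adPP S + \<beta> * adBP S) \<noteq> 0"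
  proof (rule ccontr)
    assume "\<not> ?thesis"
    then have *: "\<alpha> * (\<alpha> * adPB S + \<beta> * adBB S) - \<beta> * (\<alpha> * adPP S + \<beta> * adBP S) = 0" for \<alpha> \<beta>
      by blast
    \<comment> \<open>The determinant of a vector and its image is a quadratic form in \<alpha> and
      \<beta>; vanishing at these three vectors kills all its coefficients and makes the matrix
      scalar.\<close>
    from *[of 1 0] *[of 0 1] *[of 1 1] nonscalar show False
      by simp
  qed
  then obtain \<alpha> \<beta> where
    "\<alpha> * (\<alpha> * adPB S + \<beta> * adBB S) - \<beta> * (\<alpha> * adPP S + \<beta> * adBP S) \<noteq> 0"
    by blast
  then show ?thesis
    by (rule that) (simp_all add: br_hpb S hpb_arith ad_trace_def ad_det_def algebra_simps)
qed

end

lemma UNIV_one_outer: "(UNIV :: one_outer set) = {iS}"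
  using one_outer.exhaust by auto

lemma UNIV_two_outer: "(UNIV :: two_outer set) = {iS1, iS2}"
  using two_outer.exhaust by auto

lemma CARD_outer: "CARD(one_outer) = 1" "CARD(two_outer) = 2" "CARD(heis_index) = 3"
  by (simp_all add: UNIV_heis_index UNIV_one_outer UNIV_two_outer)

section \<open>Representatives of L / N and its dimension\<close>

context heisenberg_nilradical
begin

definition one_dim_quotient :: "'v \<Rightarrow> bool" where
  "one_dim_quotient S \<longleftrightarrow> S \<notin> N \<and> (\<forall>y. \<exists>k. y - scale k S \<in> N)"

lemma basis_mod_N_one_outer:
  assumes "one_dim_quotient S" and "\<sigma> \<noteq> 0"
  shows "basis_mod_N (\<lambda>_ :: one_outer. scale \<sigma> S)"
  unfolding basis_mod_N_def
proof (intro conjI allI impI)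
  fix y
  obtain k where "y - scale k S \<in> N"
    using assms by (auto simp: one_dim_quotient_def)
  then show "\<exists>c. y - (\<Sum>a :: one_outer\<in>UNIV. scale (c a) (scale \<sigma> S)) \<in> N"
    using \<open>\<sigma> \<noteq> 0\<close> by (intro exI[of _ "\<lambda>_. k / \<sigma>"]) (simp add: UNIV_one_outer)
next
  fix c :: "one_outer \<Rightarrow> 'f" and a
  assume *: "(\<Sum>a :: one_outer\<in>UNIV. scale (c a) (scale \<sigma> S)) \<in> N"
  have "c iS = 0"
  proof (rule ccontr)
    assume "c iS \<noteq> 0"
    have "scale (c iS * \<sigma>) S \<in> N"
      using * by (simp add: UNIV_one_outer)
    from subspace_scale[OF subspace_N this, of "1 / (c iS * \<sigma>)"] have "S \<in> N"
      using \<open>c iS \<noteq> 0\<close> \<open>\<sigma> \<noteq> 0\<close> by simp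
    then show False
      using assms by (simp add: one_dim_quotient_def)
  qed
  then show "c a = 0"
    by (metis one_outer.exhaust)
qed

lemma dim_one_dim_quotient: "one_dim_quotient S \<Longrightarrow> dim UNIV = 4"
  using dim_UNIV_eq_CARD[OF bij_comb_outer_vec[OF basis_mod_N_one_outer[of S 1]]] by (simp add: CARD_outer)

text \<open>Let M be the matrix of \<open>S\<close> and T the matrix with columns (\<alpha>,
  \<beta>) and (\<gamma>, \<epsilon>). The hypotheses \<open>P\<close> and \<open>B\<close> say
  \<sigma> M T = T m, a similarity stated without an inverse. In the condition on \<open>r'\<close>
  the square of the rescaled element is measured against the new central vector.\<close>

lemma isomorphic_one_outer:
  assumes S: "one_dim_quotient S" "adPH S = 0" "adBH S = 0" "br S S = hpb r 0 0"
    and nz: "\<sigma> \<noteq> 0" "\<alpha> * \<epsilon> - \<beta> * \<gamma> \<noteq> 0"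
    and P: "\<sigma> * (adPP S * \<alpha> + adBP S * \<beta>) = m11 * \<alpha> + m21 * \<gamma>"
      "\<sigma> * (adPB S * \<alpha> + adBB S * \<beta>) = m11 * \<beta> + m21 * \<epsilon>"
    and B: "\<sigma> * (adPP S * \<gamma> + adBP S * \<epsilon>) = m12 * \<alpha> + m22 * \<gamma>"
      "\<sigma> * (adPB S * \<gamma> + adBB S * \<epsilon>) = m12 * \<beta> + m22 * \<epsilon>"
    and d: "d iS iH = (\<sigma> * ad_trace S) *s eH" "d iS iP = m11 *s eP + m21 *s eB"
      "d iS iB = m12 *s eP + m22 *s eB"
    and r': "r' * (\<alpha> * \<epsilon> - \<beta> * \<gamma>) = \<sigma>\<^sup>2 * r"
  shows "isomorphic scale br (*s) (ext_br d (\<lambda>_ _. r'))"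
proof -
  interpret new: heisenberg_nilradical scale br N "hpb (\<alpha> * \<epsilon> - \<beta> * \<gamma>) 0 0" "hpb 0 \<alpha> \<beta>" "hpb 0 \<gamma> \<epsilon>"
    using nz(2) by (rule heisenberg_nilradical_change_basis)
  have hpb: "new.hpb h p b = hpb (h * (\<alpha> * \<epsilon> - \<beta> * \<gamma>)) (p * \<alpha> + b * \<gamma>) (p * \<beta> + b * \<epsilon>)" for h p b
    by (simp add: new.hpb_def hpb_arith)
  have basis: "new.basis_mod_N (\<lambda>_ :: one_outer. scale \<sigma> S)"
    using basis_mod_N_one_outer[OF S(1) nz(1)] by simp
  have vec: "((\<sigma> * ad_trace S) *s eH) $ iH = \<sigma> * ad_trace S" "((\<sigma> * ad_trace S) *s eH) $ iP = 0"
    "((\<sigma> * ad_trace S) *s eH) $ iB = 0" "(x *s eP + y *s eB) $ iH = 0"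
    "(x *s eP + y *s eB) $ iP = x" "(x *s eP + y *s eB) $ iB = y" for x y
    by (simp_all add: axis_def)
  show ?thesis
  proof (rule new.isomorphic_ext_br[OF basis])
    fix a b :: one_outer
    have a: "a = iS"
      by (metis one_outer.exhaust)
    show "br (scale \<sigma> S) (hpb (\<alpha> * \<epsilon> - \<beta> * \<gamma>) 0 0) = new.hvec (d a iH)"
      unfolding a d new.hvec_def vec hpb
      by (simp add: br_scale_left[of \<sigma> S] br_hpb[of S] hpb_scale ad_trace_def algebra_simps)
    show "br (scale \<sigma> S) (hpb 0 \<alpha> \<beta>) = new.hvec (d a iP)"
      unfolding a d new.hvec_def vec hpb
      using P by (simp add: br_scale_left br_hpb[of S] hpb_scale S mult.commute)
    show "br (scale \<sigma> S) (hpb 0 \<gamma> \<epsilon>) = new.hvec (d a iB)"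
      unfolding a d new.hvec_def vec hpb
      using B by (simp add: br_scale_left br_hpb[of S] hpb_scale S mult.commute)
    show "br (scale \<sigma> S) (scale \<sigma> S) = new.hpb r' 0 0"
      unfolding hpb using r' by (simp add: br_scale_left br_scale_right S hpb_scale power2_eq_square)
  qed
qed

definition two_dim_quotient :: "'v \<Rightarrow> 'v \<Rightarrow> bool" where
  "two_dim_quotient S1 S2 \<longleftrightarrow>
    adPP S1 = 1 \<and> adPB S1 = 0 \<and> adBP S1 = 0 \<and> adBB S1 = 1 \<and>
    ad_trace S2 = 0 \<and> ad_det S2 \<noteq> 0 \<and> (\<forall>y. \<exists>k l. y - scale k S1 - scale l S2 \<in> N)"

lemma basis_mod_N_two_outer:
  assumes S: "two_dim_quotient S1 S2" and "\<sigma> \<noteq> 0"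
  shows "basis_mod_N (case_two_outer S1 (scale \<sigma> S2))"
  unfolding basis_mod_N_def
proof (intro conjI allI impI)
  fix y
  obtain k l where "y - scale k S1 - scale l S2 \<in> N"
    using S unfolding two_dim_quotient_def by blast
  then show "\<exists>c. y - (\<Sum>a\<in>UNIV. scale (c a) (case a of iS1 \<Rightarrow> S1 | iS2 \<Rightarrow> scale \<sigma> S2)) \<in> N"
    using \<open>\<sigma> \<noteq> 0\<close>
    by (intro exI[of _ "case_two_outer k (l / \<sigma>)"]) (simp add: UNIV_two_outer diff_diff_eq)
next
  fix c a assume "(\<Sum>a\<in>UNIV. scale (c a) (case a of iS1 \<Rightarrow> S1 | iS2 \<Rightarrow> scale \<sigma> S2)) \<in> N"
  then have *: "ad_zero (scale (c iS1) S1 + scale (c iS2) (scale \<sigma> S2))"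
    by (simp add: UNIV_two_outer in_N_iff)
  then have "ad_trace (scale (c iS1) S1 + scale (c iS2) (scale \<sigma> S2)) = 0"
    by (simp add: ad_zero_def ad_trace_def)
  then have c1: "c iS1 = 0"
    using S by (simp add: ad_trace_add ad_trace_scale two_dim_quotient_def ad_trace_def[of S1])
  have "c iS2 = 0"
  proof (rule ccontr)
    assume "c iS2 \<noteq> 0"
    then have "adPP S2 = 0" "adPB S2 = 0" "adBP S2 = 0" "adBB S2 = 0"
      using * c1 \<open>\<sigma> \<noteq> 0\<close> by (simp_all add: ad_zero_def ad_scale)
    then show False
      using S by (simp add: two_dim_quotient_def ad_det_def)
  qed
  with c1 show "c a = 0"
    by (metis two_outer.exhaust)
qed

lemma dim_two_dim_quotient: "two_dim_quotient S1 S2 \<Longrightarrow> dim UNIV = 5"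
  using dim_UNIV_eq_CARD[OF bij_comb_outer_vec[OF basis_mod_N_two_outer[of S1 S2 1]]]
  by (simp add: CARD_outer)

text \<open>An element acting as the identity has trace 2, which leaves only the zero square in
  \<open>br_self\<close>.\<close>

lemma br_self_two_dim_quotient:
  assumes "two_dim_quotient S1 S2"
  shows "br x x = 0"
proof -
  obtain r where r: "br x x = hpb r 0 0" "\<And>y. r * ad_trace y = 0"
    using br_self by blast
  have "ad_trace S1 = 2"
    using assms by (simp add: two_dim_quotient_def ad_trace_def)
  with r(2)[of S1] have "r = 0"
    by simp
  then show ?thesis
    using r(1) by simp
qed

lemma br_antisym_two_dim_quotient:
  assumes "two_dim_quotient S1 S2"
  shows "br x y = - br y x"
proof -
  have "br x y + br y x = br (x + y) (x + y) - br x x - br y y"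
    by (simp add: br_bilinear)
  then show ?thesis
    by (simp add: br_self_two_dim_quotient[OF assms] eq_neg_iff_add_eq_0)
qed

text \<open>Besides the similarity for \<open>S2\<close>, the two outer elements must be made to
  annihilate each other; a multiple of \<open>H\<close> added to \<open>S2\<close> achieves this and
  keeps its matrix.\<close>

lemma isomorphic_two_outer:
  assumes S: "two_dim_quotient S1 S2" and H: "adPH S1 = 0" "adBH S1 = 0" "adPH S2 = 0" "adBH S2 = 0"
    and nz: "\<sigma> \<noteq> 0" "\<alpha> * \<epsilon> - \<beta> * \<gamma> \<noteq> 0"
    and P: "\<sigma> * (adPP S2 * \<alpha> + adBP S2 * \<beta>) = m11 * \<alpha> + m21 * \<gamma>"
      "\<sigma> * (adPB S2 * \<alpha> + adBB S2 * \<beta>) = m11 * \<beta> + m21 * \<epsilon>"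
    and B: "\<sigma> * (adPP S2 * \<gamma> + adBP S2 * \<epsilon>) = m12 * \<alpha> + m22 * \<gamma>"
      "\<sigma> * (adPB S2 * \<gamma> + adBB S2 * \<epsilon>) = m12 * \<beta> + m22 * \<epsilon>"
    and d: "d iS1 iH = 2 *s eH" "d iS1 iP = eP" "d iS1 iB = eB"
      "d iS2 iH = 0" "d iS2 iP = m11 *s eP + m21 *s eB" "d iS2 iB = m12 *s eP + m22 *s eB"
  shows "isomorphic scale br (*s) (ext_br d (\<lambda>_ _. 0))"
proof -
  interpret new: heisenberg_nilradical scale br N "hpb (\<alpha> * \<epsilon> - \<beta> * \<gamma>) 0 0" "hpb 0 \<alpha> \<beta>" "hpb 0 \<gamma> \<epsilon>"
    using nz(2) by (rule heisenberg_nilradical_change_basis)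
  have hpb: "new.hpb h p b = hpb (h * (\<alpha> * \<epsilon> - \<beta> * \<gamma>)) (p * \<alpha> + b * \<gamma>) (p * \<beta> + b * \<epsilon>)" for h p b
    by (simp add: new.hpb_def hpb_arith)
  note S' = S[unfolded two_dim_quotient_def]
  have S1: "br S1 (hpb h p b) = hpb (2 * h) p b" for h p b
    using S' H by (simp add: br_hpb mult.commute)
  obtain h p b where h: "br S1 S2 = hpb h p b"
    using br_in_N_always N_cases by blast
  \<comment> \<open>Adapted representatives commute on \<open>P\<close> and \<open>B\<close>
    exactly, not only modulo \<open>H\<close>, so \<open>br S1 S2\<close> annihilates both and is a
    multiple of \<open>H\<close>.\<close>
  have "br (br S1 S2) (hpb 0 q c) = 0" for q c
    unfolding leibniz_left using S' by (simp add: S1 br_hpb H)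
  from this[of 1 0] this[of 0 1] have "p = 0" "b = 0"
    by (simp_all add: h br_hpb_hpb)
  \<comment> \<open>\<open>S1\<close> doubles \<open>H\<close>, so half of the coefficient of
    \<open>br S1 S2\<close> has to be subtracted.\<close>
  define T where "T = S2 + hpb (- (h / 2)) 0 0"
  have T: "adPP T = adPP S2" "adPB T = adPB S2" "adBP T = adBP S2" "adBB T = adBB S2"
    "adPH T = 0" "adBH T = 0"
    by (simp_all add: T_def ad_add H)
  have "\<exists>k l. y - scale k S1 - scale l T \<in> N" for y
  proof -
    obtain k l where "y - scale k S1 - scale l S2 \<in> N"
      using S' by blast
    then have "(y - scale k S1 - scale l S2) - scale l (hpb (- (h / 2)) 0 0) \<in> N"
      by (rule subspace_diff[OF subspace_N]) (simp add: hpb_scale)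
    then have "y - scale k S1 - scale l T \<in> N"
      by (simp add: T_def scale_right_distrib diff_diff_eq add.assoc)
    then show ?thesis
      by blast
  qed
  then have "two_dim_quotient S1 T"
    using S' by (simp add: two_dim_quotient_def T ad_trace_def ad_det_def)
  then have basis: "new.basis_mod_N (case_two_outer S1 (scale \<sigma> T))"
    using basis_mod_N_two_outer nz(1) by simp
  have br_S1_T: "br S1 T = 0"
    by (simp add: T_def br_add_right h S1 \<open>p = 0\<close> \<open>b = 0\<close> hpb_add)
  have br_T_S1: "br T S1 = 0"
    using br_antisym_two_dim_quotient[OF S, of T S1] by (simp add: br_S1_T)
  have vec: "eP $ iH = 0" "eP $ iP = 1" "eP $ iB = 0" "eB $ iH = 0" "eB $ iP = 0" "eB $ iB = 1"
    "eH $ iH = 1" "eH $ iP = 0" "eH $ iB = 0" "(x *s eP + y *s eB) $ iH = 0"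
    "(x *s eP + y *s eB) $ iP = x" "(x *s eP + y *s eB) $ iB = y" for x y :: 'f
    by (simp_all add: axis_def)
  have tr: "adPP S2 + adBB S2 = 0"
    using S' by (simp add: ad_trace_def)
  show ?thesis
  proof (rule new.isomorphic_ext_br[OF basis])
    fix a b :: two_outer
    show "br (case_two_outer S1 (scale \<sigma> T) a) (hpb (\<alpha> * \<epsilon> - \<beta> * \<gamma>) 0 0) = new.hvec (d a iH)"
      by (cases a) (simp_all add: d new.hvec_def vec hpb S1 br_scale_left br_hpb[of T] T tr hpb_scale)
    show "br (case_two_outer S1 (scale \<sigma> T) a) (hpb 0 \<alpha> \<beta>) = new.hvec (d a iP)"
      using P by (cases a) (simp_all add: d new.hvec_def vec hpb S1 br_scale_left br_hpb[of T] T hpb_scale mult.commute)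
    show "br (case_two_outer S1 (scale \<sigma> T) a) (hpb 0 \<gamma> \<epsilon>) = new.hvec (d a iB)"
      using B by (cases a) (simp_all add: d new.hvec_def vec hpb S1 br_scale_left br_hpb[of T] T hpb_scale mult.commute)
    show "br (case_two_outer S1 (scale \<sigma> T) a) (case_two_outer S1 (scale \<sigma> T) b) = new.hpb 0 0 0"
      by (cases a; cases b)
        (simp_all add: br_bilinear br_S1_T br_T_S1 br_self_two_dim_quotient[OF S] flip: new.hpb_zero)
  qed
qed

lemma diff_in_N: "m \<in> N \<Longrightarrow> n \<in> N \<Longrightarrow> m - n \<in> N"
  by (rule subspace_diff[OF subspace_N])

lemma scale_in_N: "n \<in> N \<Longrightarrow> scale c n \<in> N"
  by (rule subspace_scale[OF subspace_N])

text \<open>All matrices commute with that of \<open>u\<close>, and the centraliser of a nonscalar 2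
  x 2 matrix is spanned by it and the identity.\<close>

lemma nonscalar_generates:
  assumes "\<not> (adPP u = adBB u \<and> adPB u = 0 \<and> adBP u = 0)"
  shows "\<exists>k l. adPP z = k + l * adPP u \<and> adPB z = l * adPB u \<and>
    adBP z = l * adBP u \<and> adBB z = k + l * adBB u"
proof -
  have "ad_zero (br u z)"
    using br_in_N_always in_N_iff by blast
  then have "adBP u * adPB z - adBP z * adPB u = 0"
    "adPB u * adPP z + adBB u * adPB z - (adPB z * adPP u + adBB z * adPB u) = 0"
    "adPP u * adBP z + adBP u * adBB z - (adPP z * adBP u + adBP z * adBB u) = 0"
    unfolding ad_zero_def ad_br by blast+
  then have eqs: "adBP u * adPB z = adBP z * adPB u"
    "adPB z * (adPP u - adBB u) = adPB u * (adPP z - adBB z)"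
    "adBP z * (adPP u - adBB u) = adBP u * (adPP z - adBB z)"
    by algebra+
  have "\<exists>l. adPP z - adBB z = l * (adPP u - adBB u) \<and> adPB z = l * adPB u \<and> adBP z = l * adBP u"
  proof -
    consider "adPP u - adBB u \<noteq> 0" | "adPB u \<noteq> 0" | "adBP u \<noteq> 0"
      using assms by auto
    then show ?thesis
    proof cases
      case 1
      then show ?thesis
        using eqs by (intro exI[of _ "(adPP z - adBB z) / (adPP u - adBB u)"])
          (simp add: nonzero_eq_divide_eq mult.commute)
    next
      case 2
      then show ?thesis
        using eqs by (intro exI[of _ "adPB z / adPB u"]) (simp add: nonzero_eq_divide_eq mult.commute)
    next
      case 3
      then show ?thesis
        using eqs by (intro exI[of _ "adBP z / adBP u"]) (simp add: nonzero_eq_divide_eq mult.commute)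
    qed
  qed
  then obtain l where "adPP z - adBB z = l * (adPP u - adBB u)" "adPB z = l * adPB u"
    "adBP z = l * adBP u"
    by blast
  then show ?thesis
    by (intro exI[of _ "adPP z - l * adPP u"] exI[of _ l]) (simp add: algebra_simps)
qed

lemma scalar_in_N_iff:
  assumes "adPP x = adBB x \<and> adPB x = 0 \<and> adBP x = 0"
  shows "x \<in> N \<longleftrightarrow> adPP x = 0"
  using assms by (auto simp: in_N_iff ad_zero_def)

lemma one_or_two_dim_quotient:
  assumes "N \<noteq> UNIV"
  shows "(\<exists>S. one_dim_quotient S) \<or> (\<exists>S1 S2. two_dim_quotient S1 S2)"
proof (rule disjCI)
  let ?scalar = "\<lambda>x. adPP x = adBB x \<and> adPB x = 0 \<and> adBP x = 0"
  assume not_two: "\<not> (\<exists>S1 S2. two_dim_quotient S1 S2)"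
  \<comment> \<open>A nonzero scalar matrix next to a nonscalar one would yield the excluded pair:
    the identity and the traceless part of \<open>u\<close>.\<close>
  have no_identity: False if u: "\<not> ?scalar u" and v: "?scalar v" "v \<notin> N" for u v
  proof -
    define S1 where "S1 = scale (1 / adPP v) v"
    define S2 where "S2 = u - scale (ad_trace u / 2) S1"
    have "adPP v \<noteq> 0"
      using v by (simp add: scalar_in_N_iff)
    with v have S1: "adPP S1 = 1" "adPB S1 = 0" "adBP S1 = 0" "adBB S1 = 1"
      by (simp_all add: S1_def ad_scale)
    then have S2: "adPP S2 = (adPP u - adBB u) / 2" "adPB S2 = adPB u" "adBP S2 = adBP u"
      "adBB S2 = - ((adPP u - adBB u) / 2)"
      by (simp_all add: S2_def ad_diff ad_scale ad_trace_def field_simps)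
    have tr: "ad_trace S2 = 0"
      by (simp add: ad_trace_def S2)
    have "S2 \<notin> N"
      using u by (auto simp: in_N_iff ad_zero_def S2)
    then have "ad_det S2 \<noteq> 0"
      using not_nilpotent tr by blast
    moreover have "\<exists>k l. y - scale k S1 - scale l S2 \<in> N" for y
    proof -
      obtain k l where "adPP y = k + l * adPP u" "adPB y = l * adPB u"
        "adBP y = l * adBP u" "adBB y = k + l * adBB u"
        using nonscalar_generates[OF u, of y] by blast
      then have "y - scale (k + l * (ad_trace u / 2)) S1 - scale l S2 \<in> N"
        unfolding in_N_iff ad_zero_def ad_diff ad_scale S1 S2 ad_trace_def by (simp add: field_simps)
      then show ?thesis
        by blast
    qed
    ultimately have "two_dim_quotient S1 S2"
      by (simp add: two_dim_quotient_def S1 tr)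
    then show False
      using not_two by blast
  qed
  obtain S where S: "S \<notin> N"
    using assms by blast
  have "\<exists>S. S \<notin> N \<and> (\<forall>y. \<exists>k. y - scale k S \<in> N)"
  proof (cases "\<exists>u. \<not> ?scalar u")
    case True
    then obtain u where u: "\<not> ?scalar u"
      by blast
    then have "u \<notin> N"
      by (auto simp: in_N_iff ad_zero_def)
    moreover have "\<exists>k. y - scale k u \<in> N" for y
    proof -
      obtain k l where kl: "adPP y = k + l * adPP u" "adPB y = l * adPB u"
        "adBP y = l * adBP u" "adBB y = k + l * adBB u"
        using nonscalar_generates[OF u, of y] by blast
      have "?scalar (y - scale l u)"
        by (simp add: ad_diff ad_scale kl)
      then show ?thesis
        using no_identity[OF u] by blast
    qed
    ultimately show ?thesis
      by blast
  next
    case False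
    then have scalar: "?scalar y" for y
      by blast
    have "y - scale (adPP y / adPP S) S \<in> N" for y
      using S scalar_in_N_iff[OF scalar, of S] scalar_in_N_iff[OF scalar]
      by (simp add: ad_diff ad_scale)
    then show ?thesis
      using S by blast
  qed
  then show "\<exists>S. one_dim_quotient S"
    by (simp add: one_dim_quotient_def)
qed

lemma one_dim_quotient_cong:
  assumes "one_dim_quotient S" "S' - S \<in> N"
  shows "one_dim_quotient S'"
proof -
  have "S' \<notin> N"
    using assms subspace_diff[OF subspace_N, of S' "S' - S"] by (auto simp: one_dim_quotient_def)
  moreover have "\<exists>k. y - scale k S' \<in> N" for y
  proof -
    obtain k where "y - scale k S \<in> N"
      using assms by (auto simp: one_dim_quotient_def)
    then have "(y - scale k S) - scale k (S' - S) \<in> N"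
      using assms by (simp add: diff_in_N scale_in_N)
    then show ?thesis
      by (auto simp: scale_right_diff_distrib)
  qed
  ultimately show ?thesis
    by (simp add: one_dim_quotient_def)
qed

lemma two_dim_quotient_cong:
  assumes S: "two_dim_quotient S1 S2" "S1' - S1 \<in> N" "S2' - S2 \<in> N"
  shows "two_dim_quotient S1' S2'"
proof -
  have "\<exists>k l. y - scale k S1' - scale l S2' \<in> N" for y
  proof -
    obtain k l where "y - scale k S1 - scale l S2 \<in> N"
      using S unfolding two_dim_quotient_def by blast
    then have "(y - scale k S1 - scale l S2) - scale k (S1' - S1) - scale l (S2' - S2) \<in> N"
      using assms by (simp add: diff_in_N scale_in_N)
    then have "y - scale k S1' - scale l S2' \<in> N"
      by (simp add: scale_right_diff_distrib algebra_simps)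
    then show ?thesis
      by blast
  qed
  then show ?thesis
    using S(1) by (simp add: two_dim_quotient_def ad_trace_def ad_det_def ad_cong[OF S(2)] ad_cong[OF S(3)])
qed

lemma adapted_one_dim_quotient:
  assumes "one_dim_quotient S"
  obtains S' where "one_dim_quotient S'" "adPH S' = 0" "adBH S' = 0"
  using exists_adapted_representative[of S] one_dim_quotient_cong[OF assms] by metis

lemma adapted_two_dim_quotient:
  assumes "two_dim_quotient S1 S2"
  obtains S1' S2' where "two_dim_quotient S1' S2'"
    "adPH S1' = 0" "adBH S1' = 0" "adPH S2' = 0" "adBH S2' = 0"
  using exists_adapted_representative[of S1] exists_adapted_representative[of S2]
    two_dim_quotient_cong[OF assms] by metis

section \<open>From companion matrices to the listed tables\<close>

definition companion :: "'v \<Rightarrow> 'f \<Rightarrow> 'f \<Rightarrow> bool" where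
  "companion S t \<delta> \<longleftrightarrow> br S P = B \<and> br S B = scale t B - scale \<delta> P"

text \<open>In the basis \<open>P, B\<close> the matrix of \<open>S\<close> is the companion matrix
  of the polynomial X*X - t X + \<delta>, and \<open>S\<close> is adapted.\<close>

lemma companion_ad:
  assumes "companion S t \<delta>"
  shows "adPH S = 0" "adBH S = 0" "adPP S = 0" "adPB S = 1" "adBP S = - \<delta>" "adBB S = t"
    "ad_trace S = t" "ad_det S = \<delta>"
proof -
  have "br S P = hpb 0 0 1" "br S B = hpb 0 (- \<delta>) t"
    using assms by (simp_all add: companion_def hpb_def)
  then show "adPH S = 0" "adBH S = 0" "adPP S = 0" "adPB S = 1" "adBP S = - \<delta>" "adBB S = t"
    by (simp_all add: br_P br_B)
  then show "ad_trace S = t" "ad_det S = \<delta>"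
    by (simp_all add: ad_trace_def ad_det_def)
qed

text \<open>Scaling by \<open>2 / t\<close> makes the trace 2 and the eigenvalues
  \<open>1 + A\<close> and \<open>1 - A\<close>, with \<open>A\<^sup>2\<close> the discriminant over
  \<open>t\<^sup>2\<close>. The columns chosen are eigenvectors; their determinant
  \<open>4 * A / t\<close> is nonzero because \<open>A\<close> is.\<close>

lemma companion_br1:
  assumes S: "one_dim_quotient S" "companion S t \<delta>"
    and "t \<noteq> 0" "A\<^sup>2 = 1 - 4 * \<delta> / t\<^sup>2" "A \<noteq> 0"
  shows "isomorphic scale br (*s) (br1 A)"
proof -
  note ad = companion_ad[OF S(2)]
  obtain r where r: "br S S = hpb r 0 0" "\<And>y. r * ad_trace y = 0"
    using br_self by blast
  have "r = 0"
    using r(2)[of S] \<open>t \<noteq> 0\<close> by (simp add: ad)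
  have \<delta>: "\<delta> * 4 = t\<^sup>2 * (1 - A\<^sup>2)"
    using assms by (simp add: field_simps)
  show ?thesis
    unfolding br1_def
    by (rule isomorphic_one_outer[where \<sigma> = "2 / t" and \<alpha> = "- (1 - A)" and \<beta> = "2 / t"
          and \<gamma> = "- (1 + A)" and \<epsilon> = "2 / t" and ?m11.0 = "1 + A" and ?m21.0 = 0
          and ?m12.0 = 0 and ?m22.0 = "1 - A", OF S(1) ad(1,2) r(1)])
       (use assms \<delta> in \<open>simp_all add: ad \<open>r = 0\<close> field_simps power2_eq_square\<close>)
qed

text \<open>The scaled matrix has the double eigenvalue 1 and is not scalar. The second basis vector
  is the image of \<open>P\<close> under the scaled matrix minus the identity, which gives a Jordan
  chain.\<close>

lemma companion_br2:
  assumes S: "one_dim_quotient S" "companion S t \<delta>"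
    and "t \<noteq> 0" "4 * \<delta> = t\<^sup>2"
  shows "isomorphic scale br (*s) br2"
proof -
  note ad = companion_ad[OF S(2)]
  obtain r where r: "br S S = hpb r 0 0" "\<And>y. r * ad_trace y = 0"
    using br_self by blast
  have "r = 0"
    using r(2)[of S] \<open>t \<noteq> 0\<close> by (simp add: ad)
  show ?thesis
    unfolding br2_def
    by (rule isomorphic_one_outer[where \<sigma> = "2 / t" and \<alpha> = 1 and \<beta> = 0
          and \<gamma> = "- 1" and \<epsilon> = "2 / t" and ?m11.0 = 1 and ?m21.0 = 1
          and ?m12.0 = 0 and ?m22.0 = 1, OF S(1) ad(1,2) r(1)])
       (use assms in \<open>simp_all add: ad \<open>r = 0\<close> field_simps power2_eq_square\<close>)
qed

text \<open>The scaled matrix minus the identity squares to \<open>- C\<^sup>2\<close>;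
  \<open>P\<close> and its image under this difference, divided by \<open>C\<close>, give the
  block.\<close>

lemma companion_br3:
  assumes S: "one_dim_quotient S" "companion S t \<delta>"
    and "t \<noteq> 0" "C\<^sup>2 = 4 * \<delta> / t\<^sup>2 - 1" "C \<noteq> 0"
  shows "isomorphic scale br (*s) (br3 C)"
proof -
  note ad = companion_ad[OF S(2)]
  obtain r where r: "br S S = hpb r 0 0" "\<And>y. r * ad_trace y = 0"
    using br_self by blast
  have "r = 0"
    using r(2)[of S] \<open>t \<noteq> 0\<close> by (simp add: ad)
  have \<delta>: "\<delta> * 4 = t\<^sup>2 * (1 + C\<^sup>2)"
    using assms by (simp add: field_simps)
  show ?thesis
    unfolding br3_def
    by (rule isomorphic_one_outer[where \<sigma> = "2 / t" and \<alpha> = 1 and \<beta> = 0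
          and \<gamma> = "- 1 / C" and \<epsilon> = "2 / (t * C)" and ?m11.0 = 1 and ?m21.0 = C
          and ?m12.0 = "- C" and ?m22.0 = 1, OF S(1) ad(1,2) r(1)])
       (use assms \<delta> in \<open>simp_all add: ad \<open>r = 0\<close> field_simps power2_eq_square\<close>)
qed

text \<open>Scaling by \<sigma> makes the determinant -1 and the eigenvalues 1 and -1. The first
  eigenvector may be stretched by any nonzero \<kappa>, which rescales the central vector freely, so
  a nonzero \<open>r\<close> becomes 1.\<close>

lemma companion_br4:
  assumes S: "one_dim_quotient S" "companion S 0 \<delta>" and \<sigma>: "\<sigma>\<^sup>2 * \<delta> = - 1"
  shows "\<exists>r\<in>{0, 1}. isomorphic scale br (*s) (br4 r)"
proof -
  note ad = companion_ad[OF S(2)]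
  obtain r where r: "br S S = hpb r 0 0"
    by (rule br_self)
  have "\<sigma> \<noteq> 0"
    using \<sigma> by auto
  have sq: "\<sigma> * (\<delta> * (\<sigma> * x)) = - x" for x
    using \<sigma> by (metis mult.assoc mult.commute mult_minus1 power2_eq_square)
  have iso: "isomorphic scale br (*s) (br4 (\<sigma> * r / (2 * \<kappa>)))" if "\<kappa> \<noteq> 0" for \<kappa>
    unfolding br4_def
    by (rule isomorphic_one_outer[where \<sigma> = \<sigma> and \<alpha> = \<kappa> and \<beta> = "\<kappa> * \<sigma>"
          and \<gamma> = "- 1" and \<epsilon> = \<sigma> and ?m11.0 = 1 and ?m21.0 = 0
          and ?m12.0 = 0 and ?m22.0 = "- 1", OF S(1) ad(1,2) r])
       (use sq[of 1] sq[of \<kappa>] \<open>\<sigma> \<noteq> 0\<close> that in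
         \<open>simp_all add: ad power2_eq_square algebra_simps\<close>)
  show ?thesis
  proof (cases "r = 0")
    case True
    then show ?thesis
      using iso[of 1] by simp
  next
    case False
    then show ?thesis
      using iso[of "\<sigma> * r / 2"] \<open>\<sigma> \<noteq> 0\<close> by simp
  qed
qed

text \<open>The scaled matrix squares to minus the identity. The second basis vector is the image of
  the first, so stretching by \<kappa> affects both and divides the square by
  \<open>\<kappa>\<^sup>2\<close>.\<close>

lemma companion_br5:
  assumes S: "one_dim_quotient S" "companion S 0 \<delta>" and \<sigma>: "\<sigma>\<^sup>2 * \<delta> = 1"
  shows "\<exists>\<rho>. \<forall>\<kappa>. \<kappa> \<noteq> 0 \<longrightarrow> isomorphic scale br (*s) (br5 (\<rho> / \<kappa>\<^sup>2))"
proof -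
  note ad = companion_ad[OF S(2)]
  obtain r where r: "br S S = hpb r 0 0"
    by (rule br_self)
  have "\<sigma> \<noteq> 0"
    using \<sigma> by auto
  have "isomorphic scale br (*s) (br5 (\<sigma> * r / \<kappa>\<^sup>2))" if "\<kappa> \<noteq> 0" for \<kappa>
    unfolding br5_def
    by (rule isomorphic_one_outer[where \<sigma> = \<sigma> and \<alpha> = \<kappa> and \<beta> = 0
          and \<gamma> = 0 and \<epsilon> = "\<kappa> * \<sigma>" and ?m11.0 = 0 and ?m21.0 = 1
          and ?m12.0 = "- 1" and ?m22.0 = 0, OF S(1) ad(1,2) r])
       (use \<sigma> \<open>\<sigma> \<noteq> 0\<close> that in \<open>simp_all add: ad field_simps power2_eq_square\<close>)
  then show ?thesis
    by blast
qed

text \<open>A scalar matrix has no cyclic vector, so this case bypasses the companion form.\<close>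

lemma scalar_br1:
  assumes S: "one_dim_quotient S" "adPH S = 0" "adBH S = 0"
    and scalar: "adPP S = adBB S" "adPB S = 0" "adBP S = 0"
  shows "isomorphic scale br (*s) (br1 0)"
proof -
  have nz: "adBB S \<noteq> 0"
    using S scalar scalar_in_N_iff[of S] by (auto simp: one_dim_quotient_def)
  obtain r where r: "br S S = hpb r 0 0" "\<And>y. r * ad_trace y = 0"
    using br_self by blast
  have "r = 0"
    using r(2)[of S] nz by (simp add: ad_trace_def scalar)
  show ?thesis
    unfolding br1_def
    by (rule isomorphic_one_outer[where \<sigma> = "1 / adBB S" and \<alpha> = 1 and \<beta> = 0
          and \<gamma> = 0 and \<epsilon> = 1 and ?m11.0 = 1 and ?m21.0 = 0
          and ?m12.0 = 0 and ?m22.0 = 1, OF S r(1)])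
       (use nz in \<open>simp_all add: ad_trace_def scalar \<open>r = 0\<close>\<close>)
qed

lemma companion_br6:
  assumes S: "two_dim_quotient S1 S2" "adPH S1 = 0" "adBH S1 = 0"
    and "companion S2 0 \<delta>" and \<sigma>: "\<sigma>\<^sup>2 * \<delta> = - 1"
  shows "isomorphic scale br (*s) br6"
proof -
  note ad = companion_ad[OF assms(4)]
  have "\<sigma> \<noteq> 0"
    using \<sigma> by auto
  then show ?thesis
    unfolding br6_def
    by (intro isomorphic_two_outer[where \<sigma> = \<sigma> and \<alpha> = 1 and \<beta> = \<sigma>
          and \<gamma> = "- 1" and \<epsilon> = \<sigma> and ?m11.0 = 1 and ?m21.0 = 0
          and ?m12.0 = 0 and ?m22.0 = "- 1", OF S ad(1,2)])
       (use \<sigma> in \<open>simp_all add: ad field_simps power2_eq_square\<close>)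
qed

lemma companion_br7:
  assumes S: "two_dim_quotient S1 S2" "adPH S1 = 0" "adBH S1 = 0"
    and "companion S2 0 \<delta>" and \<sigma>: "\<sigma>\<^sup>2 * \<delta> = 1"
  shows "isomorphic scale br (*s) br7"
proof -
  note ad = companion_ad[OF assms(4)]
  have "\<sigma> \<noteq> 0"
    using \<sigma> by auto
  then show ?thesis
    unfolding br7_def
    by (intro isomorphic_two_outer[where \<sigma> = \<sigma> and \<alpha> = 1 and \<beta> = 0
          and \<gamma> = 0 and \<epsilon> = \<sigma> and ?m11.0 = 0 and ?m21.0 = 1
          and ?m12.0 = "- 1" and ?m22.0 = 0, OF S ad(1,2)])
       (use \<sigma> in \<open>simp_all add: ad field_simps power2_eq_square\<close>)
qed

lemma exists_companion:
  assumes S: "adPH S = 0" "adBH S = 0"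
    and nonscalar: "\<not> (adPP S = adBB S \<and> adPB S = 0 \<and> adBP S = 0)"
  obtains \<Delta> \<alpha> \<beta> \<gamma> \<epsilon> where
    "heisenberg_nilradical scale br N (hpb \<Delta> 0 0) (hpb 0 \<alpha> \<beta>) (hpb 0 \<gamma> \<epsilon>)"
    "heisenberg_nilradical.companion scale br (hpb 0 \<alpha> \<beta>) (hpb 0 \<gamma> \<epsilon>) S (ad_trace S) (ad_det S)"
proof -
  obtain \<alpha> \<beta> \<gamma> \<epsilon> where \<Delta>: "\<alpha> * \<epsilon> - \<beta> * \<gamma> \<noteq> 0"
    and br: "br S (hpb 0 \<alpha> \<beta>) = hpb 0 \<gamma> \<epsilon>"
      "br S (hpb 0 \<gamma> \<epsilon>) = scale (ad_trace S) (hpb 0 \<gamma> \<epsilon>) - scale (ad_det S) (hpb 0 \<alpha> \<beta>)"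
    by (rule exists_companion_basis[OF assms])
  interpret new: heisenberg_nilradical scale br N "hpb (\<alpha> * \<epsilon> - \<beta> * \<gamma>) 0 0" "hpb 0 \<alpha> \<beta>" "hpb 0 \<gamma> \<epsilon>"
    using \<Delta> by (rule heisenberg_nilradical_change_basis)
  show ?thesis
    by (rule that[OF new.heisenberg_nilradical_axioms]) (simp add: new.companion_def br)
qed

text \<open>Stated before the field is chosen: \<open>D\<close> is the discriminant over the squared
  trace, \<delta> the determinant in the trace-zero case, and each conclusion waits for the square
  root it uses. \<open>br2\<close> enters when the discriminant vanishes.\<close>

lemma classification_one_dim_quotient:
  assumes "one_dim_quotient S"
  shows "(\<exists>D. (\<forall>A. A\<^sup>2 = D \<longrightarrow> isomorphic scale br (*s) (br1 A) \<or> isomorphic scale br (*s) br2) \<and>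
      (\<forall>C. C\<^sup>2 = - D \<and> C \<noteq> 0 \<longrightarrow> isomorphic scale br (*s) (br3 C))) \<or>
    (\<exists>\<delta>::'f. \<delta> \<noteq> 0 \<and>
      (\<forall>\<sigma>. \<sigma>\<^sup>2 * \<delta> = - 1 \<longrightarrow> (\<exists>r\<in>{0, 1}. isomorphic scale br (*s) (br4 r))) \<and>
      (\<forall>\<sigma>. \<sigma>\<^sup>2 * \<delta> = 1 \<longrightarrow>
        (\<exists>\<rho>. \<forall>\<kappa>. \<kappa> \<noteq> 0 \<longrightarrow> isomorphic scale br (*s) (br5 (\<rho> / \<kappa>\<^sup>2)))))"
    (is "?X \<or> ?Y")
proof -
  obtain S where S: "one_dim_quotient S" "adPH S = 0" "adBH S = 0"
    using adapted_one_dim_quotient[OF assms] .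
  have nil: "\<not> (ad_trace S = 0 \<and> ad_det S = 0)"
    using S not_nilpotent by (simp add: one_dim_quotient_def)
  show ?thesis
  proof (cases "adPP S = adBB S \<and> adPB S = 0 \<and> adBP S = 0")
    case True
    then have "isomorphic scale br (*s) (br1 0)"
      using scalar_br1[OF S] by blast
    then have ?X
      by (intro exI[of _ 0]) simp
    then show ?thesis ..
  next
    case False
    then obtain \<Delta> \<alpha> \<beta> \<gamma> \<epsilon> where
      new: "heisenberg_nilradical scale br N (hpb \<Delta> 0 0) (hpb 0 \<alpha> \<beta>) (hpb 0 \<gamma> \<epsilon>)"
        "heisenberg_nilradical.companion scale br (hpb 0 \<alpha> \<beta>) (hpb 0 \<gamma> \<epsilon>) S (ad_trace S) (ad_det S)"
      by (rule exists_companion[OF S(2,3)])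
    interpret new: heisenberg_nilradical scale br N "hpb \<Delta> 0 0" "hpb 0 \<alpha> \<beta>" "hpb 0 \<gamma> \<epsilon>"
      by (rule new)
    have S': "new.one_dim_quotient S"
      using S by (simp add: new.one_dim_quotient_def one_dim_quotient_def)
    show ?thesis
    proof (cases "ad_trace S = 0")
      case True
      with new(2) have c: "new.companion S 0 (ad_det S)"
        by simp
      have ?Y
      proof (rule exI[of _ "ad_det S"], intro conjI allI impI)
        show "ad_det S \<noteq> 0"
          using nil True by simp
      qed (rule new.companion_br4[OF S' c] new.companion_br5[OF S' c], assumption)+
      then show ?thesis ..
    next
      case False
      define D where "D = 1 - 4 * ad_det S / (ad_trace S)\<^sup>2"
      have "isomorphic scale br (*s) (br1 A) \<or> isomorphic scale br (*s) br2" if "A\<^sup>2 = D" for A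
      proof (cases "A = 0")
        case True
        then have "4 * ad_det S = (ad_trace S)\<^sup>2"
          using that False by (simp add: D_def)
        then show ?thesis
          using new.companion_br2[OF S' new(2) False] by blast
      next
        case nz: False
        show ?thesis
          using new.companion_br1[OF S' new(2) False _ nz] that by (simp add: D_def)
      qed
      moreover have "isomorphic scale br (*s) (br3 C)" if "C\<^sup>2 = - D" "C \<noteq> 0" for C
        using new.companion_br3[OF S' new(2) False _ that(2)] that(1) by (simp add: D_def)
      ultimately show ?thesis
        by blast
    qed
  qed
qed

lemma classification_two_dim_quotient:
  assumes "two_dim_quotient S1 S2"
  shows "\<exists>\<delta>::'f. \<delta> \<noteq> 0 \<and>
    (\<forall>\<sigma>. \<sigma>\<^sup>2 * \<delta> = - 1 \<longrightarrow> isomorphic scale br (*s) br6) \<and>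
    (\<forall>\<sigma>. \<sigma>\<^sup>2 * \<delta> = 1 \<longrightarrow> isomorphic scale br (*s) br7)"
proof -
  obtain S1 S2 where S: "two_dim_quotient S1 S2"
    and H: "adPH S1 = 0" "adBH S1 = 0" "adPH S2 = 0" "adBH S2 = 0"
    using adapted_two_dim_quotient[OF assms] .
  have S2: "ad_trace S2 = 0" "ad_det S2 \<noteq> 0"
    using S by (auto simp: two_dim_quotient_def)
  then have "\<not> (adPP S2 = adBB S2 \<and> adPB S2 = 0 \<and> adBP S2 = 0)"
    by (auto simp: ad_trace_def ad_det_def)
  then obtain \<Delta> \<alpha> \<beta> \<gamma> \<epsilon> where
    new: "heisenberg_nilradical scale br N (hpb \<Delta> 0 0) (hpb 0 \<alpha> \<beta>) (hpb 0 \<gamma> \<epsilon>)"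
      "heisenberg_nilradical.companion scale br (hpb 0 \<alpha> \<beta>) (hpb 0 \<gamma> \<epsilon>) S2 (ad_trace S2) (ad_det S2)"
    by (rule exists_companion[OF H(3,4)])
  interpret new: heisenberg_nilradical scale br N "hpb \<Delta> 0 0" "hpb 0 \<alpha> \<beta>" "hpb 0 \<gamma> \<epsilon>"
    by (rule new)
  have c: "new.companion S2 0 (ad_det S2)"
    using new(2) S2 by simp
  \<comment> \<open>The identity matrix is the same in every basis, so \<open>S1\<close> keeps its
    normalisation.\<close>
  have "br S1 (hpb 0 q c) = hpb 0 q c" for q c
    using S H by (simp add: br_hpb two_dim_quotient_def)
  then have S1: "new.adPP S1 = 1" "new.adPB S1 = 0" "new.adBP S1 = 0" "new.adBB S1 = 1"
    "new.adPH S1 = 0" "new.adBH S1 = 0"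
    using new.br_P[of S1] new.br_B[of S1] new.hpb_P new.hpb_B by (metis new.hpb_eq_iff)+
  have two: "new.two_dim_quotient S1 S2"
    using S S1 new.companion_ad[OF c] unfolding new.two_dim_quotient_def two_dim_quotient_def by simp
  show ?thesis
  proof (rule exI[of _ "ad_det S2"], intro conjI allI impI)
    show "ad_det S2 \<noteq> 0"
      by (rule S2)
  qed (rule new.companion_br6[OF two S1(5,6) c] new.companion_br7[OF two S1(5,6) c], assumption)+
qed

end

section \<open>The listed algebras\<close>

lemma sum_UNIV_outer:
  fixes f :: "'s::finite + heis_index \<Rightarrow> 'b::comm_monoid_add"
  shows "sum f UNIV = (\<Sum>s\<in>UNIV. f (Inl s)) + (f (Inr iH) + f (Inr iP) + f (Inr iB))"
  by (simp add: UNIV_Plus_UNIV[symmetric] sum.Plus UNIV_heis_index add.assoc)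

lemma bilinear_ext_axis: "bilinear_ext T (axis i 1) (axis j 1) = T i j"
proof -
  have "((axis i 1 :: 'a ^ 'b) $ k * (axis j 1 :: 'a ^ 'b) $ l) *s T k l =
      (if l = j then if k = i then T i j else 0 else 0)" for k l
    by (simp add: axis_def)
  then show ?thesis
    by (simp add: bilinear_ext_def)
qed

lemma linear_bilinear_ext_left: "Vector_Spaces.linear (*s) (*s) (\<lambda>x. bilinear_ext T x y)"
  unfolding Vector_Spaces.linear_iff
  by (auto simp: vec.vector_space_axioms bilinear_ext_def vec.scale_left_distrib sum.distrib
      distrib_right vec.scale_sum_right mult.assoc)

lemma linear_bilinear_ext_right: "Vector_Spaces.linear (*s) (*s) (\<lambda>y. bilinear_ext T x y)"
  unfolding Vector_Spaces.linear_iff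
  by (auto simp: vec.vector_space_axioms bilinear_ext_def vec.scale_left_distrib sum.distrib
      distrib_left vec.scale_sum_right mult.left_commute)

lemma leibniz_algebra_bilinear_ext:
  assumes "\<And>x y z. bilinear_ext T x (bilinear_ext T y z) =
    bilinear_ext T (bilinear_ext T x y) z + bilinear_ext T y (bilinear_ext T x z)"
  shows "leibniz_algebra (*s) (bilinear_ext T)"
proof (intro leibniz_algebra.intro leibniz_algebra_axioms.intro)
  show "\<exists>X. finite X \<and> vec.span X = UNIV"
    using vec.finite_Basis vec.span_Basis by blast
qed (rule vec.vector_space_axioms linear_bilinear_ext_left linear_bilinear_ext_right assms)+

text \<open>\<open>d_commute\<close> lists the entries of the commutators of the matrices and, with
  \<open>r_trace\<close>, yields the Leibniz identity. \<open>d_not_nilpotent\<close> says that only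
  the trivial combination of the matrices is nilpotent, which makes \<open>N\<close> the
  nilradical.\<close>

locale heisenberg_extension =
  fixes d :: "'s::finite \<Rightarrow> heis_index \<Rightarrow> 'f::field_char_0 ^ heis_index"
    and r :: "'s \<Rightarrow> 's \<Rightarrow> 'f"
  assumes d_H: "d s iH = (d s iP $ iP + d s iB $ iB) *s eH"
    and d_PH [simp]: "d s iP $ iH = 0"
    and d_BH [simp]: "d s iB $ iH = 0"
    and d_commute:
      "d s iB $ iP * d t iP $ iB = d t iB $ iP * d s iP $ iB"
      "d s iP $ iB * (d t iP $ iP - d t iB $ iB) = d t iP $ iB * (d s iP $ iP - d s iB $ iB)"
      "d s iB $ iP * (d t iP $ iP - d t iB $ iB) = d t iB $ iP * (d s iP $ iP - d s iB $ iB)"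
    and r_trace: "r s t * (d u iP $ iP + d u iB $ iB) = 0"
    and d_not_nilpotent:
      "(\<Sum>s\<in>UNIV. c s * d s iP $ iP) + (\<Sum>s\<in>UNIV. c s * d s iB $ iB) = 0 \<Longrightarrow>
       (\<Sum>s\<in>UNIV. c s * d s iP $ iP) * (\<Sum>s\<in>UNIV. c s * d s iB $ iB) -
         (\<Sum>s\<in>UNIV. c s * d s iB $ iP) * (\<Sum>s\<in>UNIV. c s * d s iP $ iB) = 0 \<Longrightarrow> c u = 0"
begin

abbreviation br :: "'f ^ ('s + heis_index) \<Rightarrow> 'f ^ ('s + heis_index) \<Rightarrow> 'f ^ ('s + heis_index)" where
  "br \<equiv> ext_br d r"

abbreviation "fH \<equiv> axis (Inr iH) 1 :: 'f ^ ('s + heis_index)"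
abbreviation "fP \<equiv> axis (Inr iP) 1 :: 'f ^ ('s + heis_index)"
abbreviation "fB \<equiv> axis (Inr iB) 1 :: 'f ^ ('s + heis_index)"

definition mPP :: "'f ^ ('s + heis_index) \<Rightarrow> 'f" where
  "mPP x = (\<Sum>s\<in>UNIV. x $ Inl s * d s iP $ iP)"
definition mPB :: "'f ^ ('s + heis_index) \<Rightarrow> 'f" where
  "mPB x = (\<Sum>s\<in>UNIV. x $ Inl s * d s iP $ iB)"
definition mBP :: "'f ^ ('s + heis_index) \<Rightarrow> 'f" where
  "mBP x = (\<Sum>s\<in>UNIV. x $ Inl s * d s iB $ iP)"
definition mBB :: "'f ^ ('s + heis_index) \<Rightarrow> 'f" where
  "mBB x = (\<Sum>s\<in>UNIV. x $ Inl s * d s iB $ iB)"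
definition rH :: "'f ^ ('s + heis_index) \<Rightarrow> 'f ^ ('s + heis_index) \<Rightarrow> 'f" where
  "rH x y = (\<Sum>s\<in>UNIV. \<Sum>t\<in>UNIV. x $ Inl s * y $ Inl t * r s t)"

lemma br_component:
  "br x y $ k = (\<Sum>i\<in>UNIV. \<Sum>j\<in>UNIV. x $ i * y $ j * ext_table d r i j $ k)"
  by (simp add: ext_br_def bilinear_ext_def)

lemma br_Inl [simp]: "br x y $ Inl s = 0"
  by (simp add: br_component sum_UNIV_outer heis_incl_def)

lemma br_Inr [simp]:
  "br x y $ Inr iH = rH x y + (mPP x + mBB x) * y $ Inr iH - (mPP y + mBB y) * x $ Inr iH +
     x $ Inr iP * y $ Inr iB - x $ Inr iB * y $ Inr iP"
  "br x y $ Inr iP = mPP x * y $ Inr iP + mBP x * y $ Inr iB - (mPP y * x $ Inr iP + mBP y * x $ Inr iB)"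
  "br x y $ Inr iB = mPB x * y $ Inr iP + mBB x * y $ Inr iB - (mPB y * x $ Inr iP + mBB y * x $ Inr iB)"
proof -
  have axis: "eH $ iH = (1 :: 'f)" "eH $ iP = (0 :: 'f)" "eH $ iB = (0 :: 'f)"
    by (simp_all add: axis_def)
  show "br x y $ Inr iH = rH x y + (mPP x + mBB x) * y $ Inr iH - (mPP y + mBB y) * x $ Inr iH +
     x $ Inr iP * y $ Inr iB - x $ Inr iB * y $ Inr iP"
    by (simp add: br_component sum_UNIV_outer heis_incl_def d_H axis rH_def mPP_def mBB_def sum.distrib
        sum_distrib_right sum_distrib_left sum_negf)
      (simp add: sum_distrib_right sum_distrib_left distrib_left distrib_right left_diff_distrib right_diff_distrib
        sum.distrib sum_subtractf sum_negf mult_ac)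
  show
  "br x y $ Inr iP = mPP x * y $ Inr iP + mBP x * y $ Inr iB - (mPP y * x $ Inr iP + mBP y * x $ Inr iB)"
    by (simp add: br_component sum_UNIV_outer heis_incl_def d_H axis mPP_def mBP_def sum.distrib
      sum_distrib_right sum_distrib_left sum_negf mult_ac)
  show
  "br x y $ Inr iB = mPB x * y $ Inr iP + mBB x * y $ Inr iB - (mPB y * x $ Inr iP + mBB y * x $ Inr iB)"
    by (simp add: br_component sum_UNIV_outer heis_incl_def d_H axis mPB_def mBB_def sum.distrib
      sum_distrib_right sum_distrib_left sum_negf mult_ac)
qed

lemma vec_outer_eq_iff:
  "x = y \<longleftrightarrow> (\<forall>s. x $ Inl s = y $ Inl s) \<and> x $ Inr iH = y $ Inr iH \<and>
    x $ Inr iP = y $ Inr iP \<and> x $ Inr iB = y $ Inr iB"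
  for x y :: "'f ^ ('s + heis_index)"
proof
  assume *: "(\<forall>s. x $ Inl s = y $ Inl s) \<and> x $ Inr iH = y $ Inr iH \<and>
    x $ Inr iP = y $ Inr iP \<and> x $ Inr iB = y $ Inr iB"
  have "x $ Inr j = y $ Inr j" for j
    using * by (cases j) simp_all
  with * have "x $ i = y $ i" for i
    by (cases i) simp_all
  then show "x = y"
    by (simp add: vec_eq_iff)
qed simp

lemma m_br [simp]:
  "mPP (br x y) = 0" "mPB (br x y) = 0" "mBP (br x y) = 0" "mBB (br x y) = 0"
  by (simp_all add: mPP_def mPB_def mBP_def mBB_def)

lemma rH_br [simp]: "rH (br x y) z = 0" "rH z (br x y) = 0"
  by (simp_all add: rH_def)

text \<open>Each relation has the shape \<open>f s * g t = f t * g s\<close>, which passes to linear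
  combinations.\<close>

lemma m_commute:
  "mBP x * mPB y = mBP y * mPB x"
  "mPB x * (mPP y - mBB y) = mPB y * (mPP x - mBB x)"
  "mBP x * (mPP y - mBB y) = mBP y * (mPP x - mBB x)"
proof -
  have swap: "(\<Sum>s\<in>UNIV. x $ Inl s * f s) * (\<Sum>t\<in>UNIV. y $ Inl t * g t) =
      (\<Sum>s\<in>UNIV. y $ Inl s * f s) * (\<Sum>t\<in>UNIV. x $ Inl t * g t)"
    if "\<And>s t. f s * g t = f t * g s" for f g :: "'s \<Rightarrow> 'f"
  proof -
    have "x $ Inl s * f s * (y $ Inl t * g t) = y $ Inl t * f t * (x $ Inl s * g s)" for s t
      using that[of s t] by (simp add: mult_ac)
    then have "(\<Sum>s\<in>UNIV. x $ Inl s * f s) * (\<Sum>t\<in>UNIV. y $ Inl t * g t) =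
        (\<Sum>s\<in>UNIV. \<Sum>t\<in>UNIV. y $ Inl t * f t * (x $ Inl s * g s))"
      by (simp only: sum_product)
    also have "\<dots> = (\<Sum>t\<in>UNIV. \<Sum>s\<in>UNIV. y $ Inl t * f t * (x $ Inl s * g s))"
      by (rule sum.swap)
    finally show ?thesis
      by (simp only: sum_product)
  qed
  have diff: "mPP y - mBB y = (\<Sum>t\<in>UNIV. y $ Inl t * (d t iP $ iP - d t iB $ iB))" for y
    by (simp add: mPP_def mBB_def right_diff_distrib sum_subtractf)
  show "mBP x * mPB y = mBP y * mPB x"
    "mPB x * (mPP y - mBB y) = mPB y * (mPP x - mBB x)"
    "mBP x * (mPP y - mBB y) = mBP y * (mPP x - mBB x)"
    unfolding diff unfolding mBP_def mPB_def by (rule swap, rule d_commute)+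
qed

lemma rH_trace: "rH x y * (mPP z + mBB z) = 0"
proof -
  have tr: "mPP z + mBB z = (\<Sum>u\<in>UNIV. z $ Inl u * (d u iP $ iP + d u iB $ iB))"
    by (simp add: mPP_def mBB_def distrib_left sum.distrib)
  have "x $ Inl s * y $ Inl t * r s t * (z $ Inl u * (d u iP $ iP + d u iB $ iB)) = 0" for s t u
    using r_trace[of s t u] by auto
  then show ?thesis
    unfolding tr rH_def sum_distrib_right unfolding sum_distrib_left by (simp only: sum.neutral_const)
qed

sublocale leibniz_algebra "(*s)" br
  unfolding ext_br_def
proof (rule leibniz_algebra_bilinear_ext, unfold ext_br_def[symmetric])
  fix x y z
  note c = m_commute[of x y] m_commute[of x z] m_commute[of y z]
  \<comment> \<open>Only the \<open>H\<close> component sees \<open>rH\<close>, and always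
    multiplied by a trace.\<close>
  note r = rH_trace[of x y z] rH_trace[of x z y] rH_trace[of y z x]
  show "br x (br y z) = br (br x y) z + br y (br x z)"
    unfolding vec_outer_eq_iff
  proof (intro conjI allI)
    show "br x (br y z) $ Inr iH = (br (br x y) z + br y (br x z)) $ Inr iH"
      using r c by (simp, algebra)
    show "br x (br y z) $ Inr iP = (br (br x y) z + br y (br x z)) $ Inr iP"
      using c by (simp, algebra)
    show "br x (br y z) $ Inr iB = (br (br x y) z + br y (br x z)) $ Inr iB"
      using c by (simp, algebra)
  qed simp
qed

definition N :: "('f ^ ('s + heis_index)) set" where
  "N = {x. \<forall>s. x $ Inl s = 0}"

lemma axis_component [simp]:
  "fH $ Inl s = 0" "fH $ Inr iH = 1" "fH $ Inr iP = 0" "fH $ Inr iB = 0"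
  "fP $ Inl s = 0" "fP $ Inr iH = 0" "fP $ Inr iP = 1" "fP $ Inr iB = 0"
  "fB $ Inl s = 0" "fB $ Inr iH = 0" "fB $ Inr iP = 0" "fB $ Inr iB = 1"
  by (simp_all add: axis_def)

lemma N_m [simp]:
  assumes "n \<in> N"
  shows "mPP n = 0" "mPB n = 0" "mBP n = 0" "mBB n = 0" "rH n x = 0" "rH x n = 0"
  using assms by (simp_all add: N_def mPP_def mPB_def mBP_def mBB_def rH_def)

lemma axis_in_N [simp]: "fH \<in> N" "fP \<in> N" "fB \<in> N"
  by (simp_all add: N_def)

lemma br_in_N [simp]: "br x y \<in> N"
  by (simp add: N_def)

lemma subspace_N: "vec.subspace N"
  by (simp add: N_def vec.subspace_def)

lemma ideal_N: "ideal N"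
  using subspace_N by (simp add: ideal_def)

lemma N_decompose:
  assumes "n \<in> N"
  shows "n = n $ Inr iH *s fH + n $ Inr iP *s fP + n $ Inr iB *s fB"
  using assms by (simp add: vec_outer_eq_iff N_def)

lemma N_eq: "N = {h *s fH + p *s fP + b *s fB | h p b. True}"
proof
  show "N \<subseteq> {h *s fH + p *s fP + b *s fB | h p b. True}"
    using N_decompose by blast
qed (auto simp: N_def)

lemma N_eq_span_HPB: "N = span_HPB"
proof
  show "N \<subseteq> span_HPB"
  proof
    fix n assume "n \<in> N"
    then obtain h p b where n: "n = h *s fH + p *s fP + b *s fB"
      unfolding N_eq by blast
    show "n \<in> span_HPB"
      unfolding n span_HPB_def by (intro vec.span_add vec.span_scale vec.span_base) auto
  qed
  show "span_HPB \<subseteq> N"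
    unfolding span_HPB_def by (rule vec.span_minimal[OF _ subspace_N]) auto
qed

definition "FH = {n \<in> N. n $ Inr iP = 0 \<and> n $ Inr iB = 0}"

lemma subspace_FH: "vec.subspace FH"
  using subspace_N by (auto simp: FH_def vec.subspace_def)

lemma br_N_N: "m \<in> N \<Longrightarrow> n \<in> N \<Longrightarrow> br m n \<in> FH"
  by (simp add: FH_def)

lemma br_N_FH: "m \<in> N \<Longrightarrow> n \<in> FH \<Longrightarrow> br m n = 0"
  by (simp add: FH_def vec_outer_eq_iff)

lemma solvable: solvable
proof -
  have "derived_series 1 \<subseteq> N"
    by (simp, intro brspan_subset subspace_N) simp
  then have "derived_series 2 \<subseteq> FH"
    by (simp add: numeral_2_eq_2, intro brspan_subset subspace_FH) (auto intro: br_N_N)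
  then have "derived_series 3 \<subseteq> {0}"
    by (simp add: numeral_3_eq_3 numeral_2_eq_2, intro brspan_subset vec.subspace_single_0)
      (auto simp: FH_def intro!: br_N_FH)
  moreover have "0 \<in> derived_series 3"
    by (simp add: numeral_3_eq_3 zero_in_brspan)
  ultimately show ?thesis
    unfolding solvable_def by blast
qed

lemma nilpotent_ideal_N: "nilpotent_ideal N"
proof -
  have "lower_central_series N 1 \<subseteq> FH"
    by (simp, intro brspan_subset subspace_FH) (rule br_N_N)
  then have "lower_central_series N 2 \<subseteq> {0}"
    by (simp add: numeral_2_eq_2, intro brspan_subset vec.subspace_single_0) (auto intro!: br_N_FH)
  moreover have "0 \<in> lower_central_series N 2"
    by (simp add: numeral_2_eq_2 zero_in_brspan)
  ultimately show ?thesis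
    unfolding nilpotent_ideal_def using ideal_N by blast
qed

definition "m_trace x = mPP x + mBB x"
definition "m_det x = mPP x * mBB x - mBP x * mPB x"

lemma not_in_N:
  assumes "x \<notin> N"
  shows "m_trace x \<noteq> 0 \<or> m_det x \<noteq> 0"
proof (rule ccontr)
  assume "\<not> ?thesis"
  then have "x $ Inl u = 0" for u
    using d_not_nilpotent[of "\<lambda>s. x $ Inl s" u]
    by (simp add: m_trace_def m_det_def mPP_def mPB_def mBP_def mBB_def)
  then show False
    using assms by (simp add: N_def)
qed

lemma br_fH: "br x fH = m_trace x *s fH"
  by (simp add: vec_outer_eq_iff m_trace_def)

text \<open>An ideal containing some \<open>x \<notin> N\<close> is not nilpotent: if the trace of \<open>x\<close> is nonzero, all
  terms of its lower central series contain \<open>H\<close>; otherwise \<open>x\<close> acts invertibly on \<open>N / F H\<close>,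
  and they all map onto \<open>N / F H\<close>.\<close>

lemma nilpotent_ideal_subset_N:
  assumes "nilpotent_ideal I"
  shows "I \<subseteq> N"
proof (rule subsetI, rule ccontr)
  fix x assume x: "x \<in> I" "x \<notin> N"
  have I: "ideal I"
    using assms by (simp add: nilpotent_ideal_def)
  obtain k where k: "lower_central_series I k = {0}"
    using assms by (auto simp: nilpotent_ideal_def)
  have br_I: "br x y \<in> I" for y
    using I x by (auto simp: ideal_def)
  have sub: "vec.subspace (lower_central_series I k)" for k
    using I by (cases k) (auto simp: ideal_def subspace_brspan)
  show False
  proof (cases "m_trace x = 0")
    case False
    have fH: "(1 / m_trace x) *s br x fH = fH"
      using False by (simp add: br_fH)
    have "fH \<in> lower_central_series I k" for k
    proof (induction k)
      case 0
      have "(1 / m_trace x) *s br x fH \<in> I"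
        using br_I I by (intro vec.subspace_scale) (auto simp: ideal_def)
      then show ?case
        by (simp add: fH)
    next
      case (Suc k)
      then have "(1 / m_trace x) *s br x fH \<in> lower_central_series I (Suc k)"
        using x by (intro vec.subspace_scale[OF sub]) (simp add: br_in_brspan)
      then show ?case
        by (simp add: fH)
    qed
    from this[of k] show False
      by (auto simp: k vec_outer_eq_iff)
  next
    case True
    then have det: "m_det x \<noteq> 0"
      using not_in_N[OF x(2)] by blast
    \<comment> \<open>\<open>p'\<close> and \<open>b'\<close> come from Cramer's rule and are fixed
      before \<open>h\<close>, because the induction controls members of the series only up to a
      multiple of \<open>fH\<close>.\<close>
    have preimage: "\<exists>p' b'. \<forall>h. \<exists>h'. br x (p' *s fP + b' *s fB + h *s fH) = p *s fP + b *s fB + h' *s fH"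
      for p b
    proof -
      define p' b' where "p' = (mBB x * p - mBP x * b) / m_det x"
        and "b' = (mPP x * b - mPB x * p) / m_det x"
      have "mPP x * p' + mBP x * b' = p * m_det x / m_det x"
        "mPB x * p' + mBB x * b' = b * m_det x / m_det x"
        unfolding p'_def b'_def
        by (simp_all add: m_det_def algebra_simps flip: add_divide_distrib diff_divide_distrib)
      then have "mPP x * p' + mBP x * b' = p" "mPB x * p' + mBB x * b' = b"
        using det by simp_all
      moreover have "p' *s fP + b' *s fB + h *s fH \<in> N" for h
        by (simp add: N_def)
      ultimately have "br x (p' *s fP + b' *s fB + h *s fH) = p *s fP + b *s fB +
          (br x (p' *s fP + b' *s fB + h *s fH) $ Inr iH) *s fH" for h
        by (simp add: vec_outer_eq_iff)
      then show ?thesis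
        by metis
    qed
    have "\<exists>h. p *s fP + b *s fB + h *s fH \<in> lower_central_series I k" for k p b
    proof (induction k arbitrary: p b)
      case 0
      then show ?case
        using preimage br_I by (metis lower_central_series.simps(1))
    next
      case (Suc k)
      obtain p' b' where *: "\<forall>h. \<exists>h'. br x (p' *s fP + b' *s fB + h *s fH) = p *s fP + b *s fB + h' *s fH"
        using preimage by blast
      obtain h where "p' *s fP + b' *s fB + h *s fH \<in> lower_central_series I k"
        using Suc by blast
      then have "br x (p' *s fP + b' *s fB + h *s fH) \<in> lower_central_series I (Suc k)"
        using x by (simp add: br_in_brspan)
      then show ?case
        using * by metis
    qed
    from this[of 1 0 k] show False
      by (auto simp: k vec_outer_eq_iff)
  qed
qed

lemma is_nilradical_N: "is_nilradical N"
  using nilpotent_ideal_N nilpotent_ideal_subset_N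
  unfolding is_nilradical_def maximal_nilpotent_ideal_def by blast

lemma heis_br_component [simp]:
  fixes x y :: "'f ^ heis_index"
  shows "heis_br x y $ iH = x $ iP * y $ iB - x $ iB * y $ iP"
    "heis_br x y $ iP = 0" "heis_br x y $ iB = 0"
  by (simp_all add: heis_br_def bilinear_ext_def UNIV_heis_index axis_def)

lemma isomorphic_onto_N: "isomorphic_onto (*s) heis_br (*s) br N"
  unfolding isomorphic_onto_def
proof (intro exI[of _ heis_incl] conjI allI)
  show "Vector_Spaces.linear (*s) (*s) (heis_incl :: 'f ^ heis_index \<Rightarrow> 'f ^ ('s + heis_index))"
    unfolding Vector_Spaces.linear_iff
    by (simp add: vec.vector_space_axioms vec_outer_eq_iff heis_incl_def)
  show "bij_betw heis_incl UNIV N"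
    unfolding bij_betw_def
  proof
    show "inj (heis_incl :: 'f ^ heis_index \<Rightarrow> 'f ^ ('s + heis_index))"
    proof (rule injI)
      fix x y :: "'f ^ heis_index"
      assume eq: "(heis_incl x :: 'f ^ ('s + heis_index)) = heis_incl y"
      have "(heis_incl x :: 'f ^ ('s + heis_index)) $ Inr j = x $ j" for x :: "'f ^ heis_index" and j
        by (simp add: heis_incl_def)
      from this[of x] this[of y] show "x = y"
        unfolding vec_eq_iff eq by simp
    qed
    have "n = heis_incl (\<chi> j. n $ Inr j)" if "n \<in> N" for n
      using that by (simp add: vec_outer_eq_iff heis_incl_def N_def)
    then show "range heis_incl = N"
      by (auto simp: N_def heis_incl_def)
  qed
  fix x y :: "'f ^ heis_index"
  have "heis_incl x \<in> N" for x
    by (simp add: N_def heis_incl_def)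
  then show "heis_incl (heis_br x y) = br (heis_incl x) (heis_incl y)"
    by (simp add: vec_outer_eq_iff) (simp add: heis_incl_def)
qed

text \<open>Multiplication by \<open>fP\<close> and \<open>fB\<close> extracts multiples of
  \<open>fH\<close> from elements of \<open>N\<close>, so an ideal without \<open>fH\<close> meets
  \<open>N\<close> only in 0. Since all brackets lie in \<open>N\<close>, such an ideal annihilates
  \<open>fP\<close> and \<open>fB\<close> and is itself inside \<open>N\<close>. Hence any two
  nonzero ideals share \<open>fH\<close>.\<close>

lemma nonzero_ideal_contains_fH:
  assumes J: "ideal J" and "J \<noteq> {0}"
  shows "fH \<in> J"
proof (rule ccontr)
  assume fH: "fH \<notin> J"
  have sub: "vec.subspace J" and br_J: "x \<in> J \<Longrightarrow> br y x \<in> J" "x \<in> J \<Longrightarrow> br x y \<in> J" for x y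
    using J by (auto simp: ideal_def)
  have scale_fH: "h = 0" if "h *s fH \<in> J" for h
  proof (rule ccontr)
    assume "h \<noteq> 0"
    then have "fH = (1 / h) *s (h *s fH)"
      by simp
    then show False
      using vec.subspace_scale[OF sub that, of "1 / h"] fH by simp
  qed
  have J_N: "x = 0" if x: "x \<in> J" "x \<in> N" for x
  proof -
    have "br fP x = x $ Inr iB *s fH" "br fB x = (- x $ Inr iP) *s fH"
      using x by (simp_all add: vec_outer_eq_iff)
    then have "x $ Inr iB = 0" "x $ Inr iP = 0"
      using scale_fH br_J(1)[OF x(1)] by (metis, metis neg_equal_0_iff_equal)
    then have "x = x $ Inr iH *s fH"
      using x by (simp add: vec_outer_eq_iff N_def)
    then show ?thesis
      using scale_fH x(1) by (metis vec.scale_zero_left)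
  qed
  have "x = 0" if x: "x \<in> J" for x
  proof -
    have "br x fP = 0" "br x fB = 0"
      using J_N br_J(2)[OF x] by simp_all
    then have "m_trace x = 0" "m_det x = 0"
      by (simp_all add: vec_outer_eq_iff m_trace_def m_det_def)
    then show ?thesis
      using not_in_N J_N x by blast
  qed
  then show False
    using assms vec.subspace_0[OF sub] by blast
qed

lemma indecomposable: indecomposable
proof -
  have "fH \<noteq> 0"
    by (simp add: vec_outer_eq_iff)
  then show ?thesis
    unfolding indecomposable_def using nonzero_ideal_contains_fH by blast
qed

lemma N_neq_UNIV: "N \<noteq> UNIV"
proof
  assume "N = UNIV"
  then have "axis (Inl undefined) 1 \<in> N"
    by blast
  then have "(axis (Inl undefined) 1 :: 'f ^ ('s + heis_index)) $ Inl undefined = 0"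
    unfolding N_def by blast
  then show False
    by simp
qed

lemma indecomposable_solvable_with_nilradical_H1:
  "indecomposable_solvable_with_nilradical_H1 (*s) br span_HPB"
  unfolding indecomposable_solvable_with_nilradical_H1_def N_eq_span_HPB[symmetric]
  using leibniz_algebra_axioms indecomposable solvable is_nilradical_N isomorphic_onto_N N_neq_UNIV
  by blast

text \<open>Makes the normal-form lemmas applicable to the listed algebras, which is how
  coincidences among them are shown.\<close>

sublocale nil: heisenberg_nilradical "(*s)" br N fH fP fB
proof
  show "I \<subseteq> N" if "nilpotent_ideal I" for I
    using that by (rule nilpotent_ideal_subset_N)
  show "N = {h *s fH + p *s fP + b *s fB | h p b. True}"
    by (rule N_eq)
qed (simp_all add: ideal_N solvable vec_outer_eq_iff)

lemma hpb_component:
  "nil.hpb h p b $ Inl s = 0" "nil.hpb h p b $ Inr iH = h" "nil.hpb h p b $ Inr iP = p"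
  "nil.hpb h p b $ Inr iB = b"
  by (simp_all add: nil.hpb_def)

lemma nil_ad:
  "nil.adPP x = mPP x" "nil.adPB x = mPB x" "nil.adBP x = mBP x" "nil.adBB x = mBB x"
    "nil.adPH x = - x $ Inr iB" "nil.adBH x = x $ Inr iP"
  using nil.br_P[of x] nil.br_B[of x] by (simp_all add: vec_outer_eq_iff hpb_component)

text \<open>Left multiplication by an element of \<open>N\<close> leads to \<open>N\<close>, then to
  \<open>FH\<close>, then to 0. Conversely, applying the cube to \<open>fH\<close> forces trace 0,
  and then the cube of the matrix is minus its determinant times the matrix.\<close>

lemma in_N_iff_ad_nilpotent: "x \<in> N \<longleftrightarrow> (\<forall>y. br x (br x (br x y)) = 0)"
proof
  assume "x \<in> N"
  then show "\<forall>y. br x (br x (br x y)) = 0"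
    by (simp add: vec_outer_eq_iff)
next
  assume *: "\<forall>y. br x (br x (br x y)) = 0"
  show "x \<in> N"
  proof (rule ccontr)
    assume "x \<notin> N"
    have tr: "m_trace x = 0"
      using *[rule_format, of fH] by (simp add: br_fH br_scale_right vec_outer_eq_iff)
    then have BB: "mBB x = - mPP x"
      by (simp add: m_trace_def add_eq_0_iff)
    have "mBP x * (mPB x * mPP x) + mPP x * (mPP x * mPP x) = 0"
      "mBP x * (mPB x * mPB x) + mPB x * (mPP x * mPP x) = 0"
      "mBP x * (mBP x * mPB x) + mBP x * (mPP x * mPP x) = 0"
      using *[rule_format, of fP] *[rule_format, of fB]
      by (simp_all add: vec_outer_eq_iff BB algebra_simps)
    then have "m_det x * mPP x = 0" "m_det x * mPB x = 0" "m_det x * mBP x = 0"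
      unfolding m_det_def BB by algebra+
    then have "m_det x = 0"
      by (auto simp: m_det_def)
    then show False
      using not_in_N tr \<open>x \<notin> N\<close> by blast
  qed
qed

text \<open>Given the trace, this relation pins down the determinant by data that a map respecting
  \<open>N\<close> and \<open>FH\<close> transports.\<close>

lemma cayley_hamilton:
  assumes "n \<in> N"
  shows "br x (br x n) - m_trace x *s br x n + m_det x *s n \<in> FH"
  using assms by (simp add: FH_def N_def m_trace_def m_det_def algebra_simps)

end

section \<open>Isomorphism invariants\<close>

lemma (in heisenberg_extension) FH_eq: "FH = {h *s fH | h. True}"
proof
  show "FH \<subseteq> {h *s fH | h. True}"
  proof
    fix n assume n: "n \<in> FH"
    then have "n = n $ Inr iH *s fH"
      by (simp add: FH_def N_def vec_outer_eq_iff)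
    then show "n \<in> {h *s fH | h. True}"
      by blast
  qed
qed (auto simp: FH_def N_def)

text \<open>The third invariant, acting as a scalar on \<open>N\<close> modulo \<open>FH\<close>, is
  there because trace and determinant cannot tell a scalar matrix from a Jordan block.\<close>

lemma heisenberg_extension_isomorphism_invariants:
  fixes d :: "'s::finite \<Rightarrow> heis_index \<Rightarrow> 'f::field_char_0 ^ heis_index"
    and d' :: "'t::finite \<Rightarrow> heis_index \<Rightarrow> 'f ^ heis_index"
  assumes "heisenberg_extension d r" and "heisenberg_extension d' r'"
    and "isomorphic (*s) (ext_br d r) (*s) (ext_br d' r')"
  shows "\<exists>f.
    (\<forall>x. heisenberg_extension.m_trace d' (f x) = heisenberg_extension.m_trace d x) \<and>
    (\<forall>x. heisenberg_extension.m_det d' (f x) = heisenberg_extension.m_det d x) \<and>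
    (\<forall>x c. (\<forall>n\<in>heisenberg_extension.N. ext_br d r x n - c *s n \<in> heisenberg_extension.FH) \<longrightarrow>
      (\<forall>n\<in>heisenberg_extension.N. ext_br d' r' (f x) n - c *s n \<in> heisenberg_extension.FH))"
proof -
  interpret E: heisenberg_extension d r
    by (rule assms)
  interpret E': heisenberg_extension d' r'
    by (rule assms)
  obtain f where "Vector_Spaces.linear (*s) (*s) f" and bij: "bij f"
    and hom: "\<And>x y. f (E.br x y) = E'.br (f x) (f y)"
    using assms(3) unfolding isomorphic_onto_def by blast
  then interpret f: Vector_Spaces.linear "(*s)" "(*s)" f
    by simp
  have inj: "f x = f y \<longleftrightarrow> x = y" for x y
    using bij by (auto simp: bij_def inj_def)
  have surj: "\<exists>x. y = f x" for y
    using bij by (metis bij_pointE)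
  have f_N: "f x \<in> E'.N \<longleftrightarrow> x \<in> E.N" for x
  proof -
    have "E'.br (f x) (E'.br (f x) (E'.br (f x) (f y))) = 0 \<longleftrightarrow> E.br x (E.br x (E.br x y)) = 0" for y
      using inj[of "E.br x (E.br x (E.br x y))" 0] by (simp add: hom f.zero)
    then show ?thesis
      unfolding E.in_N_iff_ad_nilpotent E'.in_N_iff_ad_nilpotent by (metis surj)
  qed
  have "f E.fH \<in> E'.FH"
  proof -
    have "E.fH = E.br E.fP E.fB"
      by (simp add: E.vec_outer_eq_iff)
    then have "f E.fH = E'.br (f E.fP) (f E.fB)"
      by (metis hom)
    then show ?thesis
      using f_N by (simp add: E'.br_N_N)
  qed
  then obtain h where h: "f E.fH = h *s E'.fH"
    using E'.FH_eq by auto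
  have "f E.fH \<noteq> 0"
    using inj[of E.fH 0] by (simp add: f.zero E.vec_outer_eq_iff)
  then have "h \<noteq> 0"
    using h by auto
  have f_FH: "f n \<in> E'.FH" if "n \<in> E.FH" for n
    using that unfolding E.FH_eq E'.FH_eq by (auto simp: f.scale h)
  have tr: "E'.m_trace (f x) = E.m_trace x" for x
  proof -
    have "E'.br (f x) (f E.fH) = f (E.m_trace x *s E.fH)"
      by (simp add: E.br_fH flip: hom)
    then have "(h * E'.m_trace (f x)) *s E'.fH = (E.m_trace x * h) *s E'.fH"
      by (simp add: h E'.br_scale_right E'.br_fH f.scale)
    then show ?thesis
      using \<open>h \<noteq> 0\<close> by (simp add: E'.vec_outer_eq_iff mult.commute)
  qed
  have det: "E'.m_det (f x) = E.m_det x" for x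
  proof -
    obtain n where n: "E'.fP = f n"
      using surj by blast
    then have "n \<in> E.N"
      using f_N[of n] by (simp flip: n)
    then have "f (E.br x (E.br x n) - E.m_trace x *s E.br x n + E.m_det x *s n) \<in> E'.FH"
      by (intro f_FH E.cayley_hamilton)
    then have "E'.br (f x) (E'.br (f x) E'.fP) - E'.m_trace (f x) *s E'.br (f x) E'.fP + E.m_det x *s E'.fP \<in> E'.FH"
      by (simp add: f.add f.diff f.scale hom tr n)
    moreover have "E'.br (f x) (E'.br (f x) E'.fP) - E'.m_trace (f x) *s E'.br (f x) E'.fP + E'.m_det (f x) *s E'.fP \<in> E'.FH"
      by (rule E'.cayley_hamilton) simp
    \<comment> \<open>The two relations differ by the difference of the determinants times
      \<open>fP\<close>, and elements of \<open>FH\<close> have no \<open>P\<close>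
      component.\<close>
    ultimately show ?thesis
      by (simp add: E'.FH_def) (metis add_left_cancel)
  qed
  have "\<forall>n\<in>E'.N. E'.br (f x) n - c *s n \<in> E'.FH" if *: "\<forall>n\<in>E.N. E.br x n - c *s n \<in> E.FH" for x c
  proof
    fix n' assume "n' \<in> E'.N"
    moreover obtain n where n: "n' = f n"
      using surj by blast
    ultimately have "n \<in> E.N"
      using f_N by blast
    then have "f (E.br x n - c *s n) \<in> E'.FH"
      using * f_FH by blast
    then show "E'.br (f x) n' - c *s n' \<in> E'.FH"
      by (simp add: n f.diff f.scale hom)
  qed
  with tr det show ?thesis
    by (intro exI[of _ f] conjI allI impI)
qed

section \<open>The seven tables as extensions\<close>

lemma heisenberg_extension_one_outer:
  fixes d :: "one_outer \<Rightarrow> heis_index \<Rightarrow> 'f::field_char_0 ^ heis_index"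
  assumes d: "d iS iH = (m11 + m22) *s eH" "d iS iP = m11 *s eP + m21 *s eB"
      "d iS iB = m12 *s eP + m22 *s eB"
    and r: "r * (m11 + m22) = 0"
    and not_nilpotent: "m11 + m22 \<noteq> 0 \<or> m11 * m22 - m12 * m21 \<noteq> 0"
  shows "heisenberg_extension d (\<lambda>_ _. r)"
    and "heisenberg_extension.m_trace d x = x $ Inl iS * (m11 + m22)"
    and "heisenberg_extension.m_det d x = (x $ Inl iS)\<^sup>2 * (m11 * m22 - m12 * m21)"
    and "heisenberg_extension.mPP d x = x $ Inl iS * m11"
    and "heisenberg_extension.mPB d x = x $ Inl iS * m21"
    and "heisenberg_extension.mBP d x = x $ Inl iS * m12"
    and "heisenberg_extension.mBB d x = x $ Inl iS * m22"
proof -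
  have iS: "s = iS" for s
    by (cases s) simp
  have comp: "d s iP $ iH = 0" "d s iP $ iP = m11" "d s iP $ iB = m21"
    "d s iB $ iH = 0" "d s iB $ iP = m12" "d s iB $ iB = m22" for s
    by (simp_all add: iS[of s] d axis_def)
  show E: "heisenberg_extension d (\<lambda>_ _. r)"
  proof
    fix c :: "one_outer \<Rightarrow> 'f" and u
    assume "(\<Sum>s\<in>UNIV. c s * d s iP $ iP) + (\<Sum>s\<in>UNIV. c s * d s iB $ iB) = 0"
    then have "c iS * (m11 + m22) = 0"
      by (simp add: comp UNIV_one_outer distrib_left)
    moreover assume "(\<Sum>s\<in>UNIV. c s * d s iP $ iP) * (\<Sum>s\<in>UNIV. c s * d s iB $ iB) -
         (\<Sum>s\<in>UNIV. c s * d s iB $ iP) * (\<Sum>s\<in>UNIV. c s * d s iP $ iB) = 0"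
    then have "c iS * c iS * (m11 * m22 - m12 * m21) = 0"
      by (simp add: comp UNIV_one_outer algebra_simps)
    ultimately show "c u = 0"
      using not_nilpotent by (auto simp: iS[of u])
  next
    show "d s iH = (d s iP $ iP + d s iB $ iB) *s eH" for s
      by (simp add: iS[of s] d(1) comp)
  qed (simp_all add: comp r)
  show m: "heisenberg_extension.mPP d x = x $ Inl iS * m11"
    "heisenberg_extension.mPB d x = x $ Inl iS * m21"
    "heisenberg_extension.mBP d x = x $ Inl iS * m12"
    "heisenberg_extension.mBB d x = x $ Inl iS * m22"
    by (simp_all add: heisenberg_extension.mPP_def[OF E] heisenberg_extension.mPB_def[OF E]
        heisenberg_extension.mBP_def[OF E] heisenberg_extension.mBB_def[OF E] comp UNIV_one_outer)
  show "heisenberg_extension.m_trace d x = x $ Inl iS * (m11 + m22)"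
    "heisenberg_extension.m_det d x = (x $ Inl iS)\<^sup>2 * (m11 * m22 - m12 * m21)"
    by (simp_all add: heisenberg_extension.m_trace_def[OF E] heisenberg_extension.m_det_def[OF E] m
        power2_eq_square algebra_simps)
qed

text \<open>The table rewritten literally as a 2 x 2 matrix with its trace on \<open>iH\<close>, the
  form that \<open>heisenberg_extension_one_outer\<close> expects.\<close>

lemma act1_matrix: "act1 A iS iH = ((1 + A) + (1 - A)) *s eH"
  "act1 A iS iP = (1 + A) *s eP + 0 *s eB" "act1 A iS iB = 0 *s eP + (1 - A) *s eB"
  for A :: "'f::field_char_0"
  by simp_all

lemma act2_matrix: "act2 iS iH = (1 + 1) *s eH"
  "act2 iS iP = 1 *s eP + 1 *s eB" "act2 iS iB = 0 *s eP + (1 :: 'f::field_char_0) *s eB"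
  by simp_all

lemma act3_matrix: "act3 C iS iH = (1 + 1) *s eH"
  "act3 C iS iP = 1 *s eP + C *s eB" "act3 C iS iB = (- C) *s eP + (1 :: 'f::field_char_0) *s eB"
  by simp_all

lemma act4_matrix: "act4 iS iH = (1 + (- 1)) *s eH"
  "act4 iS iP = 1 *s eP + 0 *s eB" "act4 iS iB = 0 *s eP + (- 1 :: 'f::field_char_0) *s eB"
  by simp_all

lemma act5_matrix: "act5 iS iH = (0 + 0) *s eH"
  "act5 iS iP = 0 *s eP + 1 *s eB" "act5 iS iB = (- 1) *s eP + (0 :: 'f::field_char_0) *s eB"
  by simp_all

lemmas heisenberg_extension_act1 = heisenberg_extension_one_outer[where d = "act1 A" and r = 0 and ?m11.0 = "1 + A" and ?m21.0 = "0"
    and ?m12.0 = "0" and ?m22.0 = "1 - A", OF act1_matrix, simplified]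
  for A :: "'f::field_char_0"
lemmas heisenberg_extension_act2 = heisenberg_extension_one_outer[where d = "act2 :: _ \<Rightarrow> _ \<Rightarrow> 'f::field_char_0 ^ heis_index" and r = 0 and ?m11.0 = "1" and ?m21.0 = "1"
    and ?m12.0 = "0" and ?m22.0 = "1", OF act2_matrix, simplified]
lemmas heisenberg_extension_act3 = heisenberg_extension_one_outer[where d = "act3 C" and r = 0 and ?m11.0 = "1" and ?m21.0 = "C"
    and ?m12.0 = "- C" and ?m22.0 = "1", OF act3_matrix, simplified]
  for C :: "'f::field_char_0"
lemmas heisenberg_extension_act4 = heisenberg_extension_one_outer[where d = "act4" and r = r and ?m11.0 = "1" and ?m21.0 = "0"
    and ?m12.0 = "0" and ?m22.0 = "- 1", OF act4_matrix, simplified]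
  for r :: "'f::field_char_0"
lemmas heisenberg_extension_act5 = heisenberg_extension_one_outer[where d = "act5" and r = r and ?m11.0 = "0" and ?m21.0 = "1"
    and ?m12.0 = "- 1" and ?m22.0 = "0", OF act5_matrix, simplified]
  for r :: "'f::field_char_0"

lemma heisenberg_extension_act6: "heisenberg_extension act6 (\<lambda>_ _. 0 :: 'f::field_char_0)"
proof
  fix c :: "two_outer \<Rightarrow> 'f" and u
  let ?d = "act6 :: two_outer \<Rightarrow> heis_index \<Rightarrow> 'f ^ heis_index"
  assume "(\<Sum>s\<in>UNIV. c s * ?d s iP $ iP) + (\<Sum>s\<in>UNIV. c s * ?d s iB $ iB) = 0"
  then have c1: "c iS1 = 0"
    by (simp add: UNIV_two_outer axis_def)
  assume "(\<Sum>s\<in>UNIV. c s * ?d s iP $ iP) * (\<Sum>s\<in>UNIV. c s * ?d s iB $ iB) -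
      (\<Sum>s\<in>UNIV. c s * ?d s iB $ iP) * (\<Sum>s\<in>UNIV. c s * ?d s iP $ iB) = 0"
  with c1 have "c iS2 = 0"
    by (simp add: UNIV_two_outer axis_def)
  with c1 show "c u = 0"
    by (cases u) simp_all
next
  fix s t
  let ?d = "act6 :: two_outer \<Rightarrow> heis_index \<Rightarrow> 'f ^ heis_index"
  show "?d s iH = (?d s iP $ iP + ?d s iB $ iB) *s eH" "?d s iP $ iH = 0" "?d s iB $ iH = 0"
    by (cases s; simp add: axis_def)+
  show "?d s iB $ iP * ?d t iP $ iB = ?d t iB $ iP * ?d s iP $ iB"
    "?d s iP $ iB * (?d t iP $ iP - ?d t iB $ iB) = ?d t iP $ iB * (?d s iP $ iP - ?d s iB $ iB)"
    "?d s iB $ iP * (?d t iP $ iP - ?d t iB $ iB) = ?d t iB $ iP * (?d s iP $ iP - ?d s iB $ iB)"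
    by (cases s; cases t; simp add: axis_def)+
qed simp

lemma heisenberg_extension_act7: "heisenberg_extension act7 (\<lambda>_ _. 0 :: 'f::field_char_0)"
proof
  fix c :: "two_outer \<Rightarrow> 'f" and u
  let ?d = "act7 :: two_outer \<Rightarrow> heis_index \<Rightarrow> 'f ^ heis_index"
  assume "(\<Sum>s\<in>UNIV. c s * ?d s iP $ iP) + (\<Sum>s\<in>UNIV. c s * ?d s iB $ iB) = 0"
  then have c1: "c iS1 = 0"
    by (simp add: UNIV_two_outer axis_def)
  assume "(\<Sum>s\<in>UNIV. c s * ?d s iP $ iP) * (\<Sum>s\<in>UNIV. c s * ?d s iB $ iB) -
      (\<Sum>s\<in>UNIV. c s * ?d s iB $ iP) * (\<Sum>s\<in>UNIV. c s * ?d s iP $ iB) = 0"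
  with c1 have "c iS2 = 0"
    by (simp add: UNIV_two_outer axis_def)
  with c1 show "c u = 0"
    by (cases u) simp_all
next
  fix s t
  let ?d = "act7 :: two_outer \<Rightarrow> heis_index \<Rightarrow> 'f ^ heis_index"
  show "?d s iH = (?d s iP $ iP + ?d s iB $ iB) *s eH" "?d s iP $ iH = 0" "?d s iB $ iH = 0"
    by (cases s; simp add: axis_def)+
  show "?d s iB $ iP * ?d t iP $ iB = ?d t iB $ iP * ?d s iP $ iB"
    "?d s iP $ iB * (?d t iP $ iP - ?d t iB $ iB) = ?d t iP $ iB * (?d s iP $ iP - ?d s iB $ iB)"
    "?d s iB $ iP * (?d t iP $ iP - ?d t iB $ iB) = ?d t iB $ iP * (?d s iP $ iP - ?d s iB $ iB)"
    by (cases s; cases t; simp add: axis_def)+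
qed simp

section \<open>Separating the listed algebras\<close>

lemma two_outer_invariants:
  fixes x :: "'f::field_char_0 space5"
  shows "heisenberg_extension.m_trace act6 x = 2 * x $ Inl iS1"
    "heisenberg_extension.m_trace act7 x = 2 * x $ Inl iS1"
    "heisenberg_extension.m_det act6 x = (x $ Inl iS1)\<^sup>2 - (x $ Inl iS2)\<^sup>2"
    "heisenberg_extension.m_det act7 x = (x $ Inl iS1)\<^sup>2 + (x $ Inl iS2)\<^sup>2"
proof -
  note E = heisenberg_extension_act6[where 'f = 'f] heisenberg_extension_act7[where 'f = 'f]
  show "heisenberg_extension.m_trace act6 x = 2 * x $ Inl iS1"
    "heisenberg_extension.m_det act6 x = (x $ Inl iS1)\<^sup>2 - (x $ Inl iS2)\<^sup>2"
    by (simp_all add: heisenberg_extension.m_trace_def[OF E(1)] heisenberg_extension.m_det_def[OF E(1)]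
        heisenberg_extension.mPP_def[OF E(1)] heisenberg_extension.mPB_def[OF E(1)]
        heisenberg_extension.mBP_def[OF E(1)] heisenberg_extension.mBB_def[OF E(1)]
        UNIV_two_outer axis_def power2_eq_square algebra_simps)
  show "heisenberg_extension.m_trace act7 x = 2 * x $ Inl iS1"
    "heisenberg_extension.m_det act7 x = (x $ Inl iS1)\<^sup>2 + (x $ Inl iS2)\<^sup>2"
    by (simp_all add: heisenberg_extension.m_trace_def[OF E(2)] heisenberg_extension.m_det_def[OF E(2)]
        heisenberg_extension.mPP_def[OF E(2)] heisenberg_extension.mPB_def[OF E(2)]
        heisenberg_extension.mBP_def[OF E(2)] heisenberg_extension.mBB_def[OF E(2)]
        UNIV_two_outer axis_def power2_eq_square algebra_simps)
qed

text \<open>Equal traces fix the outer coordinate of the image of \<open>S\<close> as 1. The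
  determinants \<open>1 - A\<^sup>2\<close> and 1 then leave \<open>A = 0\<close>, where
  \<open>S\<close> acts as a scalar on one side and by a Jordan block on the other.\<close>

lemma not_isomorphic_br1_br2:
  "\<not> isomorphic (*s) (br1 A) (*s) (br2 :: 'f::field_char_0 space4 \<Rightarrow> _)"
proof
  assume iso: "isomorphic (*s) (br1 A) (*s) (br2 :: 'f space4 \<Rightarrow> _)"
  let ?S = "axis (Inl iS) 1 :: 'f space4"
  interpret E1: heisenberg_extension "act1 A" "\<lambda>_ _. 0"
    by (rule heisenberg_extension_act1)
  interpret E2: heisenberg_extension "act2 :: _ \<Rightarrow> _ \<Rightarrow> 'f ^ heis_index" "\<lambda>_ _. 0"
    by (rule heisenberg_extension_act2)
  from heisenberg_extension_isomorphism_invariants[OF E1.heisenberg_extension_axioms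
      E2.heisenberg_extension_axioms iso[unfolded br1_def br2_def]]
  obtain f where tr: "\<forall>x. E2.m_trace (f x) = E1.m_trace x"
    and det: "\<forall>x. E2.m_det (f x) = E1.m_det x"
    and scalar: "\<forall>x c. (\<forall>n\<in>E1.N. E1.br x n - c *s n \<in> E1.FH) \<longrightarrow>
      (\<forall>n\<in>E2.N. E2.br (f x) n - c *s n \<in> E2.FH)"
    by (elim exE conjE)
  have s: "f ?S $ Inl iS = 1"
    using tr[rule_format, of ?S]
    by (simp add: heisenberg_extension_act1 heisenberg_extension_act2)
  have A: "A = 0"
    using det[rule_format, of ?S] s
    by (simp add: heisenberg_extension_act1 heisenberg_extension_act2 algebra_simps)
  have "E1.br ?S n - 1 *s n \<in> E1.FH" if n: "n \<in> E1.N" for n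
  proof -
    have "E1.br ?S n - 1 *s n \<in> E1.N"
      using n by (simp add: E1.N_def)
    then show ?thesis
      using n by (simp add: E1.FH_def) (simp add: heisenberg_extension_act1 A)
  qed
  then have "E2.br (f ?S) E2.fP - 1 *s E2.fP \<in> E2.FH"
    using scalar E2.axis_in_N by blast
  then show False
    by (simp add: E2.FH_def heisenberg_extension_act2 s)
qed

text \<open>Once the trace has fixed the outer coordinate, the determinants are
  \<open>1 - A\<^sup>2\<close> and \<open>1 + C\<^sup>2\<close>.\<close>

lemma not_isomorphic_br1_br3:
  assumes "0 < C"
  shows "\<not> isomorphic (*s) (br1 A) (*s) (br3 (C :: real))"
proof
  assume iso: "isomorphic (*s) (br1 A) (*s) (br3 C)"
  let ?S = "axis (Inl iS) 1 :: real space4"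
  from heisenberg_extension_isomorphism_invariants[OF heisenberg_extension_act1(1)
      heisenberg_extension_act3(1) iso[unfolded br1_def br3_def]]
  obtain f :: "real space4 \<Rightarrow> real space4" where
    tr: "\<forall>x. heisenberg_extension.m_trace (act3 C) (f x) = heisenberg_extension.m_trace (act1 A) x" and
    det: "\<forall>x. heisenberg_extension.m_det (act3 C) (f x) = heisenberg_extension.m_det (act1 A) x"
    by (elim exE conjE)
  have "f ?S $ Inl iS = 1"
    using tr[rule_format, of ?S]
    by (simp add: heisenberg_extension_act1 heisenberg_extension_act3)
  then have "A\<^sup>2 + C\<^sup>2 = 0"
    using det[rule_format, of ?S]
    by (simp add: heisenberg_extension_act1 heisenberg_extension_act3 power2_eq_square algebra_simps)
  then show False
    using assms by (simp add: sum_power2_eq_zero_iff)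
qed

lemma not_isomorphic_br2_br3:
  assumes "0 < C"
  shows "\<not> isomorphic (*s) br2 (*s) (br3 (C :: real))"
proof
  assume iso: "isomorphic (*s) br2 (*s) (br3 C)"
  let ?S = "axis (Inl iS) 1 :: real space4"
  from heisenberg_extension_isomorphism_invariants[OF heisenberg_extension_act2(1)
      heisenberg_extension_act3(1) iso[unfolded br2_def br3_def]]
  obtain f :: "real space4 \<Rightarrow> real space4" where
    tr: "\<forall>x. heisenberg_extension.m_trace (act3 C) (f x) = heisenberg_extension.m_trace act2 x" and
    det: "\<forall>x. heisenberg_extension.m_det (act3 C) (f x) = heisenberg_extension.m_det act2 x"
    by (elim exE conjE)
  have "f ?S $ Inl iS = 1"
    using tr[rule_format, of ?S]
    by (simp add: heisenberg_extension_act2 heisenberg_extension_act3)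
  then have "C = 0"
    using det[rule_format, of ?S]
    by (simp add: heisenberg_extension_act2 heisenberg_extension_act3)
  then show False
    using assms by simp
qed

text \<open>Determinants are minus squares in the first algebra and squares in the second.\<close>

lemma not_isomorphic_br4_br5: "\<not> isomorphic (*s) (br4 (0 :: real)) (*s) (br5 0)"
proof
  assume iso: "isomorphic (*s) (br4 (0 :: real)) (*s) (br5 0)"
  let ?S = "axis (Inl iS) 1 :: real space4"
  from heisenberg_extension_isomorphism_invariants[OF heisenberg_extension_act4(1)
      heisenberg_extension_act5(1) iso[unfolded br4_def br5_def]]
  obtain f :: "real space4 \<Rightarrow> real space4" where
    "\<forall>x. heisenberg_extension.m_det act5 (f x) = heisenberg_extension.m_det act4 x"
    by (elim exE conjE)
  from this[rule_format, of ?S] have "(f ?S $ Inl iS)\<^sup>2 = - 1"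
    by (simp add: heisenberg_extension_act4 heisenberg_extension_act5)
  then show False
    by (metis neg_0_le_iff_le not_one_le_zero zero_le_power2)
qed

text \<open>On elements of trace zero the determinant is minus a square in the first algebra and a
  square in the second.\<close>

lemma not_isomorphic_br6_br7: "\<not> isomorphic (*s) (br6 :: real space5 \<Rightarrow> _) (*s) br7"
proof
  assume iso: "isomorphic (*s) (br6 :: real space5 \<Rightarrow> _) (*s) br7"
  let ?S = "axis (Inl iS2) 1 :: real space5"
  from heisenberg_extension_isomorphism_invariants[OF heisenberg_extension_act6
      heisenberg_extension_act7 iso[unfolded br6_def br7_def]]
  obtain f :: "real space5 \<Rightarrow> real space5" where
    tr: "\<forall>x. heisenberg_extension.m_trace act7 (f x) = heisenberg_extension.m_trace act6 x" and
    det: "\<forall>x. heisenberg_extension.m_det act7 (f x) = heisenberg_extension.m_det act6 x"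
    by (elim exE conjE)
  have "f ?S $ Inl iS1 = 0"
    using tr[rule_format, of ?S]
    by (simp add: two_outer_invariants axis_def)
  then have "(f ?S $ Inl iS2)\<^sup>2 = - 1"
    using det[rule_format, of ?S]
    by (simp add: two_outer_invariants axis_def)
  then show False
    by (metis neg_0_le_iff_le not_one_le_zero zero_le_power2)
qed

section \<open>Membership of the listed algebras\<close>

lemma br1_membership:
  "indecomposable_solvable_with_nilradical_H1 (*s) (br1 (A :: 'f::field_char_0)) span_HPB"
  unfolding br1_def
  by (rule heisenberg_extension.indecomposable_solvable_with_nilradical_H1[OF heisenberg_extension_act1(1)])

lemma br2_membership:
  "indecomposable_solvable_with_nilradical_H1 (*s) (br2 :: 'f::field_char_0 space4 \<Rightarrow> _) span_HPB"
  unfolding br2_def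
  by (rule heisenberg_extension.indecomposable_solvable_with_nilradical_H1[OF heisenberg_extension_act2(1)])

lemma br3_membership:
  "indecomposable_solvable_with_nilradical_H1 (*s) (br3 (C :: 'f::field_char_0)) span_HPB"
  unfolding br3_def
  by (rule heisenberg_extension.indecomposable_solvable_with_nilradical_H1[OF heisenberg_extension_act3(1)])

lemma br4_membership:
  "indecomposable_solvable_with_nilradical_H1 (*s) (br4 (r :: 'f::field_char_0)) span_HPB"
  unfolding br4_def
  by (rule heisenberg_extension.indecomposable_solvable_with_nilradical_H1[OF heisenberg_extension_act4(1)])

lemma br5_membership:
  "indecomposable_solvable_with_nilradical_H1 (*s) (br5 (r :: 'f::field_char_0)) span_HPB"
  unfolding br5_def
  by (rule heisenberg_extension.indecomposable_solvable_with_nilradical_H1[OF heisenberg_extension_act5(1)])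

lemma br6_membership:
  "indecomposable_solvable_with_nilradical_H1 (*s) (br6 :: 'f::field_char_0 space5 \<Rightarrow> _) span_HPB"
  unfolding br6_def
  by (rule heisenberg_extension.indecomposable_solvable_with_nilradical_H1[OF heisenberg_extension_act6])

lemma br7_membership:
  "indecomposable_solvable_with_nilradical_H1 (*s) (br7 :: 'f::field_char_0 space5 \<Rightarrow> _) span_HPB"
  unfolding br7_def
  by (rule heisenberg_extension.indecomposable_solvable_with_nilradical_H1[OF heisenberg_extension_act7])

section \<open>Classification over the two fields\<close>

lemma nilradical_H1_imp_heisenberg_nilradical:
  fixes sc :: "'f::field_char_0 \<Rightarrow> 'v::ab_group_add \<Rightarrow> 'v"
  assumes "indecomposable_solvable_with_nilradical_H1 sc b N"
  shows "\<exists>H P B. heisenberg_nilradical sc b N H P B"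
proof -
  interpret leibniz_algebra sc b
    using assms by (simp add: indecomposable_solvable_with_nilradical_H1_def)
  have nil: "is_nilradical N" and solv: solvable
    using assms by (simp_all add: indecomposable_solvable_with_nilradical_H1_def)
  obtain f where "Vector_Spaces.linear (*s) sc f" and bij: "bij_betw f UNIV N"
    and hom: "\<And>x y. f (heis_br x y) = b (f x) (f y)"
    using assms unfolding indecomposable_solvable_with_nilradical_H1_def isomorphic_onto_def by blast
  then interpret f: Vector_Spaces.linear "(*s)" sc f
    by simp
  have v: "v = v $ iH *s eH + v $ iP *s eP + v $ iB *s eB" for v :: "'f ^ heis_index"
  proof -
    have "v $ j = (v $ iH *s eH + v $ iP *s eP + v $ iB *s eB) $ j" for j
      by (cases j) (simp_all add: axis_def)
    then show ?thesis
      unfolding vec_eq_iff by blast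
  qed
  have f: "f v = sc (v $ iH) (f eH) + sc (v $ iP) (f eP) + sc (v $ iB) (f eB)" for v
    by (subst v) (simp only: f.add f.scale)
  have table: "b (f (axis i 1)) (f (axis j 1)) = f (heis_table i j)" for i j
    by (simp add: heis_br_def bilinear_ext_axis flip: hom)
  have "heisenberg_nilradical sc b N (f eH) (f eP) (f eB)"
  proof
    show "nilpotent_ideal I \<Longrightarrow> I \<subseteq> N" for I
      by (rule nilpotent_ideal_subset_nilradical[OF nil])
    show "ideal N"
      using nil by (simp add: is_nilradical_def maximal_nilpotent_ideal_def nilpotent_ideal_def)
    show "N = {sc h (f eH) + sc p (f eP) + sc b (f eB) | h p b. True}"
    proof
      show "N \<subseteq> {sc h (f eH) + sc p (f eP) + sc b (f eB) | h p b. True}"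
      proof
        fix n assume "n \<in> N"
        then obtain v where "n = f v"
          using bij by (auto simp: bij_betw_def)
        then show "n \<in> {sc h (f eH) + sc p (f eP) + sc b (f eB) | h p b. True}"
          using f[of v] by blast
      qed
      have "sc h (f eH) + sc p (f eP) + sc b (f eB) = f (h *s eH + p *s eP + b *s eB)" for h p b
        by (simp add: f.add f.scale)
      then show "{sc h (f eH) + sc p (f eP) + sc b (f eB) | h p b. True} \<subseteq> N"
        using bij by (auto simp: bij_betw_def)
    qed
    show "h = 0 \<and> p = 0 \<and> c = 0" if "sc h (f eH) + sc p (f eP) + sc c (f eB) = 0" for h p c
    proof -
      have "f (h *s eH + p *s eP + c *s eB) = f 0"
        using that by (simp add: f.add f.scale f.zero)
      then have 0: "h *s eH + p *s eP + c *s eB = 0"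
        using bij by (auto simp: bij_betw_def inj_def)
      have "h = (h *s eH + p *s eP + c *s eB) $ iH" "p = (h *s eH + p *s eP + c *s eB) $ iP"
        "c = (h *s eH + p *s eP + c *s eB) $ iB"
        by (simp_all add: axis_def)
      then show ?thesis
        unfolding 0 by simp
    qed
  qed (simp_all add: solv table f.zero f.neg)
  then show ?thesis
    by blast
qed

lemma real_classification:
  fixes sc :: "real \<Rightarrow> 'v::ab_group_add \<Rightarrow> 'v"
  assumes "indecomposable_solvable_with_nilradical_H1 sc b N"
  shows "vector_space.dim sc UNIV \<in> {4, 5} \<and>
    (vector_space.dim sc UNIV = 4 \<longrightarrow>
       (\<exists>A\<ge>0. isomorphic sc b (*s) (br1 A)) \<or>
       isomorphic sc b (*s) br2 \<or>
       (\<exists>C>0. isomorphic sc b (*s) (br3 C)) \<or>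
       (\<exists>r\<in>{0, 1, -1}. isomorphic sc b (*s) (br4 r)) \<or>
       (\<exists>r\<in>{0, 1, -1}. isomorphic sc b (*s) (br5 r))) \<and>
    (vector_space.dim sc UNIV = 5 \<longrightarrow>
       (isomorphic sc b (*s) br6 \<or> isomorphic sc b (*s) br7) \<and> leibniz_algebra.lie b)"
proof -
  obtain H P B where nil: "heisenberg_nilradical sc b N H P B"
    using nilradical_H1_imp_heisenberg_nilradical[OF assms] by blast
  interpret heisenberg_nilradical sc b N H P B
    by (rule nil)
  \<comment> \<open>Scaling reduces the determinant to its sign, which decides between (4) and (5)
    and between (6) and (7).\<close>
  have root: "\<exists>\<sigma>. \<sigma>\<^sup>2 * \<delta> = - 1 \<or> \<sigma>\<^sup>2 * \<delta> = 1" if "\<delta> \<noteq> 0" for \<delta> :: real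
    using that by (intro exI[of _ "1 / sqrt \<bar>\<delta>\<bar>"]) (auto simp: power_divide abs_if)
  have "N \<noteq> UNIV"
    using assms by (simp add: indecomposable_solvable_with_nilradical_H1_def)
  then consider S where "one_dim_quotient S" | S1 S2 where "two_dim_quotient S1 S2"
    using one_or_two_dim_quotient by blast
  then show ?thesis
  proof cases
    case (1 S)
    have "(\<exists>A\<ge>0. isomorphic sc b (*s) (br1 A)) \<or> isomorphic sc b (*s) br2 \<or>
       (\<exists>C>0. isomorphic sc b (*s) (br3 C)) \<or>
       (\<exists>r\<in>{0, 1, -1}. isomorphic sc b (*s) (br4 r)) \<or>
       (\<exists>r\<in>{0, 1, -1}. isomorphic sc b (*s) (br5 r))"
      using classification_one_dim_quotient[OF 1]
    proof (elim disjE exE conjE)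
      fix D :: real
      assume br1: "\<forall>A. A\<^sup>2 = D \<longrightarrow> isomorphic sc b (*s) (br1 A) \<or> isomorphic sc b (*s) br2"
        and br3: "\<forall>C. C\<^sup>2 = - D \<and> C \<noteq> 0 \<longrightarrow> isomorphic sc b (*s) (br3 C)"
      show ?thesis
      \<comment> \<open>The sign of the discriminant separates real eigenvalues from a conjugate
        pair.\<close>
      proof (cases "D \<ge> 0")
        case True
        then have "0 \<le> sqrt D" "(sqrt D)\<^sup>2 = D"
          by simp_all
        with br1 show ?thesis
          by blast
      next
        case False
        then have "0 < sqrt (- D)" "(sqrt (- D))\<^sup>2 = - D" "sqrt (- D) \<noteq> 0"
          by simp_all
        with br3 show ?thesis
          by blast
      qed
    next
      fix \<delta> :: real
      assume "\<delta> \<noteq> 0"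
        and br4: "\<forall>\<sigma>. \<sigma>\<^sup>2 * \<delta> = - 1 \<longrightarrow> (\<exists>r\<in>{0, 1}. isomorphic sc b (*s) (br4 r))"
        and br5: "\<forall>\<sigma>. \<sigma>\<^sup>2 * \<delta> = 1 \<longrightarrow>
          (\<exists>\<rho>. \<forall>\<kappa>. \<kappa> \<noteq> 0 \<longrightarrow> isomorphic sc b (*s) (br5 (\<rho> / \<kappa>\<^sup>2)))"
      from root[OF \<open>\<delta> \<noteq> 0\<close>] obtain \<sigma> where "\<sigma>\<^sup>2 * \<delta> = - 1 \<or> \<sigma>\<^sup>2 * \<delta> = 1"
        by blast
      then show ?thesis
      proof
        assume "\<sigma>\<^sup>2 * \<delta> = - 1"
        with br4 show ?thesis
          by blast
      next
        assume "\<sigma>\<^sup>2 * \<delta> = 1"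
        with br5 obtain \<rho> where \<rho>: "\<kappa> \<noteq> 0 \<Longrightarrow> isomorphic sc b (*s) (br5 (\<rho> / \<kappa>\<^sup>2))" for \<kappa>
          by blast
        \<comment> \<open>\<kappa> absorbs the absolute value of \<rho>.\<close>
        have "\<exists>\<kappa>. \<kappa> \<noteq> 0 \<and> \<rho> / \<kappa>\<^sup>2 \<in> {0, 1, -1}"
        proof (cases "\<rho> = 0")
          case False
          then show ?thesis
            by (intro exI[of _ "sqrt \<bar>\<rho>\<bar>"]) (simp add: abs_if)
        qed (auto intro: exI[of _ 1])
        with \<rho> show ?thesis
          by blast
      qed
    qed
    then show ?thesis
      using dim_one_dim_quotient[OF 1] by simp
  next
    case (2 S1 S2)
    obtain \<delta> :: real where \<delta>: "\<delta> \<noteq> 0" "\<And>\<sigma>. \<sigma>\<^sup>2 * \<delta> = - 1 \<Longrightarrow> isomorphic sc b (*s) br6"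
      "\<And>\<sigma>. \<sigma>\<^sup>2 * \<delta> = 1 \<Longrightarrow> isomorphic sc b (*s) br7"
      using classification_two_dim_quotient[OF 2] by blast
    have lie
      unfolding lie_def using br_antisym_two_dim_quotient[OF 2] by blast
    with \<delta> root[OF \<delta>(1)] show ?thesis
      using dim_two_dim_quotient[OF 2] by auto
  qed
qed

lemma complex_classification:
  fixes sc :: "complex \<Rightarrow> 'v::ab_group_add \<Rightarrow> 'v"
  assumes "indecomposable_solvable_with_nilradical_H1 sc b N"
  shows "vector_space.dim sc UNIV \<in> {4, 5} \<and>
    (vector_space.dim sc UNIV = 4 \<longrightarrow>
       (\<exists>A. complex_nonneg A \<and> isomorphic sc b (*s) (br1 A)) \<or>
       isomorphic sc b (*s) br2 \<or>
       (\<exists>r\<in>{0, 1}. isomorphic sc b (*s) (br4 r))) \<and>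
    (vector_space.dim sc UNIV = 5 \<longrightarrow> isomorphic sc b (*s) br6 \<and> leibniz_algebra.lie b)"
proof -
  obtain H P B where nil: "heisenberg_nilradical sc b N H P B"
    using nilradical_H1_imp_heisenberg_nilradical[OF assms] by blast
  interpret heisenberg_nilradical sc b N H P B
    by (rule nil)
  \<comment> \<open>A root of \<open>- 1 / \<delta>\<close> always exists here, so (4) and (6) are
    reached whatever \<delta> is.\<close>
  have root: "(csqrt (- 1 / \<delta>))\<^sup>2 * \<delta> = - 1" if "\<delta> \<noteq> 0" for \<delta>
    using that by simp
  have "N \<noteq> UNIV"
    using assms by (simp add: indecomposable_solvable_with_nilradical_H1_def)
  then consider S where "one_dim_quotient S" | S1 S2 where "two_dim_quotient S1 S2"
    using one_or_two_dim_quotient by blast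
  then show ?thesis
  proof cases
    case (1 S)
    have "(\<exists>A. complex_nonneg A \<and> isomorphic sc b (*s) (br1 A)) \<or> isomorphic sc b (*s) br2 \<or>
       (\<exists>r\<in>{0, 1}. isomorphic sc b (*s) (br4 r))"
      using classification_one_dim_quotient[OF 1]
    proof (elim disjE exE conjE)
      fix D :: complex
      assume br1: "\<forall>A. A\<^sup>2 = D \<longrightarrow> isomorphic sc b (*s) (br1 A) \<or> isomorphic sc b (*s) br2"
      have "complex_nonneg (csqrt D)"
        using csqrt_principal[of D] by (simp add: complex_nonneg_def)
      with br1[rule_format, of "csqrt D"] show ?thesis
        by auto
    next
      fix \<delta> :: complex
      assume "\<delta> \<noteq> 0"
        and br4: "\<forall>\<sigma>. \<sigma>\<^sup>2 * \<delta> = - 1 \<longrightarrow> (\<exists>r\<in>{0, 1}. isomorphic sc b (*s) (br4 r))"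
      with root show ?thesis
        by blast
    qed
    then show ?thesis
      using dim_one_dim_quotient[OF 1] by simp
  next
    case (2 S1 S2)
    obtain \<delta> :: complex where \<delta>: "\<delta> \<noteq> 0" "\<And>\<sigma>. \<sigma>\<^sup>2 * \<delta> = - 1 \<Longrightarrow> isomorphic sc b (*s) br6"
      using classification_two_dim_quotient[OF 2] by blast
    have lie
      unfolding lie_def using br_antisym_two_dim_quotient[OF 2] by blast
    with \<delta>(2)[OF root[OF \<delta>(1)]] show ?thesis
      using dim_two_dim_quotient[OF 2] by auto
  qed
qed

section \<open>Coincidences in the presence of a square root of -1\<close>

lemma (in heisenberg_extension) one_dim_quotient_axis:
  assumes "CARD('s) = 1"
  shows "nil.one_dim_quotient (axis (Inl s) 1)"
proof -
  have s: "t = s" for t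
    using assms by (metis UNIV_I card_1_singletonE singletonD)
  have "y - y $ Inl s *s axis (Inl s) 1 \<in> N" for y
  proof -
    have "(y - y $ Inl s *s axis (Inl s) 1) $ Inl t = 0" for t
      unfolding s[of t] by simp
    then show ?thesis
      unfolding N_def by blast
  qed
  moreover have "axis (Inl s) 1 \<notin> N"
  proof
    assume "axis (Inl s) 1 \<in> N"
    then have "(axis (Inl s) 1 :: 'f ^ ('s + heis_index)) $ Inl s = 0"
      unfolding N_def by blast
    then show False
      by simp
  qed
  ultimately show ?thesis
    unfolding nil.one_dim_quotient_def by blast
qed

lemma br3_isomorphic_br1:
  assumes "A\<^sup>2 = - (C\<^sup>2)" "C \<noteq> 0"
  shows "isomorphic (*s) (br3 C) (*s) (br1 (A :: 'f::field_char_0))"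
proof -
  interpret heisenberg_extension "act3 C" "\<lambda>_ _. 0"
    by (rule heisenberg_extension_act3)
  let ?S = "axis (Inl iS) 1 :: 'f space4"
  have S: "nil.one_dim_quotient ?S" "nil.adPH ?S = 0" "nil.adBH ?S = 0" "br ?S ?S = nil.hpb 0 0 0"
    by (auto simp: one_dim_quotient_axis CARD_outer nil_ad vec_outer_eq_iff hpb_component rH_def)
      (simp_all add: axis_def)
  \<comment> \<open>A square root of -1. The vectors with coordinates \<open>(1, - \<kappa>)\<close>
    and \<open>(1, \<kappa>)\<close> are eigenvectors for \<open>1 + A\<close> and
    \<open>1 - A\<close>.\<close>
  define \<kappa> where "\<kappa> = A / C"
  have \<kappa>: "A * \<kappa> = - C" "C * \<kappa> = A"
    using assms by (simp_all add: \<kappa>_def power2_eq_square)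
  then have "\<kappa> \<noteq> 0"
    using assms by auto
  then show ?thesis
    unfolding br1_def br3_def
    by (intro nil.isomorphic_one_outer[where \<sigma> = 1 and \<alpha> = 1 and \<beta> = "- \<kappa>"
          and \<gamma> = 1 and \<epsilon> = \<kappa> and ?m11.0 = "1 + A" and ?m21.0 = 0
          and ?m12.0 = 0 and ?m22.0 = "1 - A", OF S])
       (use \<kappa> in \<open>simp_all add: nil_ad heisenberg_extension_act3 nil.ad_trace_def algebra_simps\<close>)
qed

lemma br5_isomorphic_br4: "isomorphic (*s) (br5 (0 :: complex)) (*s) (br4 0)"
proof -
  interpret heisenberg_extension "act5 :: _ \<Rightarrow> _ \<Rightarrow> complex ^ heis_index" "\<lambda>_ _. 0"
    by (rule heisenberg_extension_act5)
  let ?S = "axis (Inl iS) 1 :: complex space4"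
  have S: "nil.one_dim_quotient ?S" "nil.adPH ?S = 0" "nil.adBH ?S = 0" "br ?S ?S = nil.hpb 0 0 0"
    by (auto simp: one_dim_quotient_axis CARD_outer nil_ad vec_outer_eq_iff hpb_component rH_def)
      (simp_all add: axis_def)
  \<comment> \<open>The rotation has eigenvalues \<open>\<i>\<close> and \<open>- \<i>\<close>; the
    factor \<open>- \<i>\<close> turns them into 1 and -1.\<close>
  show ?thesis
    unfolding br4_def br5_def
    by (rule nil.isomorphic_one_outer[where \<sigma> = "- \<i>" and \<alpha> = 1 and \<beta> = "- \<i>"
          and \<gamma> = 1 and \<epsilon> = "\<i>" and ?m11.0 = 1 and ?m21.0 = 0
          and ?m12.0 = 0 and ?m22.0 = "- 1", OF S])
       (simp_all add: nil_ad heisenberg_extension_act5 nil.ad_trace_def)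
qed

lemma br7_isomorphic_br6: "isomorphic (*s) (br7 :: complex space5 \<Rightarrow> _) (*s) br6"
proof -
  interpret heisenberg_extension "act7 :: _ \<Rightarrow> _ \<Rightarrow> complex ^ heis_index" "\<lambda>_ _. 0"
    by (rule heisenberg_extension_act7)
  let ?S1 = "axis (Inl iS1) 1 :: complex space5" and ?S2 = "axis (Inl iS2) 1 :: complex space5"
  have m: "mPP ?S1 = 1" "mPB ?S1 = 0" "mBP ?S1 = 0" "mBB ?S1 = 1"
    "mPP ?S2 = 0" "mPB ?S2 = 1" "mBP ?S2 = - 1" "mBB ?S2 = 0"
    by (simp_all add: mPP_def mPB_def mBP_def mBB_def UNIV_two_outer axis_def)
  have H: "nil.adPH ?S1 = 0" "nil.adBH ?S1 = 0" "nil.adPH ?S2 = 0" "nil.adBH ?S2 = 0"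
    unfolding nil_ad by (simp_all add: axis_def)
  have "y - y $ Inl iS1 *s ?S1 - y $ Inl iS2 *s ?S2 \<in> N" for y
  proof -
    have "(y - y $ Inl iS1 *s ?S1 - y $ Inl iS2 *s ?S2) $ Inl s = 0" for s
      by (cases s) (simp_all add: axis_def)
    then show ?thesis
      by (simp add: N_def)
  qed
  then have "nil.two_dim_quotient ?S1 ?S2"
    unfolding nil.two_dim_quotient_def nil.ad_trace_def nil.ad_det_def nil_ad m by auto
  then show ?thesis
    unfolding br6_def br7_def
    by (rule nil.isomorphic_two_outer[where \<sigma> = "- \<i>" and \<alpha> = 1 and \<beta> = "- \<i>"
          and \<gamma> = 1 and \<epsilon> = "\<i>" and ?m11.0 = 1 and ?m21.0 = 0
          and ?m12.0 = 0 and ?m22.0 = "- 1", OF _ H])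
       (simp_all add: nil_ad m)
qed

theorem mainTheorem2:
  fixes scR :: "real \<Rightarrow> 'v::ab_group_add \<Rightarrow> 'v" and bR :: "'v \<Rightarrow> 'v \<Rightarrow> 'v" and NR :: "'v set"
    and scC :: "complex \<Rightarrow> 'w::ab_group_add \<Rightarrow> 'w" and bC :: "'w \<Rightarrow> 'w \<Rightarrow> 'w" and NC :: "'w set"
  shows
    \<comment> \<open>classification over the reals\<close>
    "(indecomposable_solvable_with_nilradical_H1 scR bR NR \<longrightarrow>
        vector_space.dim scR UNIV \<in> {4, 5} \<and>
        (vector_space.dim scR UNIV = 4 \<longrightarrow>
           (\<exists>A\<ge>0. isomorphic scR bR (*s) (br1 A)) \<or>
           isomorphic scR bR (*s) br2 \<or>
           (\<exists>C>0. isomorphic scR bR (*s) (br3 C)) \<or>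
           (\<exists>r\<in>{0, 1, -1}. isomorphic scR bR (*s) (br4 r)) \<or>
           (\<exists>r\<in>{0, 1, -1}. isomorphic scR bR (*s) (br5 r))) \<and>
        (vector_space.dim scR UNIV = 5 \<longrightarrow>
           (isomorphic scR bR (*s) br6 \<or> isomorphic scR bR (*s) br7) \<and>
           leibniz_algebra.lie bR)) \<and>
     \<comment> \<open>classification over the complex numbers\<close>
     (indecomposable_solvable_with_nilradical_H1 scC bC NC \<longrightarrow>
        vector_space.dim scC UNIV \<in> {4, 5} \<and>
        (vector_space.dim scC UNIV = 4 \<longrightarrow>
           (\<exists>A. complex_nonneg A \<and> isomorphic scC bC (*s) (br1 A)) \<or>
           isomorphic scC bC (*s) br2 \<or>
           (\<exists>r\<in>{0, 1}. isomorphic scC bC (*s) (br4 r))) \<and>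
        (vector_space.dim scC UNIV = 5 \<longrightarrow>
           isomorphic scC bC (*s) br6 \<and>
           leibniz_algebra.lie bC)) \<and>
     \<comment> \<open>the listed algebras belong to the classification, with nilradical spanned by \<open>H, P, B\<close>\<close>
     (\<forall>A\<ge>0. indecomposable_solvable_with_nilradical_H1 (*s) (br1 (A::real)) span_HPB) \<and>
     indecomposable_solvable_with_nilradical_H1 (*s) (br2 :: real space4 \<Rightarrow> _) span_HPB \<and>
     (\<forall>C>0. indecomposable_solvable_with_nilradical_H1 (*s) (br3 (C::real)) span_HPB) \<and>
     (\<forall>r\<in>{0, 1, -1}. indecomposable_solvable_with_nilradical_H1 (*s) (br4 (r::real)) span_HPB) \<and>
     (\<forall>r\<in>{0, 1, -1}. indecomposable_solvable_with_nilradical_H1 (*s) (br5 (r::real)) span_HPB) \<and>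
     indecomposable_solvable_with_nilradical_H1 (*s) (br6 :: real space5 \<Rightarrow> _) span_HPB \<and>
     indecomposable_solvable_with_nilradical_H1 (*s) (br7 :: real space5 \<Rightarrow> _) span_HPB \<and>
     (\<forall>A. complex_nonneg A \<longrightarrow> indecomposable_solvable_with_nilradical_H1 (*s) (br1 A) span_HPB) \<and>
     indecomposable_solvable_with_nilradical_H1 (*s) (br2 :: complex space4 \<Rightarrow> _) span_HPB \<and>
     (\<forall>r\<in>{0, 1}. indecomposable_solvable_with_nilradical_H1 (*s) (br4 (r::complex)) span_HPB) \<and>
     indecomposable_solvable_with_nilradical_H1 (*s) (br6 :: complex space5 \<Rightarrow> _) span_HPB \<and>
     \<comment> \<open>(1), (2), (3)\<close>
     (\<forall>A. complex_nonneg A \<longrightarrow> \<not> isomorphic (*s) (br1 A) (*s) br2) \<and>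
     (\<forall>A\<ge>0. \<not> isomorphic (*s) (br1 (A::real)) (*s) br2) \<and>
     (\<forall>A\<ge>0. \<forall>C>0. \<not> isomorphic (*s) (br1 (A::real)) (*s) (br3 C)) \<and>
     (\<forall>C>0. \<not> isomorphic (*s) br2 (*s) (br3 (C::real))) \<and>
     (\<forall>C. complex_pos C \<longrightarrow> (\<exists>A. complex_nonneg A \<and> isomorphic (*s) (br3 C) (*s) (br1 A))) \<and>
     \<comment> \<open>(4), (5) for \<open>r = 0\<close>\<close>
     \<not> isomorphic (*s) (br4 (0::real)) (*s) (br5 0) \<and>
     isomorphic (*s) (br5 (0::complex)) (*s) (br4 0) \<and>
     \<comment> \<open>(6), (7)\<close>
     \<not> isomorphic (*s) (br6 :: real space5 \<Rightarrow> _) (*s) br7 \<and>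
     isomorphic (*s) (br7 :: complex space5 \<Rightarrow> _) (*s) br6"
proof (intro conjI)
  show "indecomposable_solvable_with_nilradical_H1 scR bR NR \<longrightarrow>
        vector_space.dim scR UNIV \<in> {4, 5} \<and>
        (vector_space.dim scR UNIV = 4 \<longrightarrow>
           (\<exists>A\<ge>0. isomorphic scR bR (*s) (br1 A)) \<or>
           isomorphic scR bR (*s) br2 \<or>
           (\<exists>C>0. isomorphic scR bR (*s) (br3 C)) \<or>
           (\<exists>r\<in>{0, 1, -1}. isomorphic scR bR (*s) (br4 r)) \<or>
           (\<exists>r\<in>{0, 1, -1}. isomorphic scR bR (*s) (br5 r))) \<and>
        (vector_space.dim scR UNIV = 5 \<longrightarrow>
           (isomorphic scR bR (*s) br6 \<or> isomorphic scR bR (*s) br7) \<and>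
           leibniz_algebra.lie bR)"
    by (rule impI) (rule real_classification)
  show "indecomposable_solvable_with_nilradical_H1 scC bC NC \<longrightarrow>
        vector_space.dim scC UNIV \<in> {4, 5} \<and>
        (vector_space.dim scC UNIV = 4 \<longrightarrow>
           (\<exists>A. complex_nonneg A \<and> isomorphic scC bC (*s) (br1 A)) \<or>
           isomorphic scC bC (*s) br2 \<or>
           (\<exists>r\<in>{0, 1}. isomorphic scC bC (*s) (br4 r))) \<and>
        (vector_space.dim scC UNIV = 5 \<longrightarrow>
           isomorphic scC bC (*s) br6 \<and>
           leibniz_algebra.lie bC)"
    by (rule impI) (rule complex_classification)
  show "\<forall>C. complex_pos C \<longrightarrow> (\<exists>A. complex_nonneg A \<and> isomorphic (*s) (br3 C) (*s) (br1 A))"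
  proof (intro allI impI)
    fix C assume "complex_pos C"
    \<comment> \<open>Either root of \<open>- (C\<^sup>2)\<close> would give an isomorphism; the
      principal one meets the normalisation of the parameter.\<close>
    then have "isomorphic (*s) (br3 C) (*s) (br1 (csqrt (- (C\<^sup>2))))"
      by (intro br3_isomorphic_br1) (simp_all add: complex_pos_def)
    moreover have "complex_nonneg (csqrt (- (C\<^sup>2)))"
      using csqrt_principal unfolding complex_nonneg_def by blast
    ultimately show "\<exists>A. complex_nonneg A \<and> isomorphic (*s) (br3 C) (*s) (br1 A)"
      by blast
  qed
qed (use br1_membership br2_membership br3_membership br4_membership br5_membership
    br6_membership br7_membership not_isomorphic_br1_br2 not_isomorphic_br1_br3
    not_isomorphic_br2_br3 not_isomorphic_br4_br5 not_isomorphic_br6_br7 br5_isomorphic_br4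
    br7_isomorphic_br6 in blast)+

end
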